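(* Let $\delta\in(0,1)$, $T\ge 1$, $\iota=\log(3A_{\mathcal X}/\delta)$, and run Balanced-FTRL for the max-player with IX parameters $\gamma_h=\sqrt{H\iota/(2A_{\mathcal X}T)}$ for all $h\in[H]$, against an arbitrary (possibly adaptive) sequence of opponent policies $(\nu^t)_{t\in[T]}$. (i) With the Tsallis regularizer of parameter $\alpha\in(0,1)$ and learning rates $\eta_h=\sqrt{2\alpha(1-\alpha)/T}\,(H/A_{\mathcal X})^{\alpha-1/2}$ for all $h$, with probability at least $1-\delta$, $$\mathrm{Reg}^T_{\max}\le\Big(\sqrt{2/(\alpha(1-\alpha))}+3\sqrt{2\iota}\Big)\sqrt{HA_{\mathcal X}T}.$$ (ii) With the Shannon regularizer and learning rates $\eta_h=\sqrt{2H\log(A_{\mathcal X})/(A_{\mathcal X}T)}$ for all $h$, with probability at least $1-\delta$, $$\mathrm{Reg}^T_{\max}\le\Big(\sqrt{2\log(A_{\mathcal X})}+3\sqrt{2\iota}\Big)\sqrt{HA_{\mathcal X}T}.$$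
   Context: Setting. An episodic two-player zero-sum imperfect-information game with horizon $H\in\mathbb N$ and perfect recall. The max-player's information sets form a finite set $\mathcal X=\bigsqcup_{h=1}^H\mathcal X_h$; each $x\in\mathcal X$ has a finite nonempty action set $\mathcal A(x)$ of size $A(x)$. Perfect recall: each $x_h\in\mathcal X_h$ has a unique history $(x_1,a_1,\dots,x_{h-1},a_{h-1},x_h)$ with $x_i\in\mathcal X_i$, $a_i\in\mathcal A(x_i)$. For $h<H$, $\mathcal X_{h+1}(x_h,a_h)$ is the (nonempty) set of $x_{h+1}\in\mathcal X_{h+1}$ whose history contains $(x_h,a_h)$. Write $x'\ge x$ if $x'=x$ or $x$ appears in the history of $x'$. Let $\mathcal A(\mathcal X_h)=\{(x_h,a_h):x_h\in\mathcal X_h,a_h\in\mathcal A(x_h)\}$ and $A_{\mathcal X}=\sum_{x\in\mathcal X}A(x)$. A (max-player) policy is $\mu=(\mu_h(\cdot|x_h))$ with $\mu_h(\cdot|x_h)$ a distribution on $\mathcal A(x_h)$; $\Pi_{\max}$ is the set of policies. Its realization plan is $\mu_{1:h}(x_h,a_h)=\prod_{h'=1}^h\mu_{h'}(a_{h'}|x_{h'})$ along the history of $(x_h,a_h)$. For a min-player policy $\nu$, $p^\nu_0$ is the induced distribution of the max-player's first information set on $\mathcal X_1$, $p^\nu_h(\cdot|x_h,a_h)$ the induced distribution of the next information set on $\mathcal X_{h+1}(x_h,a_h)$, and $r^\nu_h(x_h,a_h)\in[0,1]$ the expected reward; $p^\nu_{1:h}(x_h)=p^\nu_0(x_1)\prod_{h'=1}^{h-1}p^\nu_{h'}(x_{h'+1}|x_{h'},a_{h'})$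 and the loss is $\ell^\nu_h(x_h,a_h)=p^\nu_{1:h}(x_h)(1-r^\nu_h(x_h,a_h))$. For vectors indexed by $\bigcup_h\mathcal A(\mathcal X_h)$, $\langle\mu_{1:},\ell\rangle=\sum_{h}\sum_{(x_h,a_h)\in\mathcal A(\mathcal X_h)}\mu_{1:h}(x_h,a_h)\ell_h(x_h,a_h)$. Protocol. There are $T$ episodes. Before episode $t$ the max-player chooses $\mu^t$ and the opponent $\nu^t$, both measurable w.r.t. $\mathcal F_{t-1}$, where $\mathcal F_t$ is generated by everything observed in episodes $1,\dots,t$ together with $\nu^{t+1}$. In episode $t$, for $h=1,\dots,H$ the max-player observes $x_h^t$, plays $a_h^t\sim\mu^t_h(\cdot|x_h^t)$ and receives $r_h^t\in[0,1]$; conditionally on $\mathcal F_{t-1}$, $\Pr(x^t_h=x_h,a^t_h=a_h)=p^{\nu^t}_{1:h}(x_h)\mu^t_{1:h}(x_h,a_h)$ and $\mathbb E[\mathbb 1\{x^t_h=x_h,a^t_h=a_h\}(1-r^t_h)]=\mu^t_{1:h}(x_h,a_h)\ell^{\nu^t}_h(x_h,a_h)$. The regret is $\mathrm{Reg}^T_{\max}=\max_{\mu^\dagger\in\Pi_{\max}}\sum_{t=1}^T\langle\mu^t_{1:}-\mu^\dagger_{1:},\ell^{\nu^t}\rangle$. Balanced transitions. $A^\tau(x)=\sum_{x'\ge x}A(x')$; $p^\star_0(x_1)=A^\tau(x_1)/A_{\mathcal X}$ for $x_1\in\mathcal X_1$; $p^\star_h(x_{h+1}|x_h,a_h)=A^\tau(x_{h+1})/\sum_{x'\in\mathcal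 X_{h+1}(x_h,a_h)}A^\tau(x')$; $p^\star_{1:h}(x_h)=p^\star_0(x_1)\prod_{h'=1}^{h-1}p^\star_{h'}(x_{h'+1}|x_{h'},a_{h'})$. Balanced-FTRL with learning rates $\eta_h>0$, IX parameters $\gamma_h>0$ and regularizers $\Psi_h$ on $\Delta(\mathcal A(\mathcal X_h))$ (Tsallis: $\Psi_h(w)=-\sum_{(x_h,a_h)}w(x_h,a_h)^\alpha$; Shannon: $\Psi_h(w)=\sum_{(x_h,a_h)}w(x_h,a_h)\log w(x_h,a_h)$): with $\tilde\ell^t_h(x_h,a_h)=\mathbb 1\{x^t_h=x_h,a^t_h=a_h\}(1-r^t_h)/\big(\mu^t_{1:h}(x_h,a_h)+\gamma_h/p^\star_{1:h}(x_h)\big)$ and $\tilde L^t=\sum_{k\le t}\tilde\ell^k$, the policy is $\mu^t\in\arg\min_{\mu\in\Pi_{\max}}\langle\mu_{1:},\tilde L^{t-1}\rangle+\sum_{h=1}^H\Psi_h(p^\star_{1:h}\cdot\mu_{1:h})/\eta_h$, where $(p^\star_{1:h}\cdot\mu_{1:h})(x_h,a_h)=p^\star_{1:h}(x_h)\mu_{1:h}(x_h,a_h)$. *)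

theory Defs
  imports "HOL-Probability.Probability"
begin

text \<open>Information sets have type 'x, actions type 'a.  X h is the set of information sets at
step h (h = 1..H), A x the action set of x, and par x = (x_{h-1}, a_{h-1}) the immediately
preceding information set / action pair of an information set x at a step h >= 2.  By perfect
recall the whole history of x is obtained by iterating par.\<close>

definition children :: "(nat \<Rightarrow> 'x set) \<Rightarrow> ('x \<Rightarrow> 'x \<times> 'a) \<Rightarrow> nat \<Rightarrow> 'x \<Rightarrow> 'a \<Rightarrow> 'x set" where
  "children X par h x a = {x' \<in> X (Suc h). par x' = (x, a)}"

definition infoset_tree ::
  "nat \<Rightarrow> (nat \<Rightarrow> 'x set) \<Rightarrow> ('x \<Rightarrow> 'a set) \<Rightarrow> ('x \<Rightarrow> 'x \<times> 'a) \<Rightarrow> bool" where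
  "infoset_tree H X A par \<longleftrightarrow>
     1 \<le> H \<and> X 1 \<noteq> {} \<and>
     (\<forall>h\<in>{1..H}. finite (X h)) \<and>
     (\<forall>h\<in>{1..H}. \<forall>h'\<in>{1..H}. h \<noteq> h' \<longrightarrow> X h \<inter> X h' = {}) \<and>
     (\<forall>h\<in>{1..H}. \<forall>x\<in>X h. finite (A x) \<and> A x \<noteq> {}) \<and>
     (\<forall>h\<in>{1..<H}. \<forall>x\<in>X (Suc h). fst (par x) \<in> X h \<and> snd (par x) \<in> A (fst (par x))) \<and>
     (\<forall>h\<in>{1..<H}. \<forall>x\<in>X h. \<forall>a\<in>A x. children X par h x a \<noteq> {})"

definition all_infosets :: "nat \<Rightarrow> (nat \<Rightarrow> 'x set) \<Rightarrow> 'x set" where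
  "all_infosets H X = (\<Union>h\<in>{1..H}. X h)"

definition A_X :: "nat \<Rightarrow> (nat \<Rightarrow> 'x set) \<Rightarrow> ('x \<Rightarrow> 'a set) \<Rightarrow> real" where
  "A_X H X A = (\<Sum>x\<in>all_infosets H X. real (card (A x)))"

definition anc :: "('x \<Rightarrow> 'x \<times> 'a) \<Rightarrow> nat \<Rightarrow> 'x \<Rightarrow> 'x" where
  "anc par n x = ((fst \<circ> par) ^^ n) x"

definition infoset_ge :: "nat \<Rightarrow> (nat \<Rightarrow> 'x set) \<Rightarrow> ('x \<Rightarrow> 'x \<times> 'a) \<Rightarrow> 'x \<Rightarrow> 'x \<Rightarrow> bool" where
  "infoset_ge H X par x' x \<longleftrightarrow>
     (\<exists>h\<in>{1..H}. \<exists>h'\<in>{1..H}. h \<le> h' \<and> x \<in> X h \<and> x' \<in> X h' \<and> anc par (h' - h) x' = x)"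

definition Atau :: "nat \<Rightarrow> (nat \<Rightarrow> 'x set) \<Rightarrow> ('x \<Rightarrow> 'a set) \<Rightarrow> ('x \<Rightarrow> 'x \<times> 'a) \<Rightarrow> 'x \<Rightarrow> real" where
  "Atau H X A par x = (\<Sum>x'\<in>{x'\<in>all_infosets H X. infoset_ge H X par x' x}. real (card (A x')))"

fun reachp :: "('x \<Rightarrow> real) \<Rightarrow> (nat \<Rightarrow> 'x \<Rightarrow> 'a \<Rightarrow> 'x \<Rightarrow> real) \<Rightarrow> ('x \<Rightarrow> 'x \<times> 'a) \<Rightarrow> nat \<Rightarrow> 'x \<Rightarrow> real" where
  "reachp p0 p par 0 x = 0"
| "reachp p0 p par (Suc 0) x = p0 x"
| "reachp p0 p par (Suc (Suc h)) x =
     reachp p0 p par (Suc h) (fst (par x)) * p (Suc h) (fst (par x)) (snd (par x)) x"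

fun plan :: "('x \<Rightarrow> 'x \<times> 'a) \<Rightarrow> (nat \<Rightarrow> 'x \<Rightarrow> 'a \<Rightarrow> real) \<Rightarrow> nat \<Rightarrow> 'x \<Rightarrow> 'a \<Rightarrow> real" where
  "plan par mu 0 x a = 0"
| "plan par mu (Suc 0) x a = mu 1 x a"
| "plan par mu (Suc (Suc h)) x a =
     plan par mu (Suc h) (fst (par x)) (snd (par x)) * mu (Suc (Suc h)) x a"

definition Pi_max :: "nat \<Rightarrow> (nat \<Rightarrow> 'x set) \<Rightarrow> ('x \<Rightarrow> 'a set) \<Rightarrow> (nat \<Rightarrow> 'x \<Rightarrow> 'a \<Rightarrow> real) set" where
  "Pi_max H X A = {mu. \<forall>h\<in>{1..H}. \<forall>x\<in>X h.
       (\<forall>a\<in>A x. 0 \<le> mu h x a) \<and> (\<Sum>a\<in>A x. mu h x a) = 1}"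

definition pairing :: "nat \<Rightarrow> (nat \<Rightarrow> 'x set) \<Rightarrow> ('x \<Rightarrow> 'a set) \<Rightarrow> ('x \<Rightarrow> 'x \<times> 'a) \<Rightarrow>
    (nat \<Rightarrow> 'x \<Rightarrow> 'a \<Rightarrow> real) \<Rightarrow> (nat \<Rightarrow> 'x \<Rightarrow> 'a \<Rightarrow> real) \<Rightarrow> real" where
  "pairing H X A par mu l = (\<Sum>h\<in>{1..H}. \<Sum>x\<in>X h. \<Sum>a\<in>A x. plan par mu h x a * l h x a)"

text \<open>An opponent policy n induces p0 n (distribution of x_1 on X_1), ptr n h x a
(distribution of x_{h+1} on X_{h+1}(x,a)) and rew n h x a in [0,1].\<close>
definition opp_valid :: "nat \<Rightarrow> (nat \<Rightarrow> 'x set) \<Rightarrow> ('x \<Rightarrow> 'a set) \<Rightarrow> ('x \<Rightarrow> 'x \<times> 'a) \<Rightarrow>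
    ('x \<Rightarrow> real) \<Rightarrow> (nat \<Rightarrow> 'x \<Rightarrow> 'a \<Rightarrow> 'x \<Rightarrow> real) \<Rightarrow> (nat \<Rightarrow> 'x \<Rightarrow> 'a \<Rightarrow> real) \<Rightarrow> bool" where
  "opp_valid H X A par p0 p r \<longleftrightarrow>
     (\<forall>x\<in>X 1. 0 \<le> p0 x) \<and> (\<Sum>x\<in>X 1. p0 x) = 1 \<and>
     (\<forall>h\<in>{1..<H}. \<forall>x\<in>X h. \<forall>a\<in>A x.
        (\<forall>x'\<in>children X par h x a. 0 \<le> p h x a x') \<and> (\<Sum>x'\<in>children X par h x a. p h x a x') = 1) \<and>
     (\<forall>h\<in>{1..H}. \<forall>x\<in>X h. \<forall>a\<in>A x. 0 \<le> r h x a \<and> r h x a \<le> 1)"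

definition opp_loss :: "('x \<Rightarrow> 'x \<times> 'a) \<Rightarrow> ('x \<Rightarrow> real) \<Rightarrow> (nat \<Rightarrow> 'x \<Rightarrow> 'a \<Rightarrow> 'x \<Rightarrow> real) \<Rightarrow>
    (nat \<Rightarrow> 'x \<Rightarrow> 'a \<Rightarrow> real) \<Rightarrow> nat \<Rightarrow> 'x \<Rightarrow> 'a \<Rightarrow> real" where
  "opp_loss par p0 p r h x a = reachp p0 p par h x * (1 - r h x a)"

definition pstar0 :: "nat \<Rightarrow> (nat \<Rightarrow> 'x set) \<Rightarrow> ('x \<Rightarrow> 'a set) \<Rightarrow> ('x \<Rightarrow> 'x \<times> 'a) \<Rightarrow> 'x \<Rightarrow> real" where
  "pstar0 H X A par x = Atau H X A par x / A_X H X A"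

definition pstar_tr :: "nat \<Rightarrow> (nat \<Rightarrow> 'x set) \<Rightarrow> ('x \<Rightarrow> 'a set) \<Rightarrow> ('x \<Rightarrow> 'x \<times> 'a) \<Rightarrow>
    nat \<Rightarrow> 'x \<Rightarrow> 'a \<Rightarrow> 'x \<Rightarrow> real" where
  "pstar_tr H X A par h x a x' =
     Atau H X A par x' / (\<Sum>y\<in>children X par h x a. Atau H X A par y)"

definition pstar :: "nat \<Rightarrow> (nat \<Rightarrow> 'x set) \<Rightarrow> ('x \<Rightarrow> 'a set) \<Rightarrow> ('x \<Rightarrow> 'x \<times> 'a) \<Rightarrow> nat \<Rightarrow> 'x \<Rightarrow> real" where
  "pstar H X A par h x = reachp (pstar0 H X A par) (pstar_tr H X A par) par h x"

section \<open>Regularizers on Delta(A(X_h)) (vectors indexed by the finite set S = A(X_h))\<close>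

definition tsallis :: "real \<Rightarrow> ('x \<times> 'a) set \<Rightarrow> ('x \<times> 'a \<Rightarrow> real) \<Rightarrow> real" where
  "tsallis \<alpha> S w = - (\<Sum>z\<in>S. w z powr \<alpha>)"

definition shannon :: "('x \<times> 'a) set \<Rightarrow> ('x \<times> 'a \<Rightarrow> real) \<Rightarrow> real" where
  "shannon S w = (\<Sum>z\<in>S. w z * ln (w z))"

definition ftrl_obj :: "nat \<Rightarrow> (nat \<Rightarrow> 'x set) \<Rightarrow> ('x \<Rightarrow> 'a set) \<Rightarrow> ('x \<Rightarrow> 'x \<times> 'a) \<Rightarrow>
    (nat \<Rightarrow> ('x \<times> 'a) set \<Rightarrow> ('x \<times> 'a \<Rightarrow> real) \<Rightarrow> real) \<Rightarrow> (nat \<Rightarrow> real) \<Rightarrow>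
    (nat \<Rightarrow> 'x \<Rightarrow> 'a \<Rightarrow> real) \<Rightarrow> (nat \<Rightarrow> 'x \<Rightarrow> 'a \<Rightarrow> real) \<Rightarrow> real" where
  "ftrl_obj H X A par Psi \<eta> L mu =
     pairing H X A par mu L +
     (\<Sum>h\<in>{1..H}. Psi h (Sigma (X h) A)
         (\<lambda>(x, a). pstar H X A par h x * plan par mu h x a) / \<eta> h)"

definition ix_est :: "nat \<Rightarrow> (nat \<Rightarrow> 'x set) \<Rightarrow> ('x \<Rightarrow> 'a set) \<Rightarrow> ('x \<Rightarrow> 'x \<times> 'a) \<Rightarrow>
    (nat \<Rightarrow> real) \<Rightarrow> (nat \<Rightarrow> 'w \<Rightarrow> nat \<Rightarrow> 'x \<Rightarrow> 'a \<Rightarrow> real) \<Rightarrow>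
    (nat \<Rightarrow> nat \<Rightarrow> 'w \<Rightarrow> 'x) \<Rightarrow> (nat \<Rightarrow> nat \<Rightarrow> 'w \<Rightarrow> 'a) \<Rightarrow> (nat \<Rightarrow> nat \<Rightarrow> 'w \<Rightarrow> real) \<Rightarrow>
    nat \<Rightarrow> 'w \<Rightarrow> nat \<Rightarrow> 'x \<Rightarrow> 'a \<Rightarrow> real" where
  "ix_est H X A par \<gamma> mu xs as rs t w h x a =
     (if xs t h w = x \<and> as t h w = a then 1 - rs t h w else 0) /
     (plan par (mu t w) h x a + \<gamma> h / pstar H X A par h x)"

definition ix_cum :: "nat \<Rightarrow> (nat \<Rightarrow> 'x set) \<Rightarrow> ('x \<Rightarrow> 'a set) \<Rightarrow> ('x \<Rightarrow> 'x \<times> 'a) \<Rightarrow>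
    (nat \<Rightarrow> real) \<Rightarrow> (nat \<Rightarrow> 'w \<Rightarrow> nat \<Rightarrow> 'x \<Rightarrow> 'a \<Rightarrow> real) \<Rightarrow>
    (nat \<Rightarrow> nat \<Rightarrow> 'w \<Rightarrow> 'x) \<Rightarrow> (nat \<Rightarrow> nat \<Rightarrow> 'w \<Rightarrow> 'a) \<Rightarrow> (nat \<Rightarrow> nat \<Rightarrow> 'w \<Rightarrow> real) \<Rightarrow>
    nat \<Rightarrow> 'w \<Rightarrow> nat \<Rightarrow> 'x \<Rightarrow> 'a \<Rightarrow> real" where
  "ix_cum H X A par \<gamma> mu xs as rs t w h x a =
     (\<Sum>k\<in>{1..t}. ix_est H X A par \<gamma> mu xs as rs k w h x a)"

definition balanced_ftrl :: "nat \<Rightarrow> (nat \<Rightarrow> 'x set) \<Rightarrow> ('x \<Rightarrow> 'a set) \<Rightarrow> ('x \<Rightarrow> 'x \<times> 'a) \<Rightarrow>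
    (nat \<Rightarrow> ('x \<times> 'a) set \<Rightarrow> ('x \<times> 'a \<Rightarrow> real) \<Rightarrow> real) \<Rightarrow> (nat \<Rightarrow> real) \<Rightarrow> (nat \<Rightarrow> real) \<Rightarrow>
    nat \<Rightarrow> 'w set \<Rightarrow> (nat \<Rightarrow> 'w \<Rightarrow> nat \<Rightarrow> 'x \<Rightarrow> 'a \<Rightarrow> real) \<Rightarrow>
    (nat \<Rightarrow> nat \<Rightarrow> 'w \<Rightarrow> 'x) \<Rightarrow> (nat \<Rightarrow> nat \<Rightarrow> 'w \<Rightarrow> 'a) \<Rightarrow> (nat \<Rightarrow> nat \<Rightarrow> 'w \<Rightarrow> real) \<Rightarrow> bool" where
  "balanced_ftrl H X A par Psi \<eta> \<gamma> T \<Omega> mu xs as rs \<longleftrightarrow>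
     (\<forall>t\<in>{1..T}. \<forall>w\<in>\<Omega>. mu t w \<in> Pi_max H X A \<and>
        (\<forall>mu'\<in>Pi_max H X A.
           ftrl_obj H X A par Psi \<eta> (ix_cum H X A par \<gamma> mu xs as rs (t - 1) w) (mu t w)
             \<le> ftrl_obj H X A par Psi \<eta> (ix_cum H X A par \<gamma> mu xs as rs (t - 1) w) mu'))"

text \<open>M: underlying probability space; F t = F_t (a filtration, F 0 the initial one);
xs t h, as t h, rs t h: observed information set, played action, received reward at step h of
episode t; nu t w: opponent policy of episode t; mu t w: max-player policy of episode t.\<close>
definition protocol :: "nat \<Rightarrow> (nat \<Rightarrow> 'x set) \<Rightarrow> ('x \<Rightarrow> 'a set) \<Rightarrow> ('x \<Rightarrow> 'x \<times> 'a) \<Rightarrow>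
    ('n \<Rightarrow> 'x \<Rightarrow> real) \<Rightarrow> ('n \<Rightarrow> nat \<Rightarrow> 'x \<Rightarrow> 'a \<Rightarrow> 'x \<Rightarrow> real) \<Rightarrow> ('n \<Rightarrow> nat \<Rightarrow> 'x \<Rightarrow> 'a \<Rightarrow> real) \<Rightarrow>
    nat \<Rightarrow> 'w measure \<Rightarrow> (nat \<Rightarrow> 'w measure) \<Rightarrow> (nat \<Rightarrow> 'w \<Rightarrow> 'n) \<Rightarrow>
    (nat \<Rightarrow> 'w \<Rightarrow> nat \<Rightarrow> 'x \<Rightarrow> 'a \<Rightarrow> real) \<Rightarrow>
    (nat \<Rightarrow> nat \<Rightarrow> 'w \<Rightarrow> 'x) \<Rightarrow> (nat \<Rightarrow> nat \<Rightarrow> 'w \<Rightarrow> 'a) \<Rightarrow> (nat \<Rightarrow> nat \<Rightarrow> 'w \<Rightarrow> real) \<Rightarrow> bool" where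
  "protocol H X A par p0 ptr rew T M F nu mu xs as rs \<longleftrightarrow>
     prob_space M \<and>
     (\<forall>t. subalgebra M (F t)) \<and>
     (\<forall>s t. s \<le> t \<longrightarrow> sets (F s) \<subseteq> sets (F t)) \<and>
     \<comment> \<open>observations of episode t are F_t-measurable\<close>
     (\<forall>t\<in>{1..T}. \<forall>h\<in>{1..H}.
        xs t h \<in> measurable (F t) (count_space UNIV) \<and>
        as t h \<in> measurable (F t) (count_space UNIV) \<and>
        rs t h \<in> borel_measurable (F t) \<and>
        (\<forall>w\<in>space M. 0 \<le> rs t h w \<and> rs t h w \<le> 1)) \<and>
     \<comment> \<open>opponent policies are valid and F_{t-1}-measurable (through their induced quantities)\<close>
     (\<forall>t\<in>{1..T}. \<forall>w\<in>space M.
        opp_valid H X A par (p0 (nu t w)) (ptr (nu t w)) (rew (nu t w))) \<and>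
     (\<forall>t\<in>{1..T}. (\<forall>x. (\<lambda>w. p0 (nu t w) x) \<in> borel_measurable (F (t - 1))) \<and>
        (\<forall>h x a x'. (\<lambda>w. ptr (nu t w) h x a x') \<in> borel_measurable (F (t - 1))) \<and>
        (\<forall>h x a. (\<lambda>w. rew (nu t w) h x a) \<in> borel_measurable (F (t - 1)))) \<and>
     \<comment> \<open>max-player policies are F_{t-1}-measurable\<close>
     (\<forall>t\<in>{1..T}. \<forall>h\<in>{1..H}. \<forall>x\<in>X h. \<forall>a\<in>A x.
        (\<lambda>w. mu t w h x a) \<in> borel_measurable (F (t - 1))) \<and>
     \<comment> \<open>conditional law of the visited pair and of the incurred loss given F_{t-1}\<close>
     (\<forall>t\<in>{1..T}. \<forall>h\<in>{1..H}. \<forall>x\<in>X h. \<forall>a\<in>A x.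
        (AE w in M. real_cond_exp M (F (t - 1))
            (\<lambda>w. indicator {w \<in> space M. xs t h w = x \<and> as t h w = a} w) w
          = reachp (p0 (nu t w)) (ptr (nu t w)) par h x * plan par (mu t w) h x a) \<and>
        (AE w in M. real_cond_exp M (F (t - 1))
            (\<lambda>w. indicator {w \<in> space M. xs t h w = x \<and> as t h w = a} w * (1 - rs t h w)) w
          = plan par (mu t w) h x a * opp_loss par (p0 (nu t w)) (ptr (nu t w)) (rew (nu t w)) h x a))"

definition regret :: "nat \<Rightarrow> (nat \<Rightarrow> 'x set) \<Rightarrow> ('x \<Rightarrow> 'a set) \<Rightarrow> ('x \<Rightarrow> 'x \<times> 'a) \<Rightarrow>
    ('n \<Rightarrow> 'x \<Rightarrow> real) \<Rightarrow> ('n \<Rightarrow> nat \<Rightarrow> 'x \<Rightarrow> 'a \<Rightarrow> 'x \<Rightarrow> real) \<Rightarrow> ('n \<Rightarrow> nat \<Rightarrow> 'x \<Rightarrow> 'a \<Rightarrow> real) \<Rightarrow>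
    nat \<Rightarrow> (nat \<Rightarrow> 'w \<Rightarrow> 'n) \<Rightarrow> (nat \<Rightarrow> 'w \<Rightarrow> nat \<Rightarrow> 'x \<Rightarrow> 'a \<Rightarrow> real) \<Rightarrow> 'w \<Rightarrow> real" where
  "regret H X A par p0 ptr rew T nu mu w =
     (SUP mu'\<in>Pi_max H X A. \<Sum>t\<in>{1..T}.
        pairing H X A par (mu t w) (opp_loss par (p0 (nu t w)) (ptr (nu t w)) (rew (nu t w)))
      - pairing H X A par mu' (opp_loss par (p0 (nu t w)) (ptr (nu t w)) (rew (nu t w))))"

end

theory Submission
  imports Defs "HOL-Real_Asymp.Real_Asymp"
begin

text \<open>
  The regret splits into the bias \<open>\<langle>\<mu>\<^sup>t, \<ell>\<^sup>t - \<ell>~\<^sup>t\<rangle>\<close>, the regret of FTRL against the estimated losses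
  \<open>\<ell>~\<^sup>t\<close>, and the bias \<open>\<langle>\<mu>\<^sup>\<dagger>, \<ell>~\<^sup>t - \<ell>\<^sup>t\<rangle>\<close>; write \<open>R = (2 \<iota> H A\<^sub>X T)\<^bsup>1/2\<^esup>\<close>.
  Implicit exploration makes \<open>exp (2 \<gamma>/p\<^sup>\<star> \<Sum>\<^sub>t (\<ell>~\<^sup>t - \<ell>\<^sup>t))\<close> a supermartingale for every pair \<open>(x, a)\<close>, which
  controls the last term by \<open>R/2\<close>. The first one is at most a systematic part, bounded by \<open>R/2\<close> because
  \<open>\<Sum>\<^sub>h \<Sum>\<^sub>x A(x) p\<^sup>\<nu>(x) / p\<^sup>\<star>(x) = A\<^sub>X\<close> for every opponent \<open>\<nu>\<close>, plus a bounded martingale, which an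
  exponential supermartingale bounds by \<open>R\<close>.
  For FTRL, strong convexity of the regularizer below the current iterate gives the usual penalty and
  stability terms; Young's inequality reduces the stability term to \<open>\<Sum> \<mu>\<^sup>t \<ell>~\<^sup>t \<le> H T\<close> and
  \<open>\<Sum> \<ell>~\<^sup>t / p\<^sup>\<star> \<le> A\<^sub>X (T + \<iota> / (2 \<gamma>))\<close>. The excess due to \<open>\<iota> / (2 \<gamma>)\<close> is at most \<open>R/4\<close>, unless the claimed
  bound exceeds the trivial one \<open>H T\<close>.
\<close>

section \<open>FTRL with a separable regularizer\<close>

text \<open>All levels share one learning rate and one IX parameter, so the tree is flattened to a
  single index set of A_X triples (h, x, a). On it the plans scaled by p* form a convex set of
  vectors of total mass H, and the FTRL analysis needs nothing else about the tree. The obstacle is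
  the stability term: it contains squares of estimates that are only bounded by p* / \<gamma>. One
  factor is absorbed by the iterate, because the plan times the estimate is at most 1; what remains
  is linear in the estimates and can be compared with the true losses. The maximum over comparators
  inside the regret needs no union bound over policies. The bias of a comparator is linear in its
  plan, so one overestimation event per index suffices, plus one deviation event for the played
  policies. Each of these A_X + 1 events fails with probability at most exp (- \<iota>) = \<delta> /
  (3 A_X), which is the origin of the logarithm \<iota>.\<close>

lemma convex_on_Icc_if_convex_on_Ioc:
  fixes g :: "real \<Rightarrow> real"
  assumes conv: "convex_on {a<..b} g" and cont: "continuous_on {a..b} g" and "a < b"
  shows "convex_on {a..b} g"
proof (rule convex_onI)
  fix t x y :: real
  assume t: "0 < t" "t < 1" and x: "x \<in> {a..b}" and y: "y \<in> {a..b}"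
  define z where "z = (1 - t) * x + t * y"
  have z: "z \<in> {a..b}"
    using convexD_alt[OF convex_real_interval(5) x y, of t] t by (simp add: z_def)
  \<comment> \<open>Sliding every point towards \<open>b\<close> by a fraction \<open>r\<close>
    leaves the endpoint \<open>a\<close> and commutes with convex combinations, so the inequality on
    the half-open interval passes to the limit at \<open>r = 0\<close>. The endpoint matters because
    the regularizers are not differentiable at 0, where coordinates of iterates and comparators may
    lie.\<close>
  define s where "s = (\<lambda>u r::real. (1 - r) * u + r * b)"
  have s_Icc: "s u r \<in> {a..b}" if "u \<in> {a..b}" "r \<in> {0..1}" for u r
    using convexD_alt[OF convex_real_interval(5) that(1), of b r] that assms(3) by (simp add: s_def)
  have s_Ioc: "s u r \<in> {a<..b}" if "u \<in> {a..b}" "r \<in> {0<..1}" for u r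
  proof -
    have "(1 - r) * a \<le> (1 - r) * u" "r * a < r * b"
      using that \<open>a < b\<close> by (auto intro!: mult_left_mono)
    then have "a < s u r" by (simp add: s_def algebra_simps)
    then show ?thesis using s_Icc[of u r] that by auto
  qed
  have lim: "((\<lambda>r. g (s u r)) \<longlongrightarrow> g u) (at_right 0)" if u: "u \<in> {a..b}" for u
  proof -
    have "continuous_on {0..1} (\<lambda>r. g (s u r))"
      by (rule continuous_on_compose2[OF cont])
        (use s_Icc[OF u] in \<open>auto simp: s_def intro!: continuous_intros\<close>)
    then have "((\<lambda>r. g (s u r)) \<longlongrightarrow> g (s u 0)) (at 0 within {0..1})"
      by (auto simp: continuous_on_def)
    then have "((\<lambda>r. g (s u r)) \<longlongrightarrow> g (s u 0)) (at_right 0)"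
      by (simp add: at_within_Icc_at_right)
    then show ?thesis by (simp add: s_def)
  qed
  have ev: "\<forall>\<^sub>F r in at_right 0. r \<in> {0<..1::real}"
    unfolding eventually_at_right_field by (rule exI[of _ 1]) auto
  have "g z \<le> (1 - t) * g x + t * g y"
  proof (rule tendsto_le[OF _ _ lim[OF z]])
    show "((\<lambda>r. (1 - t) * g (s x r) + t * g (s y r)) \<longlongrightarrow> (1 - t) * g x + t * g y) (at_right 0)"
      by (intro tendsto_intros lim x y)
    show "\<forall>\<^sub>F r in at_right 0. g (s z r) \<le> (1 - t) * g (s x r) + t * g (s y r)"
      using ev
    proof (rule eventually_mono)
      fix r :: real assume r: "r \<in> {0<..1}"
      have "s z r = (1 - t) * s x r + t * s y r"
        by (simp add: s_def z_def algebra_simps)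
      then show "g (s z r) \<le> (1 - t) * g (s x r) + t * g (s y r)"
        using convex_onD[OF conv _ _ s_Ioc[OF x r] s_Ioc[OF y r], of t] t by simp
    qed
  qed simp
  then show "g ((1 - t) *\<^sub>R x + t *\<^sub>R y) \<le> (1 - t) * g x + t * g y"
    by (simp add: z_def)
qed simp

text \<open>Curvature is only required towards smaller arguments: moving mass upwards never helps against
  nonnegative losses. This makes positivity of the iterates unnecessary, although the derivative of
  \<open>\<psi>\<close> may be infinite at \<open>0\<close>.\<close>

definition half_strongly_convex :: "(real \<Rightarrow> real) \<Rightarrow> (real \<Rightarrow> real) \<Rightarrow> bool" where
  "half_strongly_convex \<psi> \<kappa> \<longleftrightarrow>
     (\<forall>v w \<epsilon>. 0 \<le> v \<longrightarrow> 0 \<le> w \<longrightarrow> 0 < \<epsilon> \<longrightarrow> \<epsilon> < 1 \<longrightarrow>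
        \<psi> ((1 - \<epsilon>) * v + \<epsilon> * w) \<le> (1 - \<epsilon>) * \<psi> v + \<epsilon> * \<psi> w
          - (if w < v then \<epsilon> * (1 - \<epsilon>) / 2 * (v - w)\<^sup>2 / \<kappa> v else 0))"

text \<open>If \<open>m\<close> bounds the second derivative below on (0, b], then \<open>f\<close>
  minus \<open>m / 2\<close> times the square is convex there, and the square contributes exactly
  the gap. A move down from \<open>v\<close> takes \<open>b = v\<close> and
  \<open>m = 1 / \<kappa> v\<close>, a bound valid on all of (0, v]; a move up takes
  \<open>m = 0\<close>, which is plain convexity.\<close>

lemma half_strongly_convexI:
  assumes f': "\<And>s. 0 < s \<Longrightarrow> (f has_real_derivative f' s) (at s)"
    and f'': "\<And>s. 0 < s \<Longrightarrow> (f' has_real_derivative f'' s) (at s)"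
    and nonneg: "\<And>s. 0 < s \<Longrightarrow> 0 \<le> f'' s"
    and anti: "\<And>s v. 0 < s \<Longrightarrow> s \<le> v \<Longrightarrow> 1 / \<kappa> v \<le> f'' s"
    and lim0: "(f \<longlongrightarrow> f 0) (at_right 0)"
  shows "half_strongly_convex f \<kappa>"
proof -
  have key: "f ((1 - \<epsilon>) * v + \<epsilon> * w) \<le> (1 - \<epsilon>) * f v + \<epsilon> * f w - \<epsilon> * (1 - \<epsilon>) / 2 * (v - w)\<^sup>2 * m"
    if b: "0 < b" and m: "\<And>s. 0 < s \<Longrightarrow> s \<le> b \<Longrightarrow> m \<le> f'' s"
      and v: "v \<in> {0..b}" and w: "w \<in> {0..b}" and \<epsilon>: "0 < \<epsilon>" "\<epsilon> < 1" for b m v w \<epsilon>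
  proof -
    define g where "g = (\<lambda>s. f s - m / 2 * s\<^sup>2)"
    have "convex_on {0<..b} g"
    proof (rule f''_ge0_imp_convex[where f' = "\<lambda>s. f' s - m * s" and f'' = "\<lambda>s. f'' s - m"])
      show "(g has_real_derivative f' s - m * s) (at s)" if "s \<in> {0<..b}" for s
        unfolding g_def using that by (auto intro!: derivative_eq_intros f')
      show "((\<lambda>s. f' s - m * s) has_real_derivative f'' s - m) (at s)" if "s \<in> {0<..b}" for s
        using that by (auto intro!: derivative_eq_intros f'')
    qed (use m in auto)
    moreover have "continuous_on {0..b} f"
      unfolding continuous_on_def
    proof
      fix s assume s: "s \<in> {0..b}"
      show "(f \<longlongrightarrow> f s) (at s within {0..b})"
      proof (cases "s = 0")
        case True
        then show ?thesis using lim0 b by (simp add: at_within_Icc_at_right)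
      next
        case False
        then have "isCont f s" using f'[of s] s by (auto intro: DERIV_isCont)
        then show ?thesis by (auto simp: isCont_def intro: tendsto_within_subset)
      qed
    qed
    then have "continuous_on {0..b} g"
      unfolding g_def by (intro continuous_intros)
    ultimately have "convex_on {0..b} g"
      using b by (intro convex_on_Icc_if_convex_on_Ioc)
    from convex_onD[OF this _ _ v w, of \<epsilon>] \<epsilon>
    have "g ((1 - \<epsilon>) * v + \<epsilon> * w) \<le> (1 - \<epsilon>) * g v + \<epsilon> * g w" by simp
    moreover have "(1 - \<epsilon>) * v\<^sup>2 + \<epsilon> * w\<^sup>2 - ((1 - \<epsilon>) * v + \<epsilon> * w)\<^sup>2 = \<epsilon> * (1 - \<epsilon>) * (v - w)\<^sup>2"
      by (simp add: power2_eq_square algebra_simps)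
    then have "m / 2 * ((1 - \<epsilon>) * v\<^sup>2 + \<epsilon> * w\<^sup>2 - ((1 - \<epsilon>) * v + \<epsilon> * w)\<^sup>2)
        = \<epsilon> * (1 - \<epsilon>) / 2 * (v - w)\<^sup>2 * m" by simp
    moreover have "(1 - \<epsilon>) * g v + \<epsilon> * g w = (1 - \<epsilon>) * f v + \<epsilon> * f w
        - m / 2 * ((1 - \<epsilon>) * v\<^sup>2 + \<epsilon> * w\<^sup>2)"
      by (simp add: g_def algebra_simps add_divide_distrib diff_divide_distrib)
    ultimately show ?thesis
      unfolding right_diff_distrib by (simp add: g_def)
  qed
  show ?thesis
    unfolding half_strongly_convex_def
  proof (intro allI impI)
    fix v w \<epsilon> :: real
    assume *: "0 \<le> v" "0 \<le> w" "0 < \<epsilon>" "\<epsilon> < 1"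
    show "f ((1 - \<epsilon>) * v + \<epsilon> * w) \<le> (1 - \<epsilon>) * f v + \<epsilon> * f w
          - (if w < v then \<epsilon> * (1 - \<epsilon>) / 2 * (v - w)\<^sup>2 / \<kappa> v else 0)"
    proof (cases "w < v")
      case True
      then show ?thesis using key[of v "1 / \<kappa> v" v w \<epsilon>] anti[of _ v] * by simp
    next
      case False
      \<comment> \<open>The right end is \<open>w + 1\<close> because \<open>v = w = 0\<close> is
        possible and \<open>key\<close> needs \<open>0 < b\<close>.\<close>
      then show ?thesis using key[of "w + 1" 0 v w \<epsilon>] nonneg * by simp
    qed
  qed
qed

text \<open>The modulus is the reciprocal of the second derivative, which decreases, so that its
  value at \<open>v\<close> is its minimum over (0, v].\<close>

lemma half_strongly_convex_tsallis:
  assumes \<alpha>: "0 < \<alpha>" "\<alpha> < (1::real)"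
  shows "half_strongly_convex (\<lambda>s. - (s powr \<alpha>)) (\<lambda>v. v powr (2 - \<alpha>) / (\<alpha> * (1 - \<alpha>)))"
proof (rule half_strongly_convexI[where f' = "\<lambda>s. - (\<alpha> * s powr (\<alpha> - 1))"
      and f'' = "\<lambda>s. \<alpha> * (1 - \<alpha>) * s powr (\<alpha> - 2)"])
  fix s :: real assume s: "0 < s"
  show "((\<lambda>s. - (s powr \<alpha>)) has_real_derivative - (\<alpha> * s powr (\<alpha> - 1))) (at s)"
    using s by (auto intro!: derivative_eq_intros)
  show "((\<lambda>s. - (\<alpha> * s powr (\<alpha> - 1))) has_real_derivative \<alpha> * (1 - \<alpha>) * s powr (\<alpha> - 2)) (at s)"
    using s by (auto intro!: derivative_eq_intros simp: algebra_simps)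
  show "0 \<le> \<alpha> * (1 - \<alpha>) * s powr (\<alpha> - 2)" using \<alpha> by simp
  fix v assume v: "s \<le> v"
  have "1 / (v powr (2 - \<alpha>) / (\<alpha> * (1 - \<alpha>))) = \<alpha> * (1 - \<alpha>) * v powr (\<alpha> - 2)"
    using powr_minus[of v "2 - \<alpha>"] by (simp add: field_simps)
  also have "\<dots> \<le> \<alpha> * (1 - \<alpha>) * s powr (\<alpha> - 2)"
    using \<alpha> s v by (intro mult_left_mono powr_mono2') auto
  finally show "1 / (v powr (2 - \<alpha>) / (\<alpha> * (1 - \<alpha>))) \<le> \<alpha> * (1 - \<alpha>) * s powr (\<alpha> - 2)" .
next
  have "((\<lambda>s::real. s powr \<alpha>) \<longlongrightarrow> 0) (at_right 0)"
    using \<alpha> by real_asymp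
  from tendsto_minus[OF this] show "((\<lambda>s. - (s powr \<alpha>)) \<longlongrightarrow> - (0 powr \<alpha>)) (at_right 0)" by simp
qed

lemma half_strongly_convex_shannon: "half_strongly_convex (\<lambda>s. s * ln s) (\<lambda>v. v)"
proof (rule half_strongly_convexI[where f' = "\<lambda>s. ln s + 1" and f'' = "\<lambda>s. 1 / s"])
  show "((\<lambda>s::real. s * ln s) \<longlongrightarrow> 0 * ln 0) (at_right 0)"
    by simp real_asymp
qed (auto intro!: derivative_eq_intros simp: frac_le)

section \<open>Regret of FTRL over an abstract convex set\<close>

text \<open>No gradient of \<Phi> is taken: optimality of \<open>v\<close> is tested on the segment
  towards \<open>u\<close>, where half strong convexity produces a quadratic gap between \<Phi> u
  and \<Phi> v. Coordinates with \<open>u i < v i\<close> are charged to this gap; for the others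
  \<open>(v i - u i) * l i \<le> 0\<close> holds anyway.\<close>

lemma ftrl_step:
  fixes v u L l :: "'i \<Rightarrow> real"
  assumes fin: "finite I" and \<eta>: "0 < \<eta>"
    and nonneg: "\<And>w i. w \<in> Q \<Longrightarrow> i \<in> I \<Longrightarrow> 0 \<le> w i"
    and conv: "\<And>w w' \<epsilon>. w \<in> Q \<Longrightarrow> w' \<in> Q \<Longrightarrow> 0 < \<epsilon> \<Longrightarrow> \<epsilon> < 1 \<Longrightarrow>
      \<exists>w''\<in>Q. \<forall>i\<in>I. w'' i = (1 - \<epsilon>) * w i + \<epsilon> * w' i"
    and l: "\<And>i. i \<in> I \<Longrightarrow> 0 \<le> l i"
    and \<psi>: "half_strongly_convex \<psi> \<kappa>"
    and \<kappa>: "\<And>s. 0 < s \<Longrightarrow> 0 < \<kappa> s" "\<kappa> 0 = 0"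
    and v: "v \<in> Q" and u: "u \<in> Q"
    and opt: "\<And>w. w \<in> Q \<Longrightarrow>
      (\<Sum>i\<in>I. v i * L i) + (\<Sum>i\<in>I. \<psi> (v i)) / \<eta> \<le> (\<Sum>i\<in>I. w i * L i) + (\<Sum>i\<in>I. \<psi> (w i)) / \<eta>"
  shows "(\<Sum>i\<in>I. (v i - u i) * l i) \<le>
    ((\<Sum>i\<in>I. u i * L i) + (\<Sum>i\<in>I. \<psi> (u i)) / \<eta>) - ((\<Sum>i\<in>I. v i * L i) + (\<Sum>i\<in>I. \<psi> (v i)) / \<eta>)
    + \<eta> / 2 * (\<Sum>i\<in>I. \<kappa> (v i) * (l i)\<^sup>2)"
proof -
  define \<Phi> where "\<Phi> w = (\<Sum>i\<in>I. w i * L i) + (\<Sum>i\<in>I. \<psi> (w i)) / \<eta>" for w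
  define d where "d i = (if u i < v i then 1 / 2 * (v i - u i)\<^sup>2 / \<kappa> (v i) else 0)" for i
  define B where "B = (\<Sum>i\<in>I. d i) / \<eta>"
  have "B \<le> \<Phi> u - \<Phi> v"
  \<comment> \<open>With \<open>z = 1 - \<epsilon>\<close>, cancelling one factor
    \<open>\<epsilon>\<close> leaves \<open>z * B\<close>; the rule is the passage to the limit
    \<open>z = 1\<close>.\<close>
  proof (rule field_le_mult_one_interval)
    fix z :: real assume z: "0 < z" "z < 1"
    define \<epsilon> where "\<epsilon> = 1 - z"
    have \<epsilon>: "0 < \<epsilon>" "\<epsilon> < 1" using z by (auto simp: \<epsilon>_def)
    obtain w where w: "w \<in> Q" "\<And>i. i \<in> I \<Longrightarrow> w i = (1 - \<epsilon>) * v i + \<epsilon> * u i"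
      using conv[OF v u \<epsilon>] by blast
    have lin: "(\<Sum>i\<in>I. w i * L i) = (1 - \<epsilon>) * (\<Sum>i\<in>I. v i * L i) + \<epsilon> * (\<Sum>i\<in>I. u i * L i)"
      by (simp add: w sum_distrib_left sum.distrib[symmetric] algebra_simps cong: sum.cong)
    have "(\<Sum>i\<in>I. \<psi> (w i)) \<le> (\<Sum>i\<in>I. (1 - \<epsilon>) * \<psi> (v i) + \<epsilon> * \<psi> (u i) - \<epsilon> * (1 - \<epsilon>) * d i)"
    proof (rule sum_mono)
      fix i assume i: "i \<in> I"
      show "\<psi> (w i) \<le> (1 - \<epsilon>) * \<psi> (v i) + \<epsilon> * \<psi> (u i) - \<epsilon> * (1 - \<epsilon>) * d i"
        using \<psi>[unfolded half_strongly_convex_def, rule_format, of "v i" "u i" \<epsilon>]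
          nonneg[OF v i] nonneg[OF u i] \<epsilon> by (auto simp: w(2)[OF i] d_def split: if_splits)
    qed
    also have "\<dots> = (1 - \<epsilon>) * (\<Sum>i\<in>I. \<psi> (v i)) + \<epsilon> * (\<Sum>i\<in>I. \<psi> (u i)) - \<epsilon> * (1 - \<epsilon>) * (\<Sum>i\<in>I. d i)"
      by (simp add: sum_distrib_left sum.distrib sum_subtractf)
    finally have "(\<Sum>i\<in>I. \<psi> (w i)) / \<eta> \<le>
        ((1 - \<epsilon>) * (\<Sum>i\<in>I. \<psi> (v i)) + \<epsilon> * (\<Sum>i\<in>I. \<psi> (u i)) - \<epsilon> * (1 - \<epsilon>) * (\<Sum>i\<in>I. d i)) / \<eta>"
      using \<eta> by (intro divide_right_mono) auto
    then have "\<Phi> w \<le> (1 - \<epsilon>) * \<Phi> v + \<epsilon> * \<Phi> u - \<epsilon> * ((1 - \<epsilon>) * B)"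
      unfolding \<Phi>_def lin B_def by (simp add: algebra_simps add_divide_distrib diff_divide_distrib)
    moreover have "\<Phi> v \<le> \<Phi> w" using opt[OF w(1)] by (simp add: \<Phi>_def)
    ultimately have "\<epsilon> * ((1 - \<epsilon>) * B) \<le> \<epsilon> * (\<Phi> u - \<Phi> v)" by (simp add: algebra_simps)
    then show "z * B \<le> \<Phi> u - \<Phi> v" using \<epsilon> by (simp add: \<epsilon>_def)
  qed
  moreover have "(\<Sum>i\<in>I. (v i - u i) * l i) \<le> (\<Sum>i\<in>I. d i / \<eta> + \<eta> / 2 * (\<kappa> (v i) * (l i)\<^sup>2))"
  proof (rule sum_mono)
    fix i assume i: "i \<in> I"
    have v0: "0 \<le> v i" and u0: "0 \<le> u i" using nonneg v u i by auto
    show "(v i - u i) * l i \<le> d i / \<eta> + \<eta> / 2 * (\<kappa> (v i) * (l i)\<^sup>2)"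
    proof (cases "u i < v i")
      case True
      then have k: "0 < \<kappa> (v i)" using \<kappa> u0 by auto
      \<comment> \<open>Completing the square: this quantity is exactly the right-hand side of the
        goal minus its left-hand side.\<close>
      have "0 \<le> ((v i - u i) - \<eta> * \<kappa> (v i) * l i)\<^sup>2 / (2 * \<kappa> (v i) * \<eta>)"
        using k \<eta> by (intro divide_nonneg_nonneg) auto
      also have "\<dots> = (v i - u i)\<^sup>2 / (2 * \<kappa> (v i) * \<eta>) + \<eta> / 2 * (\<kappa> (v i) * (l i)\<^sup>2) - (v i - u i) * l i"
        using k \<eta> by (simp add: field_simps power2_eq_square)
      finally show ?thesis using True by (simp add: d_def)
    next
      case False
      then have "(v i - u i) * l i \<le> 0"
        using l[OF i] by (intro mult_nonpos_nonneg) auto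
      also have "0 \<le> \<eta> / 2 * (\<kappa> (v i) * (l i)\<^sup>2)"
        using \<kappa>(1)[of "v i"] \<kappa>(2) v0 \<eta> by (cases "v i = 0") auto
      finally show ?thesis using False by (simp add: d_def)
    qed
  qed
  ultimately show ?thesis
    unfolding \<Phi>_def B_def
    by (simp add: sum.distrib sum_divide_distrib[symmetric] sum_distrib_left[symmetric])
qed

text \<open>The induction runs over all comparators at once: the hypothesis for \<open>t\<close> is
  used with the next iterate \<open>v (Suc t)\<close> as comparator, and \<open>ftrl_step\<close>
  exchanges that iterate for \<open>w\<close> at the price of one stability term. The potentials
  telescope down to the regularizer at \<open>v 1\<close>.\<close>

lemma ftrl_regret:
  fixes v l :: "nat \<Rightarrow> 'i \<Rightarrow> real" and u :: "'i \<Rightarrow> real"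
  assumes fin: "finite I" and \<eta>: "0 < \<eta>" and T: "1 \<le> T"
    and nonneg: "\<And>w i. w \<in> Q \<Longrightarrow> i \<in> I \<Longrightarrow> 0 \<le> w i"
    and conv: "\<And>w w' \<epsilon>. w \<in> Q \<Longrightarrow> w' \<in> Q \<Longrightarrow> 0 < \<epsilon> \<Longrightarrow> \<epsilon> < 1 \<Longrightarrow>
      \<exists>w''\<in>Q. \<forall>i\<in>I. w'' i = (1 - \<epsilon>) * w i + \<epsilon> * w' i"
    and l: "\<And>t i. t \<in> {1..T} \<Longrightarrow> i \<in> I \<Longrightarrow> 0 \<le> l t i"
    and \<psi>: "half_strongly_convex \<psi> \<kappa>"
    and \<kappa>: "\<And>s. 0 < s \<Longrightarrow> 0 < \<kappa> s" "\<kappa> 0 = 0"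
    and v: "\<And>t. t \<in> {1..T} \<Longrightarrow> v t \<in> Q" and u: "u \<in> Q"
    and opt: "\<And>t w. t \<in> {1..T} \<Longrightarrow> w \<in> Q \<Longrightarrow>
      (\<Sum>i\<in>I. v t i * (\<Sum>k\<in>{1..t-1}. l k i)) + (\<Sum>i\<in>I. \<psi> (v t i)) / \<eta>
      \<le> (\<Sum>i\<in>I. w i * (\<Sum>k\<in>{1..t-1}. l k i)) + (\<Sum>i\<in>I. \<psi> (w i)) / \<eta>"
  shows "(\<Sum>t\<in>{1..T}. \<Sum>i\<in>I. (v t i - u i) * l t i) \<le>
    ((\<Sum>i\<in>I. \<psi> (u i)) - (\<Sum>i\<in>I. \<psi> (v 1 i))) / \<eta>
    + \<eta> / 2 * (\<Sum>t\<in>{1..T}. \<Sum>i\<in>I. \<kappa> (v t i) * (l t i)\<^sup>2)"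
proof -
  define \<Phi> where "\<Phi> t w = (\<Sum>i\<in>I. w i * (\<Sum>k\<in>{1..t}. l k i)) + (\<Sum>i\<in>I. \<psi> (w i)) / \<eta>" for t w
  define S where "S t = \<eta> / 2 * (\<Sum>i\<in>I. \<kappa> (v t i) * (l t i)\<^sup>2)" for t
  have "(\<Sum>k\<in>{1..t}. \<Sum>i\<in>I. v k i * l k i) \<le> \<Phi> t w - \<Phi> 0 (v 1) + (\<Sum>k\<in>{1..t}. S k)"
    if "t \<le> T" "w \<in> Q" for t w
    using that
  proof (induction t arbitrary: w)
    case 0
    then show ?case using opt[of 1 w] T by (simp add: \<Phi>_def)
  next
    case (Suc t)
    have t: "Suc t \<in> {1..T}" using Suc by auto
    have "(\<Sum>k\<in>{1..t}. \<Sum>i\<in>I. v k i * l k i) \<le> \<Phi> t (v (Suc t)) - \<Phi> 0 (v 1) + (\<Sum>k\<in>{1..t}. S k)"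
      using Suc.prems v[OF t] by (intro Suc.IH) auto
    moreover have "(\<Sum>i\<in>I. (v (Suc t) i - w i) * l (Suc t) i) \<le> \<Phi> t w - \<Phi> t (v (Suc t)) + S (Suc t)"
      unfolding \<Phi>_def S_def
      using fin \<eta> nonneg conv l[OF t] \<psi> \<kappa> v[OF t] Suc.prems(2) opt[OF t, simplified]
      by (intro ftrl_step[where Q = Q]) auto
    moreover have "\<Phi> (Suc t) w = \<Phi> t w + (\<Sum>i\<in>I. w i * l (Suc t) i)"
      by (simp add: \<Phi>_def distrib_left sum.distrib)
    ultimately show ?case
      by (simp add: left_diff_distrib sum_subtractf)
  qed
  from this[of T u] u have
    "(\<Sum>k\<in>{1..T}. \<Sum>i\<in>I. v k i * l k i) \<le> \<Phi> T u - \<Phi> 0 (v 1) + (\<Sum>k\<in>{1..T}. S k)" by simp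
  moreover have "(\<Sum>i\<in>I. u i * (\<Sum>k\<in>{1..T}. l k i)) = (\<Sum>k\<in>{1..T}. \<Sum>i\<in>I. u i * l k i)"
    by (simp add: sum_distrib_left) (rule sum.swap)
  ultimately show ?thesis
    by (simp add: \<Phi>_def S_def left_diff_distrib sum_subtractf diff_divide_distrib sum_distrib_left)
qed

section \<open>Exponential supermartingales\<close>

text \<open>Conditional expectation in weak form, tested against bounded functions of the past.
  Exponentials of bounded past sums are such functions, so the supermartingale arguments below need
  the conditional mean of \<open>C\<close> only, never that of a nonlinear function of it.\<close>

definition has_cond_mean :: "'w measure \<Rightarrow> 'w measure \<Rightarrow> ('w \<Rightarrow> real) \<Rightarrow> ('w \<Rightarrow> real) \<Rightarrow> bool" where
  "has_cond_mean M F C e \<longleftrightarrow>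
     (\<forall>G\<in>borel_measurable F. (\<exists>B. \<forall>w\<in>space M. \<bar>G w\<bar> \<le> B) \<longrightarrow>
        (\<integral>w. G w * C w \<partial>M) = (\<integral>w. G w * e w \<partial>M))"

lemma has_cond_meanD:
  assumes "has_cond_mean M F C e" "G \<in> borel_measurable F" "\<And>w. w \<in> space M \<Longrightarrow> \<bar>G w\<bar> \<le> B"
  shows "(\<integral>w. G w * C w \<partial>M) = (\<integral>w. G w * e w \<partial>M)"
  using assms unfolding has_cond_mean_def by blast

text \<open>With \<open>z = g / m\<close> this is \<open>2 z / (1 + z) \<le> ln (1 + 2 z)\<close>,
  the inequality behind implicit exploration: the extra \<open>g\<close> in the denominator pays for
  the curvature of the exponential, so that no second-order term is left.\<close>

lemma exp_ix_bound:
  fixes m g :: real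
  assumes "0 \<le> m" "0 < g"
  shows "(exp (2 * g / (m + g)) - 1) * m \<le> 2 * g"
proof (cases "m = 0")
  case False
  with assms have m: "0 < m" by simp
  define z where "z = g / m"
  have z: "0 \<le> z" using m assms by (simp add: z_def)
  \<comment> \<open>As \<open>2 z / (1 + z) = 2 - 2 / (1 + z)\<close> and \<open>f 0 = 2\<close>,
    the logarithmic inequality is \<open>f 0 \<le> f z\<close>.\<close>
  define f where "f = (\<lambda>s::real. ln (1 + 2 * s) + 2 / (1 + s))"
  have "f 0 \<le> f z"
  proof (rule DERIV_nonneg_imp_nondecreasing[OF z])
    fix s :: real assume s: "0 \<le> s" "s \<le> z"
    have "(f has_real_derivative 2 / (1 + 2 * s) - 2 / (1 + s)\<^sup>2) (at s)"
      unfolding f_def using s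
      by (auto intro!: derivative_eq_intros simp: power2_eq_square)
    moreover have "2 / (1 + s)\<^sup>2 \<le> 2 / (1 + 2 * s)"
      using s by (intro frac_le) (auto simp: power2_eq_square algebra_simps)
    ultimately show "\<exists>y. (f has_real_derivative y) (at s) \<and> 0 \<le> y"
      by (intro exI[of _ "2 / (1 + 2 * s) - 2 / (1 + s)\<^sup>2"]) simp
  qed
  moreover have "2 * z / (1 + z) = 2 - 2 / (1 + z)" using z by (simp add: field_simps)
  ultimately have "2 * z / (1 + z) \<le> ln (1 + 2 * z)" by (simp add: f_def)
  then have "exp (2 * z / (1 + z)) \<le> 1 + 2 * z"
    using z by (subst (asm) ln_ge_iff) auto
  moreover have "2 * g / (m + g) = 2 * z / (1 + z)"
    using m assms by (simp add: z_def field_simps)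
  ultimately have "exp (2 * g / (m + g)) - 1 \<le> 2 * z" by simp
  then have "(exp (2 * g / (m + g)) - 1) * m \<le> 2 * z * m"
    using m by (intro mult_right_mono) auto
  then show ?thesis using m by (simp add: z_def)
qed (use assms in simp)

text \<open>Replaces the exponential by an expression linear in \<open>c\<close>, to which
  \<open>has_cond_mean\<close> applies.\<close>

lemma exp_le_chord:
  fixes c s :: real
  assumes "0 \<le> c" "c \<le> 1"
  shows "exp (s * c) \<le> 1 + (exp s - 1) * c"
proof -
  have "convex_on UNIV (exp :: real \<Rightarrow> real)" by (rule exp_convex)
  from convex_onD[OF this, of c 0 s] assms show ?thesis by (simp add: algebra_simps)
qed

context prob_space
begin

lemma integrable_bounded:
  fixes f :: "'a \<Rightarrow> real"
  assumes "f \<in> borel_measurable M" "\<And>w. w \<in> space M \<Longrightarrow> \<bar>f w\<bar> \<le> B"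
  shows "integrable M f"
  by (rule integrable_const_bound[where B = B]) (use assms in auto)

lemma has_cond_meanI:
  assumes sub: "subalgebra M F"
    and C: "C \<in> borel_measurable M" "\<And>w. w \<in> space M \<Longrightarrow> \<bar>C w\<bar> \<le> c"
    and e: "e \<in> borel_measurable M"
    and eq: "AE w in M. real_cond_exp M F C w = e w"
  shows "has_cond_mean M F C e"
  unfolding has_cond_mean_def
proof (intro ballI impI, elim exE)
  fix G :: "'a \<Rightarrow> real" and B assume G: "G \<in> borel_measurable F" and B: "\<forall>w\<in>space M. \<bar>G w\<bar> \<le> B"
  interpret finite_measure_subalgebra M F by unfold_locales (fact sub)
  have GM: "G \<in> borel_measurable M" using G sub by (rule measurable_from_subalg[rotated])
  have int: "integrable M (\<lambda>w. G w * C w)"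
  proof (rule integrable_bounded[where B = "B * c"])
    show "\<bar>G w * C w\<bar> \<le> B * c" if "w \<in> space M" for w
      using B C(2)[OF that] that by (auto simp: abs_mult intro!: mult_mono intro: order_trans[OF abs_ge_zero])
  qed (use GM C in measurable)
  have "(\<integral>w. G w * C w \<partial>M) = (\<integral>w. G w * real_cond_exp M F C w \<partial>M)"
    using real_cond_exp_intg(2)[OF int G C(1)] by simp
  also have "\<dots> = (\<integral>w. G w * e w \<partial>M)"
    using eq GM C(1) e by (intro integral_cong_AE) auto
  finally show "(\<integral>w. G w * C w \<partial>M) = (\<integral>w. G w * e w \<partial>M)" .
qed

text \<open>The coefficients depend on the past only, so \<open>G * k i\<close> is again a bounded
  test function.\<close>

lemma has_cond_mean_sum:
  assumes "finite I" and sub: "subalgebra M F"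
    and C: "\<And>i. i \<in> I \<Longrightarrow> C i \<in> borel_measurable M" "\<And>i w. i \<in> I \<Longrightarrow> w \<in> space M \<Longrightarrow> \<bar>C i w\<bar> \<le> 1"
    and e: "\<And>i. i \<in> I \<Longrightarrow> e i \<in> borel_measurable M" "\<And>i w. i \<in> I \<Longrightarrow> w \<in> space M \<Longrightarrow> \<bar>e i w\<bar> \<le> 1"
    and k: "\<And>i. i \<in> I \<Longrightarrow> k i \<in> borel_measurable F" "\<And>i w. i \<in> I \<Longrightarrow> w \<in> space M \<Longrightarrow> \<bar>k i w\<bar> \<le> 1"
    and cm: "\<And>i. i \<in> I \<Longrightarrow> has_cond_mean M F (C i) (e i)"
  shows "has_cond_mean M F (\<lambda>w. \<Sum>i\<in>I. k i w * C i w) (\<lambda>w. \<Sum>i\<in>I. k i w * e i w)"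
  unfolding has_cond_mean_def
proof (intro ballI impI, elim exE)
  fix G :: "'a \<Rightarrow> real" and B assume G: "G \<in> borel_measurable F" and B: "\<forall>w\<in>space M. \<bar>G w\<bar> \<le> B"
  have GM: "G \<in> borel_measurable M" using G sub by (rule measurable_from_subalg[rotated])
  have kM: "k i \<in> borel_measurable M" if "i \<in> I" for i
    using k(1)[OF that] sub by (rule measurable_from_subalg[rotated])
  have Gk: "\<bar>G w * k i w\<bar> \<le> B" if "i \<in> I" "w \<in> space M" for i w
    using mult_mono[of "\<bar>G w\<bar>" B "\<bar>k i w\<bar>" 1] B k(2)[OF that] that
    by (auto simp: abs_mult intro: order_trans[OF abs_ge_zero])
  have int: "integrable M (\<lambda>w. G w * k i w * D w)"
    if i: "i \<in> I" and D: "D \<in> borel_measurable M" "\<And>w. w \<in> space M \<Longrightarrow> \<bar>D w\<bar> \<le> 1" for i D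
  proof (rule integrable_bounded[where B = B])
    show "\<bar>G w * k i w * D w\<bar> \<le> B" if "w \<in> space M" for w
      using mult_mono[of "\<bar>G w * k i w\<bar>" B "\<bar>D w\<bar>" 1] Gk[OF i that] D(2)[OF that]
      by (simp add: abs_mult order_trans[OF abs_ge_zero])
  qed (use GM kM[OF i] D in measurable)
  have "(\<integral>w. G w * (\<Sum>i\<in>I. k i w * C i w) \<partial>M) = (\<integral>w. (\<Sum>i\<in>I. G w * k i w * C i w) \<partial>M)"
    by (simp add: sum_distrib_left mult.assoc)
  also have "\<dots> = (\<Sum>i\<in>I. \<integral>w. G w * k i w * C i w \<partial>M)"
    by (intro Bochner_Integration.integral_sum int C)
  also have "\<dots> = (\<Sum>i\<in>I. \<integral>w. G w * k i w * e i w \<partial>M)"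
    by (intro sum.cong has_cond_meanD[OF cm, where B = B] refl Gk) (use G k in auto)
  also have "\<dots> = (\<integral>w. (\<Sum>i\<in>I. G w * k i w * e i w) \<partial>M)"
    by (intro Bochner_Integration.integral_sum[symmetric] int e)
  also have "\<dots> = (\<integral>w. G w * (\<Sum>i\<in>I. k i w * e i w) \<partial>M)"
    by (simp add: sum_distrib_left mult.assoc)
  finally show "(\<integral>w. G w * (\<Sum>i\<in>I. k i w * C i w) \<partial>M) = (\<integral>w. G w * (\<Sum>i\<in>I. k i w * e i w) \<partial>M)" .
qed

text \<open>The hypothesis \<open>super\<close> is the tested form of "exp (Z t) has conditional
  mean at most 1". With the exponential of the earlier partial sum as \<open>G\<close> it keeps the
  exponential moment of the sum at most 1, and Markov's inequality gives the tail.\<close>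

lemma exp_supermartingale_tail:
  fixes Z :: "nat \<Rightarrow> 'a \<Rightarrow> real"
  assumes sub: "\<And>t. subalgebra M (F t)"
    and filt: "\<And>s t. s \<le> t \<Longrightarrow> sets (F s) \<subseteq> sets (F t)"
    and Z: "\<And>t. t \<in> {1..T} \<Longrightarrow> Z t \<in> borel_measurable (F t)"
    and bnd: "\<And>t w. t \<in> {1..T} \<Longrightarrow> w \<in> space M \<Longrightarrow> \<bar>Z t w\<bar> \<le> B"
    and super: "\<And>t (G :: 'a \<Rightarrow> real) c. t \<in> {1..T} \<Longrightarrow> G \<in> borel_measurable (F (t - 1)) \<Longrightarrow>
      (\<And>w. w \<in> space M \<Longrightarrow> 0 \<le> G w \<and> G w \<le> c) \<Longrightarrow> (\<integral>w. G w * exp (Z t w) \<partial>M) \<le> (\<integral>w. G w \<partial>M)"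
  shows "prob {w \<in> space M. L < (\<Sum>t\<in>{1..T}. Z t w)} \<le> exp (- L)"
proof -
  have subF: "subalgebra (F t) (F s)" if "s \<le> t" for s t
    using sub[of s] sub[of t] filt[OF that] by (auto simp: subalgebra_def)
  have meas: "(\<lambda>w. \<Sum>k\<in>{1..t}. Z k w) \<in> borel_measurable (F t)" if "t \<le> T" for t
    using that by (intro borel_measurable_sum measurable_from_subalg[OF subF Z]) auto
  have bound: "\<bar>\<Sum>k\<in>{1..t}. Z k w\<bar> \<le> real t * B" if "t \<le> T" "w \<in> space M" for t w
  proof -
    have "\<bar>\<Sum>k\<in>{1..t}. Z k w\<bar> \<le> (\<Sum>k\<in>{1..t}. B)"
      using that by (intro order_trans[OF sum_abs] sum_mono bnd) auto
    then show ?thesis by simp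
  qed
  have le1: "(\<integral>w. exp (\<Sum>k\<in>{1..t}. Z k w) \<partial>M) \<le> 1" if "t \<le> T" for t
    using that
  proof (induction t)
    case 0
    then show ?case by (simp add: prob_space)
  next
    case (Suc t)
    have "(\<integral>w. exp (\<Sum>k\<in>{1..Suc t}. Z k w) \<partial>M) = (\<integral>w. exp (\<Sum>k\<in>{1..t}. Z k w) * exp (Z (Suc t) w) \<partial>M)"
      by (simp add: exp_add)
    also have "\<dots> \<le> (\<integral>w. exp (\<Sum>k\<in>{1..t}. Z k w) \<partial>M)"
      using Suc.prems meas[of t] bound[of t]
      by (intro super[of _ _ "exp (real t * B)"]) (auto simp: abs_le_iff)
    also have "\<dots> \<le> 1" using Suc by simp
    finally show ?case .
  qed
  have mM: "(\<lambda>w. \<Sum>k\<in>{1..T}. Z k w) \<in> borel_measurable M"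
    by (rule measurable_from_subalg[OF sub meas]) simp
  have int: "integrable M (\<lambda>w. exp (\<Sum>k\<in>{1..T}. Z k w))"
    by (rule integrable_bounded[where B = "exp (real T * B)"])
      (use mM bound[of T] in \<open>auto simp: abs_le_iff\<close>)
  have "prob {w \<in> space M. L < (\<Sum>t\<in>{1..T}. Z t w)} \<le> prob {w \<in> space M. exp L \<le> exp (\<Sum>t\<in>{1..T}. Z t w)}"
    using mM by (intro finite_measure_mono) auto
  also have "\<dots> \<le> (\<integral>w. exp (\<Sum>k\<in>{1..T}. Z k w) \<partial>M) / exp L"
    by (rule integral_Markov_inequality_measure[OF int, where A = "{}"]) auto
  also have "\<dots> \<le> exp (- L)"
    using le1[of T] by (simp add: exp_minus divide_simps)
  finally show ?thesis .
qed

text \<open>Given the past, the chord bound replaces the exponential of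
  \<open>2 g C / (m + g)\<close> by \<open>1 + b C\<close>, whose mean is
  \<open>1 + b m l \<le> 1 + 2 g l \<le> exp (2 g l)\<close>; this is the compensator in
  \<open>Z\<close>. \<open>C\<close> takes values in [0, 1] and not only 0 and 1, since it carries
  the random reward besides the visit.\<close>

lemma ix_tail:
  fixes C m l :: "nat \<Rightarrow> 'a \<Rightarrow> real"
  assumes sub: "\<And>t. subalgebra M (F t)"
    and filt: "\<And>s t. s \<le> t \<Longrightarrow> sets (F s) \<subseteq> sets (F t)"
    and C: "\<And>t. t \<in> {1..T} \<Longrightarrow> C t \<in> borel_measurable (F t)"
      "\<And>t w. t \<in> {1..T} \<Longrightarrow> w \<in> space M \<Longrightarrow> 0 \<le> C t w \<and> C t w \<le> 1"
    and m: "\<And>t. t \<in> {1..T} \<Longrightarrow> m t \<in> borel_measurable (F (t - 1))"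
      "\<And>t w. t \<in> {1..T} \<Longrightarrow> w \<in> space M \<Longrightarrow> 0 \<le> m t w"
    and l: "\<And>t. t \<in> {1..T} \<Longrightarrow> l t \<in> borel_measurable (F (t - 1))"
      "\<And>t w. t \<in> {1..T} \<Longrightarrow> w \<in> space M \<Longrightarrow> 0 \<le> l t w \<and> l t w \<le> 1"
    and g: "0 < g"
    and cm: "\<And>t. t \<in> {1..T} \<Longrightarrow> has_cond_mean M (F (t - 1)) (C t) (\<lambda>w. m t w * l t w)"
  shows "prob {w \<in> space M. L / (2 * g) < (\<Sum>t\<in>{1..T}. C t w / (m t w + g) - l t w)} \<le> exp (- L)"
proof -
  define Z where "Z t w = 2 * g * (C t w / (m t w + g) - l t w)" for t w
  have subF: "subalgebra (F t) (F s)" if "s \<le> t" for s t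
    using sub[of s] sub[of t] filt[OF that] by (auto simp: subalgebra_def)
  have ratio: "0 \<le> C t w / (m t w + g) \<and> C t w / (m t w + g) \<le> 1 / g"
    if "t \<in> {1..T}" "w \<in> space M" for t w
    using C(2)[OF that] m(2)[OF that] g by (auto intro!: frac_le divide_nonneg_nonneg)
  have "prob {w \<in> space M. L < (\<Sum>t\<in>{1..T}. Z t w)} \<le> exp (- L)"
  proof (rule exp_supermartingale_tail[where B = "2 + 2 * g", OF sub filt])
    fix t assume t: "t \<in> {1..T}"
    have mt: "m t \<in> borel_measurable (F t)" "l t \<in> borel_measurable (F t)"
      using measurable_from_subalg[OF subF m(1)[OF t]] measurable_from_subalg[OF subF l(1)[OF t]] by auto
    then show "Z t \<in> borel_measurable (F t)"
      unfolding Z_def using C(1)[OF t] by measurable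
    show "\<bar>Z t w\<bar> \<le> 2 + 2 * g" if w: "w \<in> space M" for w
    proof -
      have "\<bar>Z t w\<bar> = 2 * g * \<bar>C t w / (m t w + g) - l t w\<bar>"
        using g by (simp add: Z_def abs_mult)
      also have "\<dots> \<le> 2 * g * (1 / g + 1)"
        using ratio[OF t w] l(2)[OF t w] g by (intro mult_left_mono) auto
      also have "\<dots> = 2 + 2 * g" using g by (simp add: field_simps)
      finally show ?thesis .
    qed
    fix G :: "'a \<Rightarrow> real" and c assume G: "G \<in> borel_measurable (F (t - 1))"
      and Gb: "\<And>w. w \<in> space M \<Longrightarrow> 0 \<le> G w \<and> G w \<le> c"
    \<comment> \<open>\<open>b\<close> is the slope of the chord. It and the factor
      \<open>exp (- (2 * g * l t w))\<close> are known before the episode, so they move into the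
      test function and only \<open>C t\<close> is left to average.\<close>
    define b where "b w = exp (2 * g / (m t w + g)) - 1" for w
    define G' where "G' w = G w * exp (- (2 * g * l t w))" for w
    have b_meas: "b \<in> borel_measurable (F (t - 1))" unfolding b_def using m(1)[OF t] by measurable
    have G'_meas: "G' \<in> borel_measurable (F (t - 1))" unfolding G'_def using G l(1)[OF t] by measurable
    have b: "0 \<le> b w \<and> b w \<le> exp 2" if "w \<in> space M" for w
    proof -
      have "0 \<le> 2 * g / (m t w + g)" "2 * g / (m t w + g) \<le> 2"
        using m(2)[OF t that] g by (auto simp: divide_simps)
      then have "1 \<le> exp (2 * g / (m t w + g))" "exp (2 * g / (m t w + g)) \<le> exp 2" by auto
      then show ?thesis unfolding b_def by linarith
    qed
    have bm: "b w * m t w \<le> 2 * g" if "w \<in> space M" for w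
      unfolding b_def using m(2)[OF t that] g by (rule exp_ix_bound)
    have G'_b: "0 \<le> G' w \<and> G' w \<le> G w" if "w \<in> space M" for w
      using Gb[OF that] l(2)[OF t that] g unfolding G'_def by (auto intro!: mult_left_le)
    have M: "G \<in> borel_measurable M" "G' \<in> borel_measurable M" "b \<in> borel_measurable M"
      "C t \<in> borel_measurable M" "m t \<in> borel_measurable M" "l t \<in> borel_measurable M"
      using measurable_from_subalg[OF sub] G G'_meas b_meas C(1)[OF t] m(1)[OF t] l(1)[OF t] by blast+
    have Gc: "\<bar>G' w\<bar> \<le> c" if "w \<in> space M" for w
      using G'_b[OF that] Gb[OF that] by linarith
    have i1: "integrable M G'" by (rule integrable_bounded[OF M(2) Gc])
    have bb: "\<bar>G' w * b w\<bar> \<le> c * exp 2" if "w \<in> space M" for w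
      using G'_b[OF that] Gb[OF that] b[OF that] by (auto simp: abs_mult intro!: mult_mono)
    have i2: "integrable M (\<lambda>w. G' w * b w * C t w)"
    proof (rule integrable_bounded[where B = "c * exp 2"])
      show "\<bar>G' w * b w * C t w\<bar> \<le> c * exp 2" if "w \<in> space M" for w
        using mult_mono[OF bb[OF that], of "\<bar>C t w\<bar>" 1] C(2)[OF t that]
          order_trans[OF abs_ge_zero bb[OF that]] by (auto simp: abs_mult)
    qed (use M in measurable)
    have le: "G' w * b w * (m t w * l t w) \<le> G' w * (2 * g * l t w)"
      "0 \<le> G' w * b w * (m t w * l t w)" if "w \<in> space M" for w
    proof -
      have "G' w * (b w * m t w * l t w) \<le> G' w * (2 * g * l t w)"
        using bm[OF that] l(2)[OF t that] G'_b[OF that] by (intro mult_left_mono mult_right_mono) auto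
      then show "G' w * b w * (m t w * l t w) \<le> G' w * (2 * g * l t w)" by (simp add: ac_simps)
      show "0 \<le> G' w * b w * (m t w * l t w)"
        using G'_b[OF that] b[OF that] m(2)[OF t that] l(2)[OF t that] by simp
    qed
    \<comment> \<open>\<open>m t\<close> carries no upper bound here; boundedness comes from
      \<open>b w * m t w \<le> 2 * g\<close>.\<close>
    have i3: "integrable M (\<lambda>w. G' w * b w * (m t w * l t w))"
    proof (rule integrable_bounded[where B = "c * (2 * g)"])
      show "\<bar>G' w * b w * (m t w * l t w)\<bar> \<le> c * (2 * g)" if "w \<in> space M" for w
      proof -
        have "G' w * (2 * g * l t w) \<le> c * (2 * g)"
          using G'_b[OF that] Gb[OF that] l(2)[OF t that] g
          by (intro mult_mono mult_left_le) auto
        then show ?thesis using le[OF that] by linarith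
      qed
    qed (use M in measurable)
    have "(\<integral>w. G w * exp (Z t w) \<partial>M) \<le> (\<integral>w. G' w + G' w * b w * C t w \<partial>M)"
    proof (rule integral_mono)
      show "integrable M (\<lambda>w. G' w + G' w * b w * C t w)" using i1 i2 by simp
      show *: "G w * exp (Z t w) \<le> G' w + G' w * b w * C t w" if "w \<in> space M" for w
      proof -
        have "exp (2 * g / (m t w + g) * C t w) \<le> 1 + b w * C t w"
          unfolding b_def by (rule exp_le_chord) (use C(2)[OF t that] in auto)
        then have "G' w * exp (2 * g / (m t w + g) * C t w) \<le> G' w * (1 + b w * C t w)"
          using G'_b[OF that] by (intro mult_left_mono) auto
        moreover have "G w * exp (Z t w) = G' w * exp (2 * g / (m t w + g) * C t w)"
          by (simp add: G'_def Z_def exp_add[symmetric] algebra_simps)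
        ultimately show ?thesis by (simp add: algebra_simps)
      qed
      show "integrable M (\<lambda>w. G w * exp (Z t w))"
      proof (rule Bochner_Integration.integrable_bound[OF \<open>integrable M (\<lambda>w. G' w + G' w * b w * C t w)\<close>])
        show "AE w in M. norm (G w * exp (Z t w)) \<le> norm (G' w + G' w * b w * C t w)"
        proof (rule AE_I2)
          fix w assume w: "w \<in> space M"
          have "0 \<le> G w * exp (Z t w)" using Gb[OF w] by simp
          with *[OF w] show "norm (G w * exp (Z t w)) \<le> norm (G' w + G' w * b w * C t w)" by simp
        qed
      qed (use M in \<open>unfold Z_def, measurable\<close>)
    qed
    also have "\<dots> = (\<integral>w. G' w \<partial>M) + (\<integral>w. G' w * b w * (m t w * l t w) \<partial>M)"
      using i1 i2 has_cond_meanD[OF cm[OF t], of "\<lambda>w. G' w * b w" "c * exp 2"] G'_meas b_meas bb by simp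
    also have "\<dots> = (\<integral>w. G' w + G' w * b w * (m t w * l t w) \<partial>M)"
      using i1 i3 by simp
    also have "\<dots> \<le> (\<integral>w. G w \<partial>M)"
    proof (rule integral_mono)
      show "G' w + G' w * b w * (m t w * l t w) \<le> G w" if "w \<in> space M" for w
      proof -
        have "G' w + G' w * b w * (m t w * l t w) \<le> G' w * (1 + 2 * g * l t w)"
          using le(1)[OF that] by (simp add: algebra_simps)
        also have "\<dots> \<le> G' w * exp (2 * g * l t w)"
          using G'_b[OF that] by (intro mult_left_mono exp_ge_add_one_self) auto
        also have "\<dots> = G w" by (simp add: G'_def exp_minus)
        finally show ?thesis .
      qed
      show "integrable M G" by (rule integrable_bounded[OF M(1), where B = c]) (use Gb in auto)
    qed (use i1 i3 in simp)
    finally show "(\<integral>w. G w * exp (Z t w) \<partial>M) \<le> (\<integral>w. G w \<partial>M)" .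
  qed
  moreover have "(\<Sum>t\<in>{1..T}. Z t w) = 2 * g * (\<Sum>t\<in>{1..T}. C t w / (m t w + g) - l t w)" for w
    by (simp add: Z_def sum_distrib_left)
  ultimately show ?thesis using g by (simp add: pos_divide_less_eq mult.commute)
qed

text \<open>For nonnegative \<open>s\<close> one has \<open>exp (- s) \<le> 1 - s + s^2 / 2\<close>,
  and \<open>Y^2 \<le> B Y\<close> makes this linear in \<open>Y\<close>: with
  \<open>s = lam Y\<close> it becomes \<open>1 - d Y\<close>. After passing to the mean
  \<open>e\<close>, the bounds \<open>1 - d e \<le> exp (- d e)\<close> and \<open>e \<le> B\<close>
  leave a cost of \<open>lam^2 B^2 / 2\<close> per episode, which \<open>Z\<close>
  subtracts.\<close>

lemma lower_tail:
  fixes Y e :: "nat \<Rightarrow> 'a \<Rightarrow> real"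
  assumes sub: "\<And>t. subalgebra M (F t)"
    and filt: "\<And>s t. s \<le> t \<Longrightarrow> sets (F s) \<subseteq> sets (F t)"
    and Y: "\<And>t. t \<in> {1..T} \<Longrightarrow> Y t \<in> borel_measurable (F t)"
      "\<And>t w. t \<in> {1..T} \<Longrightarrow> w \<in> space M \<Longrightarrow> 0 \<le> Y t w \<and> Y t w \<le> B"
    and e: "\<And>t. t \<in> {1..T} \<Longrightarrow> e t \<in> borel_measurable (F (t - 1))"
      "\<And>t w. t \<in> {1..T} \<Longrightarrow> w \<in> space M \<Longrightarrow> 0 \<le> e t w \<and> e t w \<le> B"
    and lam: "0 < lam"
    and cm: "\<And>t. t \<in> {1..T} \<Longrightarrow> has_cond_mean M (F (t - 1)) (Y t) (e t)"
  shows "prob {w \<in> space M. lam * B\<^sup>2 * T / 2 + L / lam < (\<Sum>t\<in>{1..T}. e t w - Y t w)} \<le> exp (- L)"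
proof -
  define Z where "Z t w = lam * (e t w - Y t w) - lam\<^sup>2 * B\<^sup>2 / 2" for t w
  have subF: "subalgebra (F t) (F s)" if "s \<le> t" for s t
    using sub[of s] sub[of t] filt[OF that] by (auto simp: subalgebra_def)
  have "prob {w \<in> space M. L < (\<Sum>t\<in>{1..T}. Z t w)} \<le> exp (- L)"
  proof (rule exp_supermartingale_tail[where B = "lam * B + lam\<^sup>2 * B\<^sup>2 / 2", OF sub filt])
    fix t assume t: "t \<in> {1..T}"
    have "e t \<in> borel_measurable (F t)"
      using measurable_from_subalg[OF subF e(1)[OF t]] by auto
    then show "Z t \<in> borel_measurable (F t)"
      unfolding Z_def using Y(1)[OF t] by measurable
    show "\<bar>Z t w\<bar> \<le> lam * B + lam\<^sup>2 * B\<^sup>2 / 2" if w: "w \<in> space M" for w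
    proof -
      have "\<bar>Z t w\<bar> \<le> \<bar>lam * (e t w - Y t w)\<bar> + \<bar>lam\<^sup>2 * B\<^sup>2 / 2\<bar>"
        unfolding Z_def by (rule abs_triangle_ineq4)
      also have "\<bar>lam * (e t w - Y t w)\<bar> \<le> lam * B"
        using lam Y(2)[OF t w] e(2)[OF t w] by (auto simp: abs_mult abs_le_iff)
      finally show ?thesis by simp
    qed
    fix G :: "'a \<Rightarrow> real" and c assume G: "G \<in> borel_measurable (F (t - 1))"
      and Gb: "\<And>w. w \<in> space M \<Longrightarrow> 0 \<le> G w \<and> G w \<le> c"
    define d where "d = lam - lam\<^sup>2 * B / 2"
    define G' where "G' w = G w * exp (lam * e t w - lam\<^sup>2 * B\<^sup>2 / 2)" for w
    have G'_meas: "G' \<in> borel_measurable (F (t - 1))" unfolding G'_def using G e(1)[OF t] by measurable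
    have M: "G \<in> borel_measurable M" "G' \<in> borel_measurable M"
      "Y t \<in> borel_measurable M" "e t \<in> borel_measurable M"
      using measurable_from_subalg[OF sub] G G'_meas Y(1)[OF t] e(1)[OF t] by blast+
    have G'_b: "0 \<le> G' w \<and> G' w \<le> c * exp (lam * B)" if "w \<in> space M" for w
    proof -
      have "lam * e t w \<le> lam * B" using e(2)[OF t that] lam by simp
      moreover have "0 \<le> lam\<^sup>2 * B\<^sup>2 / 2" by simp
      ultimately have "exp (lam * e t w - lam\<^sup>2 * B\<^sup>2 / 2) \<le> exp (lam * B)"
        unfolding exp_le_cancel_iff by linarith
      then show ?thesis using Gb[OF that] unfolding G'_def by (auto intro!: mult_mono)
    qed
    have int: "integrable M (\<lambda>w. G' w * U w)"
      if "U \<in> borel_measurable M" "\<And>w. w \<in> space M \<Longrightarrow> \<bar>U w\<bar> \<le> u" for U u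
    proof (rule integrable_bounded[where B = "c * exp (lam * B) * u"])
      show "\<bar>G' w * U w\<bar> \<le> c * exp (lam * B) * u" if "w \<in> space M" for w
        using G'_b[OF that] \<open>\<And>w. w \<in> space M \<Longrightarrow> \<bar>U w\<bar> \<le> u\<close>[OF that]
        by (auto simp: abs_mult intro!: mult_mono)
    qed (use M that in measurable)
    have iY: "integrable M (\<lambda>w. G' w * Y t w)" by (rule int[of "Y t" B, OF M(3)]) (use Y(2)[OF t] in auto)
    have ie: "integrable M (\<lambda>w. G' w * e t w)" by (rule int[of "e t" B, OF M(4)]) (use e(2)[OF t] in auto)
    have i1: "integrable M G'" using int[of "\<lambda>_. 1" 1] by simp
    have "(\<integral>w. G w * exp (Z t w) \<partial>M) \<le> (\<integral>w. G' w - d * (G' w * Y t w) \<partial>M)"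
    proof (rule integral_mono)
      have eq: "G w * exp (Z t w) = G' w * exp (- (lam * Y t w))" for w
        by (simp add: G'_def Z_def exp_add[symmetric] algebra_simps)
      show "integrable M (\<lambda>w. G w * exp (Z t w))"
        unfolding eq by (rule int[of _ 1]) (use M Y(2)[OF t] lam in auto)
      show "G w * exp (Z t w) \<le> G' w - d * (G' w * Y t w)" if w: "w \<in> space M" for w
      proof -
        define s where "s = lam * Y t w"
        have s: "0 \<le> s" using lam Y(2)[OF t w] by (simp add: s_def)
        \<comment> \<open>The quadratic Taylor bound for exp s is inverted: its polynomial times
          \<open>1 - s + s^2 / 2\<close> equals \<open>1 + s^4 / 4\<close>, which is at least
          1.\<close>
        have "exp (- s) \<le> 1 - s + s\<^sup>2 / 2"
        proof -
          have "1 + s + s\<^sup>2 / 2 \<le> exp s" using exp_lower_Taylor_quadratic[OF s] by simp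
          moreover have "0 < 1 + s + s\<^sup>2 / 2" using s by (simp add: add_pos_nonneg)
          ultimately have "exp (- s) \<le> 1 / (1 + s + s\<^sup>2 / 2)"
            by (simp add: exp_minus inverse_eq_divide frac_le)
          also have "\<dots> \<le> 1 - s + s\<^sup>2 / 2"
          proof -
            have "(1 - s + s\<^sup>2 / 2) * (1 + s + s\<^sup>2 / 2) = 1 + s ^ 4 / 4"
              by (simp add: power2_eq_square power4_eq_xxxx algebra_simps)
            then have "1 \<le> (1 - s + s\<^sup>2 / 2) * (1 + s + s\<^sup>2 / 2)" by simp
            with \<open>0 < 1 + s + s\<^sup>2 / 2\<close> show ?thesis by (simp add: pos_divide_le_eq)
          qed
          finally show ?thesis .
        qed
        also have "s\<^sup>2 \<le> lam\<^sup>2 * (B * Y t w)"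
          unfolding s_def power_mult_distrib using Y(2)[OF t w]
          by (intro mult_left_mono) (auto simp: power2_eq_square intro!: mult_right_mono)
        finally have "exp (- s) \<le> 1 - d * Y t w"
          by (simp add: s_def d_def algebra_simps)
        then have "G' w * exp (- s) \<le> G' w * (1 - d * Y t w)"
          using G'_b[OF w] by (intro mult_left_mono) auto
        then show ?thesis by (simp add: eq s_def algebra_simps)
      qed
    qed (use i1 iY in simp)
    also have "\<dots> = (\<integral>w. G' w \<partial>M) - d * (\<integral>w. G' w * Y t w \<partial>M)"
      using i1 iY by simp
    also have "(\<integral>w. G' w * Y t w \<partial>M) = (\<integral>w. G' w * e t w \<partial>M)"
      by (rule has_cond_meanD[OF cm[OF t] G'_meas, where B = "c * exp (lam * B)"]) (use G'_b in auto)
    also have "(\<integral>w. G' w \<partial>M) - d * (\<integral>w. G' w * e t w \<partial>M) = (\<integral>w. G' w - d * (G' w * e t w) \<partial>M)"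
      using i1 ie by simp
    also have "\<dots> \<le> (\<integral>w. G w \<partial>M)"
    proof (rule integral_mono)
      show "G' w - d * (G' w * e t w) \<le> G w" if w: "w \<in> space M" for w
      proof -
        have "- d * e t w \<le> - (lam * e t w - lam\<^sup>2 * B\<^sup>2 / 2)"
        proof -
          have "lam\<^sup>2 * (B * e t w) \<le> lam\<^sup>2 * (B * B)"
            using e(2)[OF t w] by (intro mult_left_mono) auto
          then show ?thesis by (simp add: d_def power2_eq_square algebra_simps)
        qed
        then have "1 - d * e t w \<le> exp (- (lam * e t w - lam\<^sup>2 * B\<^sup>2 / 2))"
          using exp_ge_add_one_self[of "- (lam * e t w - lam\<^sup>2 * B\<^sup>2 / 2)"] by linarith
        then have "G' w * (1 - d * e t w) \<le> G' w * exp (- (lam * e t w - lam\<^sup>2 * B\<^sup>2 / 2))"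
          using G'_b[OF w] by (intro mult_left_mono) auto
        also have "\<dots> = G w"
          unfolding G'_def mult.assoc exp_add[symmetric] by simp
        finally show ?thesis by (simp add: algebra_simps)
      qed
      show "integrable M G" by (rule integrable_bounded[OF M(1), where B = c]) (use Gb in auto)
    qed (use i1 ie in simp)
    finally show "(\<integral>w. G w * exp (Z t w) \<partial>M) \<le> (\<integral>w. G w \<partial>M)" .
  qed
  moreover have "lam * B\<^sup>2 * T / 2 + L / lam < (\<Sum>t\<in>{1..T}. e t w - Y t w) \<longleftrightarrow> L < (\<Sum>t\<in>{1..T}. Z t w)" for w
  proof -
    have "(\<Sum>t\<in>{1..T}. Z t w) = lam * (\<Sum>t\<in>{1..T}. e t w - Y t w) - lam * (lam * B\<^sup>2 * T / 2)"
      by (simp add: Z_def sum_subtractf sum_distrib_left[symmetric] power2_eq_square)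
    also have "L < \<dots> \<longleftrightarrow> L < lam * ((\<Sum>t\<in>{1..T}. e t w - Y t w) - lam * B\<^sup>2 * T / 2)"
      by (simp add: algebra_simps)
    also have "\<dots> \<longleftrightarrow> L / lam < (\<Sum>t\<in>{1..T}. e t w - Y t w) - lam * B\<^sup>2 * T / 2"
      using lam by (simp add: pos_divide_less_eq mult.commute)
    finally show ?thesis by linarith
  qed
  ultimately show ?thesis by simp
qed

end

section \<open>Balanced transitions\<close>

locale game_tree =
  fixes H :: nat and X :: "nat \<Rightarrow> 'x set" and A :: "'x \<Rightarrow> 'a set" and par :: "'x \<Rightarrow> 'x \<times> 'a"
  assumes tree: "infoset_tree H X A par"
begin

abbreviation K :: real where "K \<equiv> A_X H X A"
abbreviation ps :: "nat \<Rightarrow> 'x \<Rightarrow> real" where "ps \<equiv> pstar H X A par"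
abbreviation Policies :: "(nat \<Rightarrow> 'x \<Rightarrow> 'a \<Rightarrow> real) set" where "Policies \<equiv> Pi_max H X A"
abbreviation tau :: "'x \<Rightarrow> real" where "tau \<equiv> Atau H X A par"
abbreviation ch :: "nat \<Rightarrow> 'x \<Rightarrow> 'a \<Rightarrow> 'x set" where "ch \<equiv> children X par"

lemma H_ge_1: "1 \<le> H" using tree by (simp add: infoset_tree_def)

lemma finite_X: "h \<in> {1..H} \<Longrightarrow> finite (X h)" using tree by (simp add: infoset_tree_def)

lemma X_disjoint: "h \<in> {1..H} \<Longrightarrow> h' \<in> {1..H} \<Longrightarrow> h \<noteq> h' \<Longrightarrow> X h \<inter> X h' = {}"
  using tree unfolding infoset_tree_def by blast

lemma X_unique: "h \<in> {1..H} \<Longrightarrow> h' \<in> {1..H} \<Longrightarrow> x \<in> X h \<Longrightarrow> x \<in> X h' \<Longrightarrow> h = h'"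
  using X_disjoint by blast

lemma finite_A: "h \<in> {1..H} \<Longrightarrow> x \<in> X h \<Longrightarrow> finite (A x)"
  and A_nonempty: "h \<in> {1..H} \<Longrightarrow> x \<in> X h \<Longrightarrow> A x \<noteq> {}"
  using tree unfolding infoset_tree_def by blast+

lemma par_in: "h \<in> {1..<H} \<Longrightarrow> x \<in> X (Suc h) \<Longrightarrow> fst (par x) \<in> X h"
    "h \<in> {1..<H} \<Longrightarrow> x \<in> X (Suc h) \<Longrightarrow> snd (par x) \<in> A (fst (par x))"
  using tree unfolding infoset_tree_def by blast+

lemma children_nonempty: "h \<in> {1..<H} \<Longrightarrow> x \<in> X h \<Longrightarrow> a \<in> A x \<Longrightarrow> ch h x a \<noteq> {}"
  using tree unfolding infoset_tree_def by blast

lemma finite_children: "h \<in> {1..<H} \<Longrightarrow> finite (ch h x a)"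
  unfolding children_def using finite_X[of "Suc h"] by simp

lemma X_nonempty: "h \<in> {1..H} \<Longrightarrow> X h \<noteq> {}"
proof (induction h)
  case (Suc h)
  show ?case
  proof (cases "h = 0")
    case True then show ?thesis using tree by (simp add: infoset_tree_def)
  next
    case False
    then have h: "h \<in> {1..<H}" "h \<in> {1..H}" using Suc.prems by auto
    then obtain x a where x: "x \<in> X h" "a \<in> A x" using Suc.IH A_nonempty by blast
    show ?thesis using children_nonempty[OF h(1) x] by (auto simp: children_def)
  qed
qed simp

text \<open>Perfect recall: \<open>par\<close> sends each information set of level
  \<open>h + 1\<close> to a single pair of level \<open>h\<close>, so the children sets partition
  level \<open>h + 1\<close>.\<close>

lemma sum_children:
  fixes f :: "'x \<Rightarrow> real"
  assumes h: "h \<in> {1..<H}"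
  shows "(\<Sum>x\<in>X (Suc h). f x) = (\<Sum>x\<in>X h. \<Sum>a\<in>A x. \<Sum>y\<in>ch h x a. f y)"
proof -
  have fin: "finite (X h)" "finite (X (Suc h))" "\<And>x. x \<in> X h \<Longrightarrow> finite (A x)"
    using h finite_X[of h] finite_X[of "Suc h"] finite_A[of h] by auto
  have par_Sigma: "par x \<in> Sigma (X h) A" if "x \<in> X (Suc h)" for x
    using par_in[OF h that] by (cases "par x") auto
  have "(\<Sum>x\<in>X (Suc h). f x) = (\<Sum>z\<in>Sigma (X h) A. \<Sum>y\<in>{y \<in> X (Suc h). par y = z}. f y)"
    using fin par_Sigma by (intro sum.group[symmetric] finite_SigmaI image_subsetI) auto
  also have "\<dots> = (\<Sum>x\<in>X h. \<Sum>a\<in>A x. \<Sum>y\<in>ch h x a. f y)"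
    using fin by (subst sum.Sigma) (auto simp: children_def split_beta)
  finally show ?thesis .
qed

text \<open>All levels at once, with cardinality A_X (\<open>K_eq_card\<close>). One FTRL instance
  over this set replaces the \<open>H\<close> levels.\<close>

definition idx :: "(nat \<times> 'x \<times> 'a) set" where
  "idx = (SIGMA h:{1..H}. Sigma (X h) A)"

lemma finite_idx: "finite idx"
  unfolding idx_def using finite_X finite_A by (intro finite_SigmaI) auto

lemma sum_idx: "(\<Sum>(h, x, a)\<in>idx. f h x a) = (\<Sum>h\<in>{1..H}. \<Sum>x\<in>X h. \<Sum>a\<in>A x. f h x a)"
proof -
  have "(\<Sum>h\<in>{1..H}. \<Sum>x\<in>X h. \<Sum>a\<in>A x. f h x a) = (\<Sum>h\<in>{1..H}. \<Sum>z\<in>Sigma (X h) A. f h (fst z) (snd z))"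
    using finite_X finite_A by (intro sum.cong refl) (subst sum.Sigma, auto simp: split_beta)
  also have "\<dots> = (\<Sum>(h, x, a)\<in>idx. f h x a)"
    unfolding idx_def using finite_X finite_A
    by (subst sum.Sigma) (auto simp: split_beta intro!: finite_SigmaI)
  finally show ?thesis by simp
qed

lemma sum_all_infosets: "(\<Sum>x\<in>all_infosets H X. f x) = (\<Sum>h\<in>{1..H}. \<Sum>x\<in>X h. f x)"
  unfolding all_infosets_def using finite_X X_disjoint by (intro sum.UNION_disjoint) auto

lemma K_eq_sum: "K = (\<Sum>h\<in>{1..H}. \<Sum>x\<in>X h. real (card (A x)))"
  unfolding A_X_def by (rule sum_all_infosets)

lemma K_eq_card: "K = real (card idx)"
proof -
  have "real (card idx) = (\<Sum>(h, x, a)\<in>idx. 1)" by (simp add: split_beta)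
  also have "\<dots> = K" unfolding sum_idx K_eq_sum by simp
  finally show ?thesis by simp
qed

lemma level_card_ge_1: "h \<in> {1..H} \<Longrightarrow> 1 \<le> (\<Sum>x\<in>X h. real (card (A x)))"
proof -
  assume h: "h \<in> {1..H}"
  then obtain x where x: "x \<in> X h" using X_nonempty by blast
  have "1 \<le> card (A x)" using finite_A[OF h x] A_nonempty[OF h x] by (simp add: Suc_le_eq card_gt_0_iff)
  then have "1 \<le> real (card (A x))" by simp
  also have "\<dots> \<le> (\<Sum>x\<in>X h. real (card (A x)))"
    using x finite_X[OF h] by (intro member_le_sum) auto
  finally show ?thesis .
qed

lemma H_le_K: "real H \<le> K"
proof -
  have "real H = (\<Sum>h\<in>{1..H}. 1)" by simp
  also have "\<dots> \<le> K" unfolding K_eq_sum by (intro sum_mono level_card_ge_1)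
  finally show ?thesis .
qed

lemma K_ge_1: "1 \<le> K" using H_le_K H_ge_1 by simp

section \<open>Subtree weights\<close>

lemma anc_in: "h \<le> h' \<Longrightarrow> 1 \<le> h \<Longrightarrow> h' \<le> H \<Longrightarrow> x \<in> X h' \<Longrightarrow> anc par (h' - h) x \<in> X h"
proof (induction "h' - h" arbitrary: h)
  case (Suc n)
  have e: "h' - h = Suc (h' - Suc h)" using Suc.hyps by auto
  have "anc par (h' - Suc h) x \<in> X (Suc h)" using Suc by auto
  then have "fst (par (anc par (h' - Suc h) x)) \<in> X h" using Suc by (intro par_in) auto
  then show ?case unfolding e by (simp add: anc_def)
qed (simp add: anc_def)

text \<open>Lying below \<open>x\<close> becomes an equation for an iterate of \<open>par\<close>;
  uniqueness of the level of an information set fixes the number of iterations.\<close>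

lemma tau_eq:
  assumes h: "h \<in> {1..H}" and x: "x \<in> X h"
  shows "tau x = (\<Sum>h'\<in>{h..H}. \<Sum>x'\<in>X h'. if anc par (h' - h) x' = x then real (card (A x')) else 0)"
proof -
  have ge: "infoset_ge H X par x' x \<longleftrightarrow> h \<le> h' \<and> anc par (h' - h) x' = x"
    if "h' \<in> {1..H}" "x' \<in> X h'" for h' x'
    unfolding infoset_ge_def using that h x X_unique by blast
  have fin: "finite (all_infosets H X)" using finite_X by (auto simp: all_infosets_def)
  have "tau x = (\<Sum>x'\<in>all_infosets H X. if infoset_ge H X par x' x then real (card (A x')) else 0)"
    unfolding Atau_def using fin by (simp add: sum.inter_filter)
  also have "\<dots> = (\<Sum>h'\<in>{1..H}. \<Sum>x'\<in>X h'. if h \<le> h' \<and> anc par (h' - h) x' = x then real (card (A x')) else 0)"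
    unfolding sum_all_infosets by (intro sum.cong refl) (simp add: ge)
  also have "\<dots> = (\<Sum>h'\<in>{h..H}. \<Sum>x'\<in>X h'. if anc par (h' - h) x' = x then real (card (A x')) else 0)"
    using h by (intro sum.mono_neutral_cong_right) (auto intro: finite_X)
  finally show ?thesis .
qed

text \<open>Every information set has one ancestor on level \<open>h\<close>, so subtrees rooted on
  a common level are disjoint and nothing is counted twice.\<close>

lemma sum_tau_level:
  assumes h: "h \<in> {1..H}" and S: "S \<subseteq> X h"
  shows "(\<Sum>y\<in>S. tau y) = (\<Sum>h'\<in>{h..H}. \<Sum>x'\<in>X h'. if anc par (h' - h) x' \<in> S then real (card (A x')) else 0)"
proof -
  have fin: "finite S" using finite_subset[OF S finite_X[OF h]] .
  have "(\<Sum>y\<in>S. tau y) =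
      (\<Sum>y\<in>S. \<Sum>h'\<in>{h..H}. \<Sum>x'\<in>X h'. if anc par (h' - h) x' = y then real (card (A x')) else 0)"
    using S by (intro sum.cong refl tau_eq[OF h]) auto
  also have "\<dots> = (\<Sum>h'\<in>{h..H}. \<Sum>y\<in>S. \<Sum>x'\<in>X h'. if anc par (h' - h) x' = y then real (card (A x')) else 0)"
    by (rule sum.swap)
  also have "\<dots> = (\<Sum>h'\<in>{h..H}. \<Sum>x'\<in>X h'. \<Sum>y\<in>S. if anc par (h' - h) x' = y then real (card (A x')) else 0)"
    by (intro sum.cong refl sum.swap)
  finally show ?thesis using fin by (simp add: sum.delta')
qed

lemma sum_tau_roots: "(\<Sum>x\<in>X 1. tau x) = K"
proof -
  have "(\<Sum>x\<in>X 1. tau x) = (\<Sum>h'\<in>{1..H}. \<Sum>x'\<in>X h'. if anc par (h' - 1) x' \<in> X 1 then real (card (A x')) else 0)"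
    using H_ge_1 by (intro sum_tau_level) auto
  also have "\<dots> = K"
    unfolding K_eq_sum using anc_in[of 1] by (intro sum.cong refl) auto
  finally show ?thesis .
qed

lemma tau_rec:
  assumes h: "h \<in> {1..<H}" and x: "x \<in> X h"
  shows "tau x = real (card (A x)) + (\<Sum>a\<in>A x. \<Sum>y\<in>ch h x a. tau y)"
proof -
  have h': "h \<in> {1..H}" using h by auto
  have "(\<Sum>a\<in>A x. \<Sum>y\<in>ch h x a. tau y) = (\<Sum>y\<in>(\<Union>a\<in>A x. ch h x a). tau y)"
    using finite_A[OF h' x] finite_children[OF h]
    by (intro sum.UNION_disjoint[symmetric]) (auto simp: children_def)
  also have "(\<Union>a\<in>A x. ch h x a) = {y \<in> X (Suc h). fst (par y) = x}"
    using par_in[OF h] by (fastforce simp: children_def prod_eq_iff)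
  also have "(\<Sum>y\<in>{y \<in> X (Suc h). fst (par y) = x}. tau y) =
    (\<Sum>h'\<in>{Suc h..H}. \<Sum>x'\<in>X h'.
      if anc par (h' - Suc h) x' \<in> {y \<in> X (Suc h). fst (par y) = x} then real (card (A x')) else 0)"
    using h by (intro sum_tau_level) auto
  also have "\<dots> = (\<Sum>h'\<in>{Suc h..H}. \<Sum>x'\<in>X h'. if anc par (h' - h) x' = x then real (card (A x')) else 0)"
  proof (intro sum.cong refl if_cong)
    fix h' x' assume h1: "h' \<in> {Suc h..H}" and x': "x' \<in> X h'"
    have e: "h' - h = Suc (h' - Suc h)" using h1 by auto
    have "anc par (h' - Suc h) x' \<in> X (Suc h)" using h1 x' by (intro anc_in) auto
    then show "(anc par (h' - Suc h) x' \<in> {y \<in> X (Suc h). fst (par y) = x}) = (anc par (h' - h) x' = x)"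
      unfolding e by (simp add: anc_def)
  qed
  finally have "(\<Sum>a\<in>A x. \<Sum>y\<in>ch h x a. tau y) =
     (\<Sum>h'\<in>{Suc h..H}. \<Sum>x'\<in>X h'. if anc par (h' - h) x' = x then real (card (A x')) else 0)" .
  moreover have "(\<Sum>x'\<in>X h. if anc par (h - h) x' = x then real (card (A x')) else 0) = real (card (A x))"
    using x finite_X[OF h'] by (simp add: anc_def sum.delta')
  moreover have "{h..H} = insert h {Suc h..H}" using h by auto
  ultimately show ?thesis by (simp add: tau_eq[OF h' x])
qed

lemma tau_ge_card: "h \<in> {1..H} \<Longrightarrow> x \<in> X h \<Longrightarrow> real (card (A x)) \<le> tau x"
proof -
  assume h: "h \<in> {1..H}" and x: "x \<in> X h"
  have "x \<in> {x' \<in> all_infosets H X. infoset_ge H X par x' x}"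
    using h x unfolding infoset_ge_def all_infosets_def
    by (auto simp: anc_def intro!: bexI[of _ h])
  moreover have "finite (all_infosets H X)" using finite_X by (auto simp: all_infosets_def)
  ultimately show ?thesis unfolding Atau_def by (intro member_le_sum) auto
qed

lemma tau_pos:
  assumes "h \<in> {1..H}" "x \<in> X h"
  shows "0 < tau x"
proof -
  have "0 < card (A x)" using finite_A[OF assms] A_nonempty[OF assms] by (simp add: card_gt_0_iff)
  then show ?thesis using tau_ge_card[OF assms] by linarith
qed

section \<open>Reach probabilities and realization plans\<close>

text \<open>The transition part of \<open>opp_valid\<close> alone, so that facts about reach
  probabilities apply to every opponent and to p* alike.\<close>

definition valid_trans :: "('x \<Rightarrow> real) \<Rightarrow> (nat \<Rightarrow> 'x \<Rightarrow> 'a \<Rightarrow> 'x \<Rightarrow> real) \<Rightarrow> bool" where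
  "valid_trans q0 q \<longleftrightarrow> (\<forall>x\<in>X 1. 0 \<le> q0 x) \<and> (\<Sum>x\<in>X 1. q0 x) = 1 \<and>
     (\<forall>h\<in>{1..<H}. \<forall>x\<in>X h. \<forall>a\<in>A x.
        (\<forall>x'\<in>ch h x a. 0 \<le> q h x a x') \<and> (\<Sum>x'\<in>ch h x a. q h x a x') = 1)"

lemma reachp_Suc: "h \<in> {1..<H} \<Longrightarrow>
    reachp q0 q par (Suc h) x = reachp q0 q par h (fst (par x)) * q h (fst (par x)) (snd (par x)) x"
  by (cases h) auto

lemma plan_Suc: "h \<in> {1..<H} \<Longrightarrow>
    plan par mu (Suc h) x a = plan par mu h (fst (par x)) (snd (par x)) * mu (Suc h) x a"
  by (cases h) auto

lemma level_induct [consumes 1, case_names root step]: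
  assumes "h \<in> {1..H}" "P 1" "\<And>h. h \<in> {1..<H} \<Longrightarrow> P h \<Longrightarrow> P (Suc h)"
  shows "P h"
  using assms(1)
proof (induction h)
  case (Suc h)
  then show ?case using assms(2) assms(3)[of h] by (cases "h = 0") auto
qed simp

lemma par_children: "y \<in> ch h x a \<Longrightarrow> par y = (x, a)" by (simp add: children_def)

lemma reachp_nonneg:
  assumes "valid_trans q0 q" "h \<in> {1..H}" "x \<in> X h"
  shows "0 \<le> reachp q0 q par h x"
  using assms(2,3)
proof (induction h arbitrary: x rule: level_induct)
  case root
  then show ?case using assms(1) by (simp add: valid_trans_def)
next
  case (step h)
  have "x \<in> ch h (fst (par x)) (snd (par x))" using step.prems by (simp add: children_def)
  then have "0 \<le> q h (fst (par x)) (snd (par x)) x"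
    using assms(1) step.hyps par_in[OF step.hyps(1) step.prems] unfolding valid_trans_def by blast
  then show ?case
    using step.IH[OF par_in(1)[OF step.hyps(1) step.prems]] by (simp add: reachp_Suc[OF step.hyps(1)])
qed

lemma policy_nonneg: "mu \<in> Policies \<Longrightarrow> h \<in> {1..H} \<Longrightarrow> x \<in> X h \<Longrightarrow> a \<in> A x \<Longrightarrow> 0 \<le> mu h x a"
  and policy_sum: "mu \<in> Policies \<Longrightarrow> h \<in> {1..H} \<Longrightarrow> x \<in> X h \<Longrightarrow> (\<Sum>a\<in>A x. mu h x a) = 1"
  unfolding Pi_max_def by blast+

lemma plan_nonneg:
  assumes "mu \<in> Policies" "h \<in> {1..H}" "x \<in> X h" "a \<in> A x"
  shows "0 \<le> plan par mu h x a"
  using assms(2-4)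
proof (induction h arbitrary: x a rule: level_induct)
  case root
  then show ?case using policy_nonneg[OF assms(1), of 1 x a] H_ge_1 by simp
next
  case (step h)
  then show ?case
    using policy_nonneg[OF assms(1), of "Suc h" x a] par_in[OF step.hyps(1) step.prems(1)]
    by (simp add: plan_Suc[OF step.hyps(1)])
qed

lemma plan_sum_Suc:
  assumes mu: "mu \<in> Policies" and h: "h \<in> {1..<H}" and x: "x \<in> X (Suc h)"
  shows "(\<Sum>a\<in>A x. plan par mu (Suc h) x a) = plan par mu h (fst (par x)) (snd (par x))"
  using policy_sum[OF mu _ x] h by (simp add: plan_Suc[OF h] sum_distrib_left[symmetric])

text \<open>The summand is the probability of visiting the pair at step \<open>h\<close>. In the
  induction the new actions sum out into the plan of the parent pair, then the new transitions sum
  out to one.\<close>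

lemma reach_plan_sum:
  assumes q: "valid_trans q0 q" and mu: "mu \<in> Policies" and h: "h \<in> {1..H}"
  shows "(\<Sum>x\<in>X h. \<Sum>a\<in>A x. reachp q0 q par h x * plan par mu h x a) = 1"
  using h
proof (induction h rule: level_induct)
  case root
  have "(\<Sum>x\<in>X 1. \<Sum>a\<in>A x. q0 x * mu 1 x a) = (\<Sum>x\<in>X 1. q0 x)"
    using policy_sum[OF mu, of 1] H_ge_1 by (simp add: sum_distrib_left[symmetric])
  then show ?case using q by (simp add: valid_trans_def)
next
  case (step h)
  note h = step.hyps(1)
  let ?r = "reachp q0 q par" and ?m = "plan par mu"
  have "(\<Sum>x\<in>X (Suc h). \<Sum>a\<in>A x. ?r (Suc h) x * ?m (Suc h) x a)
      = (\<Sum>x\<in>X (Suc h). ?r (Suc h) x * ?m h (fst (par x)) (snd (par x)))"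
    by (simp add: sum_distrib_left[symmetric] plan_sum_Suc[OF mu h])
  also have "\<dots> = (\<Sum>x\<in>X h. \<Sum>a\<in>A x. \<Sum>y\<in>ch h x a. ?r h x * q h x a y * ?m h x a)"
    unfolding sum_children[OF h]
    by (intro sum.cong refl) (simp add: reachp_Suc[OF h] par_children)
  also have "\<dots> = (\<Sum>x\<in>X h. \<Sum>a\<in>A x. ?r h x * ?m h x a * (\<Sum>y\<in>ch h x a. q h x a y))"
    by (simp add: sum_distrib_left ac_simps)
  also have "\<dots> = (\<Sum>x\<in>X h. \<Sum>a\<in>A x. ?r h x * ?m h x a)"
    using q h unfolding valid_trans_def by (intro sum.cong refl) simp
  finally show ?case using step.IH by simp
qed

lemma plan_le_1:
  assumes "mu \<in> Policies" "h \<in> {1..H}" "x \<in> X h" "a \<in> A x"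
  shows "plan par mu h x a \<le> 1"
  using assms(2-4)
proof (induction h arbitrary: x a rule: level_induct)
  case root
  have "mu 1 x a \<le> (\<Sum>a\<in>A x. mu 1 x a)"
    using root policy_nonneg[OF assms(1), of 1 x] finite_A[of 1 x] H_ge_1 by (intro member_le_sum) auto
  then show ?case using policy_sum[OF assms(1), of 1 x] root H_ge_1 by simp
next
  case (step h)
  have "plan par mu (Suc h) x a \<le> (\<Sum>a\<in>A x. plan par mu (Suc h) x a)"
    using step plan_nonneg[OF assms(1), of "Suc h" x] finite_A[of "Suc h" x] by (intro member_le_sum) auto
  also have "\<dots> \<le> 1"
    unfolding plan_sum_Suc[OF assms(1) step.hyps(1) step.prems(1)]
    using par_in[OF step.hyps(1) step.prems(1)] by (intro step.IH)
  finally show ?case .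
qed

lemma reachp_le_1:
  assumes "valid_trans q0 q" "h \<in> {1..H}" "x \<in> X h"
  shows "reachp q0 q par h x \<le> 1"
  using assms(2,3)
proof (induction h arbitrary: x rule: level_induct)
  case root
  have "q0 x \<le> (\<Sum>x\<in>X 1. q0 x)"
    using root assms(1) finite_X[of 1] H_ge_1 unfolding valid_trans_def by (intro member_le_sum) auto
  then show ?case using assms(1) by (simp add: valid_trans_def)
next
  case (step h)
  let ?y = "fst (par x)" and ?a = "snd (par x)"
  have x: "x \<in> ch h ?y ?a" using step.prems by (simp add: children_def)
  have *: "(\<forall>x'\<in>ch h ?y ?a. 0 \<le> q h ?y ?a x') \<and> (\<Sum>x'\<in>ch h ?y ?a. q h ?y ?a x') = 1"
    using assms(1) step.hyps par_in[OF step.hyps(1) step.prems] unfolding valid_trans_def by blast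
  then have "q h ?y ?a x \<le> (\<Sum>x'\<in>ch h ?y ?a. q h ?y ?a x')"
    using x finite_children[OF step.hyps(1)] by (intro member_le_sum) auto
  then have "reachp q0 q par h ?y * q h ?y ?a x \<le> 1"
    using * x step.IH[OF par_in(1)[OF step.hyps(1) step.prems]] by (intro mult_le_one) auto
  then show ?case by (simp add: reachp_Suc[OF step.hyps(1)])
qed

section \<open>The balanced law and the balance identity\<close>

lemma sum_tau_children_pos:
  assumes "h \<in> {1..<H}" "x \<in> X h" "a \<in> A x"
  shows "0 < (\<Sum>y\<in>ch h x a. tau y)"
  using finite_children[OF assms(1)] children_nonempty[OF assms] tau_pos[of "Suc h"] assms(1)
  by (intro sum_pos) (auto simp: children_def)

lemma valid_pstar: "valid_trans (pstar0 H X A par) (pstar_tr H X A par)"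
  unfolding valid_trans_def
proof (intro conjI ballI)
  show "0 \<le> pstar0 H X A par x" if "x \<in> X 1" for x
    using tau_pos[of 1 x] that H_ge_1 K_ge_1 by (simp add: pstar0_def)
  show "(\<Sum>x\<in>X 1. pstar0 H X A par x) = 1"
    using sum_tau_roots K_ge_1 by (simp add: pstar0_def sum_divide_distrib[symmetric])
  fix h x a assume hxa: "h \<in> {1..<H}" "x \<in> X h" "a \<in> A x"
  show "0 \<le> pstar_tr H X A par h x a y" if "y \<in> ch h x a" for y
    using sum_tau_children_pos[OF hxa] tau_pos[of "Suc h" y] that hxa(1)
    by (simp add: pstar_tr_def children_def)
  show "(\<Sum>y\<in>ch h x a. pstar_tr H X A par h x a y) = 1"
    using sum_tau_children_pos[OF hxa] by (simp add: pstar_tr_def sum_divide_distrib[symmetric])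
qed

lemma pstar_Suc: "h \<in> {1..<H} \<Longrightarrow> y \<in> ch h x a \<Longrightarrow>
    ps (Suc h) y = ps h x * (tau y / (\<Sum>y\<in>ch h x a. tau y))"
  by (simp add: pstar_def reachp_Suc par_children pstar_tr_def)

lemma pstar_pos: "h \<in> {1..H} \<Longrightarrow> x \<in> X h \<Longrightarrow> 0 < ps h x"
proof (induction h arbitrary: x rule: level_induct)
  case root
  then show ?case using tau_pos[of 1 x] H_ge_1 K_ge_1 by (simp add: pstar_def pstar0_def)
next
  case (step h)
  have x: "x \<in> ch h (fst (par x)) (snd (par x))" using step.prems by (simp add: children_def)
  show ?case
    unfolding pstar_Suc[OF step.hyps(1) x]
    using par_in[OF step.hyps(1) step.prems] step sum_tau_children_pos[OF step.hyps(1)] tau_pos[of "Suc h" x]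
    by (auto intro!: mult_pos_pos divide_pos_pos)
qed

text \<open>The transitions \<open>p\<^sup>\<star>\<close> are chosen so that \<open>\<Sum>\<^sub>x p(x) A\<^sup>\<tau>(x) / p\<^sup>\<star>(x)\<close>
  drops from one level to the next by exactly \<open>\<Sum>\<^sub>x p(x) A(x) / p\<^sup>\<star>(x)\<close>, for every opponent.\<close>

lemma balance:
  assumes q: "valid_trans q0 q"
  shows "(\<Sum>h\<in>{1..H}. \<Sum>x\<in>X h. real (card (A x)) * reachp q0 q par h x / ps h x) = K"
proof -
  let ?r = "reachp q0 q par"
  define S where "S h = (\<Sum>x\<in>X h. ?r h x / ps h x * tau x)" for h
  define D where "D h = (\<Sum>x\<in>X h. real (card (A x)) * ?r h x / ps h x)" for h
  \<comment> \<open>At the roots p* is \<open>tau x / K\<close>, so every ratio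
    \<open>tau x / ps 1 x\<close> equals \<open>K\<close>, and \<open>q0\<close> sums to
    one.\<close>
  have S1: "S 1 = K"
  proof -
    have "S 1 = (\<Sum>x\<in>X 1. q0 x * K)"
      unfolding S_def using tau_pos[of 1] H_ge_1
      by (intro sum.cong refl) (force simp: pstar_def pstar0_def)
    then show ?thesis using q by (simp add: valid_trans_def sum_distrib_right[symmetric])
  qed
  have step: "S h = D h + S (Suc h)" if h: "h \<in> {1..<H}" for h
  proof -
    \<comment> \<open>\<open>tau y\<close> cancels against its occurrence in
      \<open>ps (Suc h) y\<close>. The only dependence on \<open>y\<close> left is the transition
      probability \<open>q h x a y\<close>, which sums to one over the children.\<close>
    have "S (Suc h) = (\<Sum>x\<in>X h. \<Sum>a\<in>A x. \<Sum>y\<in>ch h x a. q h x a y * (?r h x / ps h x * (\<Sum>y\<in>ch h x a. tau y)))"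
      unfolding S_def sum_children[OF h]
    proof (intro sum.cong refl)
      fix x a y assume x: "x \<in> X h" "a \<in> A x" and y: "y \<in> ch h x a"
      have "0 < tau y" using y h tau_pos[of "Suc h" y] by (simp add: children_def)
      then show "?r (Suc h) y / ps (Suc h) y * tau y = q h x a y * (?r h x / ps h x * (\<Sum>y\<in>ch h x a. tau y))"
        by (simp add: pstar_Suc[OF h y] reachp_Suc[OF h] par_children[OF y])
    qed
    also have "\<dots> = (\<Sum>x\<in>X h. \<Sum>a\<in>A x. ?r h x / ps h x * (\<Sum>y\<in>ch h x a. tau y))"
      using q h unfolding valid_trans_def sum_distrib_right[symmetric] by (intro sum.cong refl) simp
    also have "D h + \<dots> = S h"
      unfolding D_def S_def sum.distrib[symmetric]
      by (intro sum.cong refl) (simp add: tau_rec[OF h] algebra_simps sum_distrib_left add_divide_distrib sum_divide_distrib)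
    finally show ?thesis by simp
  qed
  have last: "S H = D H"
    unfolding S_def D_def
  proof (intro sum.cong refl)
    fix x assume x: "x \<in> X H"
    have "tau x = real (card (A x))"
      using tau_eq[of H x] x H_ge_1 finite_X[of H] by (simp add: anc_def sum.delta')
    then show "?r H x / ps H x * tau x = real (card (A x)) * ?r H x / ps H x" by simp
  qed
  \<comment> \<open>There is no level after \<open>H\<close>, so the telescoped sum keeps
    \<open>S h\<close> and \<open>D h\<close>. It closes by \<open>S H = D H\<close>: a subtree on
    the last level is a single information set.\<close>
  have "(\<Sum>k\<in>{1..h}. D k) = K - S h + D h" if "h \<in> {1..H}" for h
    using that
  proof (induction h rule: level_induct)
    case root
    then show ?case by (simp add: S1[unfolded One_nat_def])
  next
    case (step h)
    then show ?case using \<open>\<And>h. h \<in> {1..<H} \<Longrightarrow> S h = D h + S (Suc h)\<close>[of h] by simp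
  qed
  from this[of H] last H_ge_1 show ?thesis by (simp add: D_def)
qed

text \<open>Mixing policies step by step does not mix their plans, so the plans are mixed and a
  policy is recovered by normalizing. The plans at \<open>x\<close> sum over the actions to the plan
  of the parent pair; hence the normalizer is the mixed plan of that pair, and the product along the
  history gives back \<open>c\<close>.\<close>

lemma plan_convex:
  assumes mu: "mu \<in> Policies" and mu': "mu' \<in> Policies" and \<epsilon>: "0 < \<epsilon>" "\<epsilon> < 1"
  shows "\<exists>mu''\<in>Policies. \<forall>h\<in>{1..H}. \<forall>x\<in>X h. \<forall>a\<in>A x.
    plan par mu'' h x a = (1 - \<epsilon>) * plan par mu h x a + \<epsilon> * plan par mu' h x a"
proof -
  define c where "c h x a = (1 - \<epsilon>) * plan par mu h x a + \<epsilon> * plan par mu' h x a" for h x a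
  define s where "s h x = (\<Sum>a\<in>A x. c h x a)" for h x
  \<comment> \<open>Where the mixed plan gives \<open>x\<close> no mass, any distribution will do;
    \<open>mu\<close> supplies one.\<close>
  define mu'' where "mu'' h x a = (if s h x = 0 then mu h x a else c h x a / s h x)" for h x a
  have c0: "0 \<le> c h x a" if "h \<in> {1..H}" "x \<in> X h" "a \<in> A x" for h x a
    unfolding c_def using plan_nonneg[OF mu that] plan_nonneg[OF mu' that] \<epsilon> by simp
  have s0: "0 \<le> s h x" if "h \<in> {1..H}" "x \<in> X h" for h x
    unfolding s_def using c0[OF that] by (rule sum_nonneg)
  have cz: "c h x a = s h x * mu'' h x a" if "h \<in> {1..H}" "x \<in> X h" "a \<in> A x" for h x a
  proof (cases "s h x = 0")
    case True
    then have "c h x a = 0"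
      using sum_nonneg_eq_0_iff[of "A x" "c h x"] finite_A[OF that(1,2)] c0[OF that(1,2)] that(3)
      by (simp add: s_def)
    then show ?thesis using True by simp
  qed (simp add: mu''_def)
  have "mu'' \<in> Policies"
    unfolding Pi_max_def
  proof (intro CollectI ballI conjI)
    fix h x assume hx: "h \<in> {1..H}" "x \<in> X h"
    show "0 \<le> mu'' h x a" if "a \<in> A x" for a
      using policy_nonneg[OF mu hx that] c0[OF hx that] s0[OF hx] by (simp add: mu''_def)
    show "(\<Sum>a\<in>A x. mu'' h x a) = 1"
      using policy_sum[OF mu hx] by (cases "s h x = 0") (simp_all add: mu''_def sum_divide_distrib[symmetric] s_def[symmetric])
  qed
  moreover have "plan par mu'' h x a = c h x a" if "h \<in> {1..H}" "x \<in> X h" "a \<in> A x" for h x a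
    using that
  proof (induction h arbitrary: x a rule: level_induct)
    case root
    then have "s 1 x = 1"
      using policy_sum[OF mu, of 1 x] policy_sum[OF mu', of 1 x] H_ge_1
      by (simp add: s_def c_def sum.distrib sum_distrib_left[symmetric])
    then show ?case using cz[of 1 x a] root H_ge_1 by simp
  next
    case (step h)
    have "s (Suc h) x = c h (fst (par x)) (snd (par x))"
      unfolding s_def c_def sum.distrib sum_distrib_left[symmetric]
        plan_sum_Suc[OF mu step.hyps(1) step.prems(1)] plan_sum_Suc[OF mu' step.hyps(1) step.prems(1)] ..
    then show ?case
      using cz[of "Suc h" x a] step par_in[OF step.hyps(1) step.prems(1)] by (simp add: plan_Suc)
  qed
  ultimately show ?thesis unfolding c_def by blast
qed

end

section \<open>FTRL with implicit exploration along one trajectory\<close>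

lemma powr_young:
  fixes w b \<beta> :: real
  assumes "0 \<le> w" "0 < b" "0 < \<beta>" "\<beta> < 1"
  shows "w powr \<beta> * b powr (1 - \<beta>) \<le> \<beta> * w + (1 - \<beta>) * b"
proof (cases "w = 0")
  case False
  then show ?thesis using Youngs_inequality_0[of \<beta> "1 - \<beta>" w b] assms by simp
qed (use assms in simp)

text \<open>This is \<open>ln z \<le> z - 1\<close> at \<open>z = 1 / (y x)\<close>. With
  \<open>y = n\<close> the number of coordinates, summation bounds the entropy of a vector of
  arbitrary total mass \<open>B\<close> by \<open>B ln n + 1 - B\<close>.\<close>

lemma neg_xlnx_le:
  fixes x y :: real
  assumes "0 \<le> x" "0 < y"
  shows "- (x * ln x) \<le> x * ln y + 1 / y - x"
proof (cases "x = 0")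
  case False
  then have x: "0 < x" using assms by simp
  have "ln (1 / (y * x)) \<le> 1 / (y * x) - 1"
    using x assms by (intro ln_le_minus_one) simp
  then have "x * ln (1 / (y * x)) \<le> x * (1 / (y * x) - 1)"
    using x by (intro mult_left_mono) auto
  also have "x * (1 / (y * x) - 1) = 1 / y - x"
    using x assms by (simp add: field_simps)
  also have "ln (1 / (y * x)) = - ln y - ln x"
    using x assms by (simp add: ln_div ln_mult_pos)
  finally show ?thesis by (simp add: algebra_simps)
qed (use assms in simp)

text \<open>What remains once an outcome of the good event is fixed: no probability occurs, and
  concentration survives only in \<open>over\<close>. In the application \<open>p\<close> is p*,
  \<open>Q\<close> consists of the realization plans, \<open>B\<close> is the horizon,
  \<open>C\<close> the observed and \<open>l\<close> the true losses; \<open>l_sum\<close> then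
  follows from the balance identity.\<close>

locale ix_path =
  fixes I :: "'i set" and p :: "'i \<Rightarrow> real" and Q :: "('i \<Rightarrow> real) set" and \<gamma> \<iota> B :: real and T :: nat
    and m C l :: "nat \<Rightarrow> 'i \<Rightarrow> real"
  assumes fin: "finite I" and nonempty: "I \<noteq> {}" and p_pos: "\<And>i. i \<in> I \<Longrightarrow> 0 < p i"
    and T: "1 \<le> T" and \<gamma>: "0 < \<gamma>" and B: "0 < B"
    and Q_nonneg: "\<And>w i. w \<in> Q \<Longrightarrow> i \<in> I \<Longrightarrow> 0 \<le> w i"
    and Q_conv: "\<And>w w' \<epsilon>. w \<in> Q \<Longrightarrow> w' \<in> Q \<Longrightarrow> 0 < \<epsilon> \<Longrightarrow> \<epsilon> < 1 \<Longrightarrow>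
      \<exists>w''\<in>Q. \<forall>i\<in>I. w'' i = (1 - \<epsilon>) * w i + \<epsilon> * w' i"
    and Q_sum: "\<And>w. w \<in> Q \<Longrightarrow> (\<Sum>i\<in>I. p i * w i) = B"
    and m_Q: "\<And>t. t \<in> {1..T} \<Longrightarrow> m t \<in> Q"
    and C_range: "\<And>t i. t \<in> {1..T} \<Longrightarrow> i \<in> I \<Longrightarrow> 0 \<le> C t i \<and> C t i \<le> 1"
    and C_sum: "\<And>t. t \<in> {1..T} \<Longrightarrow> (\<Sum>i\<in>I. C t i) \<le> B"
    and l_nonneg: "\<And>t i. t \<in> {1..T} \<Longrightarrow> i \<in> I \<Longrightarrow> 0 \<le> l t i"
    and l_sum: "\<And>t. t \<in> {1..T} \<Longrightarrow> (\<Sum>i\<in>I. l t i / p i) \<le> card I"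
    and over: "\<And>i. i \<in> I \<Longrightarrow>
      (\<Sum>t\<in>{1..T}. C t i / (m t i + \<gamma> / p i) - l t i) \<le> \<iota> / (2 * (\<gamma> / p i))"
begin

definition est :: "nat \<Rightarrow> 'i \<Rightarrow> real" where "est t i = C t i / (m t i + \<gamma> / p i)"

lemma m_nonneg: "t \<in> {1..T} \<Longrightarrow> i \<in> I \<Longrightarrow> 0 \<le> m t i" using Q_nonneg m_Q by blast

lemma est_nonneg: "t \<in> {1..T} \<Longrightarrow> i \<in> I \<Longrightarrow> 0 \<le> est t i"
  unfolding est_def using C_range[of t i] m_nonneg[of t i] p_pos[of i] \<gamma> by simp

lemma m_est_le: "t \<in> {1..T} \<Longrightarrow> i \<in> I \<Longrightarrow> m t i * est t i \<le> C t i"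
proof -
  assume *: "t \<in> {1..T}" "i \<in> I"
  have "0 < \<gamma> / p i" using p_pos[OF *(2)] \<gamma> by simp
  then have "m t i / (m t i + \<gamma> / p i) \<le> 1" using m_nonneg[OF *] by simp
  then have "m t i / (m t i + \<gamma> / p i) * C t i \<le> 1 * C t i"
    using C_range[OF *] by (intro mult_right_mono) auto
  then show ?thesis by (simp add: est_def)
qed

lemma sum_m_est_le: "(\<Sum>t\<in>{1..T}. \<Sum>i\<in>I. m t i * est t i) \<le> B * T"
proof -
  have "(\<Sum>t\<in>{1..T}. \<Sum>i\<in>I. m t i * est t i) \<le> (\<Sum>t\<in>{1..T}. B)"
    by (intro sum_mono order_trans[OF _ C_sum]) (auto intro!: sum_mono m_est_le)
  then show ?thesis by (simp add: mult.commute)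
qed

text \<open>The allowed overestimate of coordinate \<open>i\<close> is proportional to
  \<open>p i\<close>. Division by \<open>p i\<close> makes it the same for all coordinates, which is
  the effect of scaling the IX parameter by p*.\<close>

lemma sum_est_le: "(\<Sum>t\<in>{1..T}. \<Sum>i\<in>I. est t i / p i) \<le> card I * (T + \<iota> / (2 * \<gamma>))"
proof -
  have "(\<Sum>t\<in>{1..T}. \<Sum>i\<in>I. est t i / p i) - (\<Sum>t\<in>{1..T}. \<Sum>i\<in>I. l t i / p i)
      = (\<Sum>i\<in>I. (\<Sum>t\<in>{1..T}. est t i - l t i) / p i)"
    by (subst (1 2) sum.swap) (simp add: sum_subtractf[symmetric] diff_divide_distrib[symmetric] sum_divide_distrib[symmetric])
  also have "\<dots> \<le> (\<Sum>i\<in>I. \<iota> / (2 * \<gamma>))"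
  proof (rule sum_mono)
    fix i assume i: "i \<in> I"
    have "(\<Sum>t\<in>{1..T}. est t i - l t i) / p i \<le> \<iota> / (2 * (\<gamma> / p i)) / p i"
      using over[OF i] p_pos[OF i] unfolding est_def by (intro divide_right_mono) auto
    also have "\<dots> = \<iota> / (2 * \<gamma>)" using p_pos[OF i] by simp
    finally show "(\<Sum>t\<in>{1..T}. est t i - l t i) / p i \<le> \<iota> / (2 * \<gamma>)" .
  qed
  also have "(\<Sum>t\<in>{1..T}. \<Sum>i\<in>I. l t i / p i) \<le> (\<Sum>t\<in>{1..T}. card I)"
    using sum_mono[of "{1..T}" "\<lambda>t. \<Sum>i\<in>I. l t i / p i" "\<lambda>t. real (card I)"] l_sum by simp
  ultimately show ?thesis by (simp add: algebra_simps)
qed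

text \<open>In the coordinates \<open>p i * w i\<close> the regularizer is separable with a single
  \<open>\<psi>\<close>, and dividing the losses by \<open>p i\<close> leaves every pairing
  unchanged; \<open>ftrl_regret\<close> is applied to the rescaled set.\<close>

lemma reg_le:
  assumes \<psi>: "half_strongly_convex \<psi> \<kappa>"
    and \<kappa>: "\<And>s. 0 < s \<Longrightarrow> 0 < \<kappa> s" "\<kappa> 0 = 0"
    and \<eta>: "0 < \<eta>" and u: "u \<in> Q"
    and opt: "\<And>t w. t \<in> {1..T} \<Longrightarrow> w \<in> Q \<Longrightarrow>
      (\<Sum>i\<in>I. m t i * (\<Sum>k\<in>{1..t-1}. est k i)) + (\<Sum>i\<in>I. \<psi> (p i * m t i)) / \<eta>
      \<le> (\<Sum>i\<in>I. w i * (\<Sum>k\<in>{1..t-1}. est k i)) + (\<Sum>i\<in>I. \<psi> (p i * w i)) / \<eta>"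
  shows "(\<Sum>t\<in>{1..T}. \<Sum>i\<in>I. (m t i - u i) * est t i) \<le>
    ((\<Sum>i\<in>I. \<psi> (p i * u i)) - (\<Sum>i\<in>I. \<psi> (p i * m 1 i))) / \<eta>
    + \<eta> / 2 * (\<Sum>t\<in>{1..T}. \<Sum>i\<in>I. \<kappa> (p i * m t i) * (est t i / p i)\<^sup>2)"
proof -
  define S where "S = (\<lambda>w i. p i * w i)"
  have eq: "(\<Sum>i\<in>I. S w i * (\<Sum>k\<in>{1..t}. est k i / p i)) = (\<Sum>i\<in>I. w i * (\<Sum>k\<in>{1..t}. est k i))" for w t
    by (intro sum.cong refl) (use p_pos in \<open>force simp: S_def sum_divide_distrib[symmetric]\<close>)
  have "(\<Sum>t\<in>{1..T}. \<Sum>i\<in>I. (S (m t) i - S u i) * (est t i / p i)) \<le>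
    ((\<Sum>i\<in>I. \<psi> (S u i)) - (\<Sum>i\<in>I. \<psi> (S (m 1) i))) / \<eta>
    + \<eta> / 2 * (\<Sum>t\<in>{1..T}. \<Sum>i\<in>I. \<kappa> (S (m t) i) * (est t i / p i)\<^sup>2)"
  proof (rule ftrl_regret[where Q = "S ` Q", OF fin \<eta> T])
    show "0 \<le> w i" if "w \<in> S ` Q" "i \<in> I" for w i
      using that Q_nonneg p_pos by (fastforce simp: S_def less_imp_le)
    show "\<exists>w''\<in>S ` Q. \<forall>i\<in>I. w'' i = (1 - \<epsilon>) * w i + \<epsilon> * w' i"
      if w: "w \<in> S ` Q" "w' \<in> S ` Q" and e: "0 < \<epsilon>" "\<epsilon> < 1" for w w' \<epsilon>
    proof -
      from w obtain z z' where z: "z \<in> Q" "z' \<in> Q" "w = S z" "w' = S z'" by blast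
      from Q_conv[OF z(1,2) e] obtain z'' where "z'' \<in> Q" "\<forall>i\<in>I. z'' i = (1 - \<epsilon>) * z i + \<epsilon> * z' i" by blast
      then show ?thesis by (intro bexI[of _ "S z''"]) (auto simp: S_def z distrib_left)
    qed
    show "0 \<le> est t i / p i" if "t \<in> {1..T}" "i \<in> I" for t i
      using est_nonneg[OF that] p_pos[OF that(2)] by simp
    show "(\<Sum>i\<in>I. S (m t) i * (\<Sum>k\<in>{1..t-1}. est k i / p i)) + (\<Sum>i\<in>I. \<psi> (S (m t) i)) / \<eta>
      \<le> (\<Sum>i\<in>I. w i * (\<Sum>k\<in>{1..t-1}. est k i / p i)) + (\<Sum>i\<in>I. \<psi> (w i)) / \<eta>"
      if "t \<in> {1..T}" "w \<in> S ` Q" for t w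
    proof -
      from that obtain z where z: "z \<in> Q" "w = S z" by blast
      show ?thesis unfolding z(2) eq using opt[OF that(1) z(1)] by (simp add: S_def)
    qed
  qed (use \<psi> \<kappa> u m_Q in auto)
  moreover have "(S (m t) i - S u i) * (est t i / p i) = (m t i - u i) * est t i" if "i \<in> I" for t i
    using p_pos[OF that] by (simp add: S_def field_simps)
  ultimately show ?thesis by (simp add: S_def)
qed

text \<open>Lets one of the two factors of a squared estimate be dropped in the stability
  terms.\<close>

lemma scaled_le: "t \<in> {1..T} \<Longrightarrow> i \<in> I \<Longrightarrow> p i * m t i * (est t i / p i) \<le> 1"
  using m_est_le[of t i] C_range[of t i] p_pos[of i] by auto

text \<open>\<open>b\<close> is the coordinate of the vector that spreads the mass \<open>B\<close>
  evenly, and Young's inequality is used twice against it. The first use bounds the sum of powers by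
  its value at the even spread. The second splits the stability term into \<open>m * est\<close>
  with weight \<open>1 - \<alpha>\<close> and \<open>est / p\<close> with weight
  \<open>\<alpha>\<close>, so that the overestimate is also damped by
  \<open>\<alpha>\<close>.\<close>

lemma reg_tsallis:
  assumes \<alpha>: "0 < \<alpha>" "\<alpha> < 1" and \<eta>: "0 < \<eta>" and u: "u \<in> Q"
    and opt: "\<And>t w. t \<in> {1..T} \<Longrightarrow> w \<in> Q \<Longrightarrow>
      (\<Sum>i\<in>I. m t i * (\<Sum>k\<in>{1..t-1}. est k i)) + (\<Sum>i\<in>I. - ((p i * m t i) powr \<alpha>)) / \<eta>
      \<le> (\<Sum>i\<in>I. w i * (\<Sum>k\<in>{1..t-1}. est k i)) + (\<Sum>i\<in>I. - ((p i * w i) powr \<alpha>)) / \<eta>"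
  defines "b \<equiv> B / card I"
  shows "(\<Sum>t\<in>{1..T}. \<Sum>i\<in>I. (m t i - u i) * est t i) \<le>
    card I * b powr \<alpha> / \<eta> + \<eta> / (2 * (\<alpha> * (1 - \<alpha>))) * (b powr (- \<alpha>) * B * (T + \<alpha> * (\<iota> / (2 * \<gamma>))))"
proof -
  let ?\<kappa> = "\<lambda>v. v powr (2 - \<alpha>) / (\<alpha> * (1 - \<alpha>))"
  have n: "0 < real (card I)" using fin nonempty by (simp add: card_gt_0_iff)
  then have b: "0 < b" using B by (simp add: b_def)
  have nb: "card I * b = B" using n by (simp add: b_def)
  have v0: "0 \<le> p i * m t i" if "t \<in> {1..T}" "i \<in> I" for t i
    using m_nonneg[OF that] p_pos[OF that(2)] by simp
  have "(\<Sum>t\<in>{1..T}. \<Sum>i\<in>I. (m t i - u i) * est t i) \<le>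
    ((\<Sum>i\<in>I. - ((p i * u i) powr \<alpha>)) - (\<Sum>i\<in>I. - ((p i * m 1 i) powr \<alpha>))) / \<eta>
    + \<eta> / 2 * (\<Sum>t\<in>{1..T}. \<Sum>i\<in>I. ?\<kappa> (p i * m t i) * (est t i / p i)\<^sup>2)"
    by (rule reg_le[OF half_strongly_convex_tsallis[OF \<alpha>] _ _ \<eta> u opt]) (use \<alpha> in auto)
  also have "((\<Sum>i\<in>I. - ((p i * u i) powr \<alpha>)) - (\<Sum>i\<in>I. - ((p i * m 1 i) powr \<alpha>))) / \<eta> \<le> card I * b powr \<alpha> / \<eta>"
  proof (rule divide_right_mono)
    have "(\<Sum>i\<in>I. (p i * m 1 i) powr \<alpha>) \<le> (\<Sum>i\<in>I. (\<alpha> * (p i * m 1 i) + (1 - \<alpha>) * b) * b powr (\<alpha> - 1))"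
    proof (rule sum_mono)
      fix i assume i: "i \<in> I"
      have "(p i * m 1 i) powr \<alpha> = (p i * m 1 i) powr \<alpha> * b powr (1 - \<alpha>) * b powr (\<alpha> - 1)"
        using b by (simp add: mult.assoc powr_add[symmetric])
      also have "\<dots> \<le> (\<alpha> * (p i * m 1 i) + (1 - \<alpha>) * b) * b powr (\<alpha> - 1)"
        using v0[of 1 i] T i b \<alpha> by (intro mult_right_mono powr_young) auto
      finally show "(p i * m 1 i) powr \<alpha> \<le> (\<alpha> * (p i * m 1 i) + (1 - \<alpha>) * b) * b powr (\<alpha> - 1)" .
    qed
    also have "\<dots> = (\<alpha> * B + (1 - \<alpha>) * (card I * b)) * b powr (\<alpha> - 1)"
      using Q_sum[OF m_Q, of 1] T
      by (simp add: sum_distrib_right[symmetric] sum.distrib sum_distrib_left[symmetric])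
    also have "\<dots> = card I * (b powr 1 * b powr (\<alpha> - 1))"
      unfolding nb[symmetric] using b by (simp add: algebra_simps)
    also have "\<dots> = card I * b powr \<alpha>" unfolding powr_add[symmetric] by simp
    finally have "(\<Sum>i\<in>I. (p i * m 1 i) powr \<alpha>) \<le> card I * b powr \<alpha>" .
    moreover have "0 \<le> (\<Sum>i\<in>I. (p i * u i) powr \<alpha>)" by (simp add: sum_nonneg)
    ultimately show "(\<Sum>i\<in>I. - ((p i * u i) powr \<alpha>)) - (\<Sum>i\<in>I. - ((p i * m 1 i) powr \<alpha>)) \<le> card I * b powr \<alpha>"
      by (simp add: sum_negf)
  qed (use \<eta> in simp)
  also have "\<eta> / 2 * (\<Sum>t\<in>{1..T}. \<Sum>i\<in>I. ?\<kappa> (p i * m t i) * (est t i / p i)\<^sup>2)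
    \<le> \<eta> / 2 * (1 / (\<alpha> * (1 - \<alpha>)) * (b powr (- \<alpha>) * B * (T + \<alpha> * (\<iota> / (2 * \<gamma>)))))"
  proof (rule mult_left_mono)
    have "(\<Sum>t\<in>{1..T}. \<Sum>i\<in>I. ?\<kappa> (p i * m t i) * (est t i / p i)\<^sup>2)
      \<le> (\<Sum>t\<in>{1..T}. \<Sum>i\<in>I. 1 / (\<alpha> * (1 - \<alpha>)) * (b powr (- \<alpha>) * ((1 - \<alpha>) * (m t i * est t i) + \<alpha> * b * (est t i / p i))))"
    proof (intro sum_mono)
      fix t i assume t: "t \<in> {1..T}" and i: "i \<in> I"
      let ?v = "p i * m t i" and ?e = "est t i / p i"
      have e0: "0 \<le> ?e" using est_nonneg[OF t i] p_pos[OF i] by simp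
      have "?v powr (2 - \<alpha>) = ?v powr (1 - \<alpha>) * ?v"
      proof (cases "?v = 0")
        case False
        then have "0 < ?v" using v0[OF t i] by linarith
        then have "?v powr (1 - \<alpha>) * ?v = ?v powr (1 - \<alpha>) * ?v powr 1" by simp
        also have "\<dots> = ?v powr (2 - \<alpha>)" unfolding powr_add[symmetric] by simp
        finally show ?thesis by simp
      qed auto
      \<comment> \<open>One factor \<open>?v * ?e\<close> is split off to be bounded by 1; the rest
        is linear in the estimate.\<close>
      then have "?v powr (2 - \<alpha>) * ?e\<^sup>2 = ?v powr (1 - \<alpha>) * ?e * (?v * ?e)"
        by (simp add: power2_eq_square)
      also have "\<dots> \<le> ?v powr (1 - \<alpha>) * ?e * 1"
        using scaled_le[OF t i] e0 by (intro mult_left_mono mult_nonneg_nonneg) auto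
      also have "\<dots> = b powr (- \<alpha>) * (?v powr (1 - \<alpha>) * b powr \<alpha>) * ?e"
        using b by (simp add: powr_minus)
      also have "\<dots> \<le> b powr (- \<alpha>) * ((1 - \<alpha>) * ?v + \<alpha> * b) * ?e"
        using powr_young[of ?v b "1 - \<alpha>"] v0[OF t i] b \<alpha> e0
        by (intro mult_right_mono mult_left_mono) auto
      also have "\<dots> = b powr (- \<alpha>) * ((1 - \<alpha>) * (m t i * est t i) + \<alpha> * b * ?e)"
        using p_pos[OF i] by (simp add: algebra_simps)
      finally have *: "?v powr (2 - \<alpha>) * ?e\<^sup>2 \<le> \<dots>" .
      have "?\<kappa> ?v * ?e\<^sup>2 = 1 / (\<alpha> * (1 - \<alpha>)) * (?v powr (2 - \<alpha>) * ?e\<^sup>2)" by simp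
      also have "\<dots> \<le> 1 / (\<alpha> * (1 - \<alpha>)) * (b powr (- \<alpha>) * ((1 - \<alpha>) * (m t i * est t i) + \<alpha> * b * ?e))"
        using * \<alpha> by (intro mult_left_mono) auto
      finally show "?\<kappa> ?v * ?e\<^sup>2 \<le> 1 / (\<alpha> * (1 - \<alpha>)) * (b powr (- \<alpha>) * ((1 - \<alpha>) * (m t i * est t i) + \<alpha> * b * ?e))" .
    qed
    also have "\<dots> = 1 / (\<alpha> * (1 - \<alpha>)) * (b powr (- \<alpha>) * ((1 - \<alpha>) * (\<Sum>t\<in>{1..T}. \<Sum>i\<in>I. m t i * est t i)
        + \<alpha> * b * (\<Sum>t\<in>{1..T}. \<Sum>i\<in>I. est t i / p i)))"
      by (simp only: sum_distrib_left[symmetric] sum.distrib)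
    also have "\<dots> \<le> 1 / (\<alpha> * (1 - \<alpha>)) * (b powr (- \<alpha>) * ((1 - \<alpha>) * (B * T)
        + \<alpha> * b * (card I * (T + \<iota> / (2 * \<gamma>)))))"
      using sum_m_est_le sum_est_le \<alpha> b by (intro mult_left_mono add_mono) auto
    also have "(1 - \<alpha>) * (B * T) + \<alpha> * b * (card I * (T + \<iota> / (2 * \<gamma>))) = B * (T + \<alpha> * (\<iota> / (2 * \<gamma>)))"
      unfolding nb[symmetric] by (simp add: algebra_simps)
    finally show "(\<Sum>t\<in>{1..T}. \<Sum>i\<in>I. ?\<kappa> (p i * m t i) * (est t i / p i)\<^sup>2)
      \<le> 1 / (\<alpha> * (1 - \<alpha>)) * (b powr (- \<alpha>) * B * (T + \<alpha> * (\<iota> / (2 * \<gamma>))))" by (simp only: mult.assoc)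
  qed (use \<eta> in simp)
  finally show ?thesis by simp
qed

text \<open>The comparator's entropy term is nonpositive because its scaled coordinates are at most
  1, and \<open>1 \<le> B\<close> removes the constant left over by \<open>neg_xlnx_le\<close>. The
  modulus is \<open>v\<close> itself, so \<open>scaled_le\<close> reduces the stability term to the
  sum of \<open>est / p\<close> without Young's inequality.\<close>

lemma reg_shannon:
  assumes \<eta>: "0 < \<eta>" and u: "u \<in> Q" and u1: "\<And>i. i \<in> I \<Longrightarrow> p i * u i \<le> 1" and B1: "1 \<le> B"
    and opt: "\<And>t w. t \<in> {1..T} \<Longrightarrow> w \<in> Q \<Longrightarrow>
      (\<Sum>i\<in>I. m t i * (\<Sum>k\<in>{1..t-1}. est k i)) + (\<Sum>i\<in>I. (p i * m t i) * ln (p i * m t i)) / \<eta>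
      \<le> (\<Sum>i\<in>I. w i * (\<Sum>k\<in>{1..t-1}. est k i)) + (\<Sum>i\<in>I. (p i * w i) * ln (p i * w i)) / \<eta>"
  shows "(\<Sum>t\<in>{1..T}. \<Sum>i\<in>I. (m t i - u i) * est t i) \<le>
    B * ln (card I) / \<eta> + \<eta> / 2 * (card I * (T + \<iota> / (2 * \<gamma>)))"
proof -
  have n: "0 < real (card I)" using fin nonempty by (simp add: card_gt_0_iff)
  have v0: "0 \<le> p i * m t i" if "t \<in> {1..T}" "i \<in> I" for t i
    using m_nonneg[OF that] p_pos[OF that(2)] by simp
  have xlnx: "x * ln x \<le> 0" if "0 \<le> x" "x \<le> 1" for x :: real
    by (cases "x = 0") (use that in \<open>auto intro!: mult_nonneg_nonpos\<close>)
  have "(\<Sum>t\<in>{1..T}. \<Sum>i\<in>I. (m t i - u i) * est t i) \<le>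
    ((\<Sum>i\<in>I. (p i * u i) * ln (p i * u i)) - (\<Sum>i\<in>I. (p i * m 1 i) * ln (p i * m 1 i))) / \<eta>
    + \<eta> / 2 * (\<Sum>t\<in>{1..T}. \<Sum>i\<in>I. (p i * m t i) * (est t i / p i)\<^sup>2)"
    by (rule reg_le[OF half_strongly_convex_shannon _ _ \<eta> u opt]) auto
  also have "((\<Sum>i\<in>I. (p i * u i) * ln (p i * u i)) - (\<Sum>i\<in>I. (p i * m 1 i) * ln (p i * m 1 i))) / \<eta>
    \<le> B * ln (card I) / \<eta>"
  proof (rule divide_right_mono)
    have "(\<Sum>i\<in>I. (p i * u i) * ln (p i * u i)) \<le> 0"
    proof (rule sum_nonpos)
      fix i assume i: "i \<in> I"
      have "0 \<le> p i * u i" using p_pos[OF i] Q_nonneg[OF u i] by simp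
      then show "(p i * u i) * ln (p i * u i) \<le> 0" using u1[OF i] by (rule xlnx)
    qed
    moreover have "(\<Sum>i\<in>I. - ((p i * m 1 i) * ln (p i * m 1 i)))
      \<le> (\<Sum>i\<in>I. (p i * m 1 i) * ln (card I) + 1 / card I - p i * m 1 i)"
    proof (rule sum_mono)
      fix i assume i: "i \<in> I"
      show "- ((p i * m 1 i) * ln (p i * m 1 i)) \<le> (p i * m 1 i) * ln (card I) + 1 / card I - p i * m 1 i"
        using v0[of 1 i] T i n by (intro neg_xlnx_le) auto
    qed
    moreover have "(\<Sum>i\<in>I. (p i * m 1 i) * ln (card I) + 1 / card I - p i * m 1 i) = B * ln (card I) + 1 - B"
      using Q_sum[OF m_Q, of 1] T n
      by (simp add: sum.distrib sum_subtractf sum_distrib_right[symmetric])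
    ultimately show "(\<Sum>i\<in>I. (p i * u i) * ln (p i * u i)) - (\<Sum>i\<in>I. (p i * m 1 i) * ln (p i * m 1 i))
      \<le> B * ln (card I)" using B1 by (simp add: sum_negf)
  qed (use \<eta> in simp)
  also have "\<eta> / 2 * (\<Sum>t\<in>{1..T}. \<Sum>i\<in>I. (p i * m t i) * (est t i / p i)\<^sup>2)
    \<le> \<eta> / 2 * (card I * (T + \<iota> / (2 * \<gamma>)))"
  proof (rule mult_left_mono)
    have "(\<Sum>t\<in>{1..T}. \<Sum>i\<in>I. (p i * m t i) * (est t i / p i)\<^sup>2) \<le> (\<Sum>t\<in>{1..T}. \<Sum>i\<in>I. est t i / p i)"
    proof (intro sum_mono)
      fix t i assume t: "t \<in> {1..T}" and i: "i \<in> I"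
      have "(p i * m t i * (est t i / p i)) * (est t i / p i) \<le> 1 * (est t i / p i)"
        using scaled_le[OF t i] est_nonneg[OF t i] p_pos[OF i] by (intro mult_right_mono) auto
      then show "(p i * m t i) * (est t i / p i)\<^sup>2 \<le> est t i / p i"
        by (simp only: power2_eq_square mult.assoc mult_1_left)
    qed
    also note sum_est_le
    finally show "(\<Sum>t\<in>{1..T}. \<Sum>i\<in>I. (p i * m t i) * (est t i / p i)\<^sup>2) \<le> card I * (T + \<iota> / (2 * \<gamma>))" .
  qed (use \<eta> in simp)
  finally show ?thesis by simp
qed

text \<open>In the application \<open>m / (m + \<gamma> / p) * (m * l)\<close> is the conditional
  mean of \<open>m * est\<close>, so \<open>dev\<close> bounds a martingale. This mean falls short
  of \<open>m * l\<close> by at most \<open>\<gamma> * l / p\<close>, which sums to the first term.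
  For the comparator, weighting \<open>over\<close> by \<open>u\<close> leaves the mass
  \<open>p * u\<close>, whose total is \<open>B\<close>.\<close>

lemma regret_decomposition:
  assumes u: "u \<in> Q"
    and reg: "(\<Sum>t\<in>{1..T}. \<Sum>i\<in>I. (m t i - u i) * est t i) \<le> r"
    and dev: "(\<Sum>t\<in>{1..T}. (\<Sum>i\<in>I. m t i / (m t i + \<gamma> / p i) * (m t i * l t i)) - (\<Sum>i\<in>I. m t i * est t i)) \<le> d"
  shows "(\<Sum>t\<in>{1..T}. (\<Sum>i\<in>I. m t i * l t i) - (\<Sum>i\<in>I. u i * l t i)) \<le> \<gamma> * T * card I + d + r + B * \<iota> / (2 * \<gamma>)"
proof -
  have bias: "(\<Sum>t\<in>{1..T}. \<Sum>i\<in>I. m t i * l t i - m t i / (m t i + \<gamma> / p i) * (m t i * l t i)) \<le> \<gamma> * T * card I"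
  proof -
    have "(\<Sum>t\<in>{1..T}. \<Sum>i\<in>I. m t i * l t i - m t i / (m t i + \<gamma> / p i) * (m t i * l t i))
      \<le> (\<Sum>t\<in>{1..T}. \<Sum>i\<in>I. \<gamma> * (l t i / p i))"
    proof (intro sum_mono)
      fix t i assume t: "t \<in> {1..T}" and i: "i \<in> I"
      define g where "g = \<gamma> / p i"
      have g: "0 < g" using \<gamma> p_pos[OF i] by (simp add: g_def)
      have m0: "0 \<le> m t i" by (rule m_nonneg[OF t i])
      have "m t i * l t i - m t i / (m t i + g) * (m t i * l t i) = g * l t i * (m t i / (m t i + g))"
        using g m0 by (simp add: field_simps)
      also have "\<dots> \<le> g * l t i * 1"
        using g m0 l_nonneg[OF t i] by (intro mult_left_mono) auto
      finally show "m t i * l t i - m t i / (m t i + \<gamma> / p i) * (m t i * l t i) \<le> \<gamma> * (l t i / p i)"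
        by (simp add: g_def)
    qed
    also have "\<dots> = (\<Sum>t\<in>{1..T}. \<gamma> * (\<Sum>i\<in>I. l t i / p i))" by (simp add: sum_distrib_left)
    also have "\<dots> \<le> (\<Sum>t\<in>{1..T}. \<gamma> * card I)"
      using l_sum \<gamma> by (intro sum_mono mult_left_mono) auto
    finally show ?thesis by (simp add: ac_simps)
  qed
  have "(\<Sum>t\<in>{1..T}. \<Sum>i\<in>I. u i * (est t i - l t i)) = (\<Sum>i\<in>I. u i * (\<Sum>t\<in>{1..T}. est t i - l t i))"
    by (subst sum.swap) (simp add: sum_distrib_left)
  also have "\<dots> \<le> (\<Sum>i\<in>I. u i * (\<iota> / (2 * (\<gamma> / p i))))"
    using over Q_nonneg[OF u] unfolding est_def by (intro sum_mono mult_left_mono) auto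
  also have "\<dots> = (\<Sum>i\<in>I. \<iota> / (2 * \<gamma>) * (p i * u i))"
    by (intro sum.cong refl) (simp add: field_simps)
  also have "\<dots> = B * \<iota> / (2 * \<gamma>)"
    unfolding sum_distrib_left[symmetric] Q_sum[OF u] by simp
  finally have "(\<Sum>t\<in>{1..T}. \<Sum>i\<in>I. u i * (est t i - l t i)) \<le> B * \<iota> / (2 * \<gamma>)" .
  with bias reg dev show ?thesis
    by (simp add: sum_subtractf left_diff_distrib right_diff_distrib)
qed

end

section \<open>Substitution of the learning rates\<close>

text \<open>The learning rate equates the penalty with the main part of the stability term; each is
  half of the leading term. The part of the stability term due to the overestimate is left, and
  \<open>big\<close> controls it.\<close>

lemma tuning_tsallis:
  fixes H K T \<iota> \<alpha> :: real
  assumes pos: "0 < H" "0 < K" "0 < T" "0 < \<iota>" and \<alpha>: "0 < \<alpha>" "\<alpha> < 1"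
  defines "\<gamma> \<equiv> sqrt (H * \<iota> / (2 * K * T))"
    and "\<eta> \<equiv> sqrt (2 * \<alpha> * (1 - \<alpha>) / T) * (H / K) powr (\<alpha> - 1/2)"
  assumes big: "sqrt (2 / (\<alpha> * (1 - \<alpha>))) * sqrt (H * K * T) < H * T"
  shows "K * (H / K) powr \<alpha> / \<eta>
    + \<eta> / (2 * (\<alpha> * (1 - \<alpha>))) * ((H / K) powr (- \<alpha>) * H * (T + \<alpha> * (\<iota> / (2 * \<gamma>))))
    \<le> sqrt (2 / (\<alpha> * (1 - \<alpha>))) * sqrt (H * K * T) + sqrt (2 * \<iota>) * sqrt (H * K * T) / 4"
proof -
  \<comment> \<open>Naming the square roots turns the claims into identities of rational functions;
    the power \<open>P\<close> of \<open>H / K\<close> cancels and stays opaque.\<close>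
  define h where "h = sqrt H" define k where "k = sqrt K" define t where "t = sqrt T"
  define j where "j = sqrt \<iota>" define s where "s = sqrt (2 * (\<alpha> * (1 - \<alpha>)))"
  define q where "q = (sqrt 2 :: real)"
  have p: "0 < h" "0 < k" "0 < t" "0 < j" "0 < s" "0 < q"
    using pos \<alpha> by (auto simp: h_def k_def t_def j_def s_def q_def)
  have sq: "H = h\<^sup>2" "K = k\<^sup>2" "T = t\<^sup>2" "\<iota> = j\<^sup>2" "\<alpha> * (1 - \<alpha>) = s\<^sup>2 / 2" and q2: "q * q = 2"
    using pos \<alpha> by (auto simp: h_def k_def t_def j_def s_def q_def)
  define P where "P = (H / K) powr \<alpha>"
  have P: "0 < P" using pos by (simp add: P_def)
  have "(H / K) powr (\<alpha> - 1/2) = P * (H / K) powr (- (1/2))"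
    unfolding P_def powr_add[symmetric] by simp
  also have "(H / K) powr (- (1/2)) = k / h"
    using pos by (simp add: powr_minus powr_half_sqrt real_sqrt_divide h_def k_def)
  finally have \<eta>: "\<eta> = s * k / (t * h) * P"
    by (simp add: \<eta>_def real_sqrt_divide s_def t_def mult.assoc)
  have \<gamma>: "\<gamma> = h * j / (q * k * t)"
    by (simp add: \<gamma>_def real_sqrt_divide real_sqrt_mult h_def j_def q_def k_def t_def)
  have hkt: "sqrt (H * K * T) = h * k * t" by (simp add: real_sqrt_mult h_def k_def t_def)
  have a2: "sqrt (2 / (\<alpha> * (1 - \<alpha>))) = 2 / s"
    unfolding sq using p by (simp add: real_sqrt_divide)
  have Pm: "(H / K) powr (- \<alpha>) = 1 / P" by (simp add: P_def powr_minus divide_inverse)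
  have "2 / s * (h * k * t) < h\<^sup>2 * t\<^sup>2" using big unfolding hkt a2 by (simp add: sq)
  then have "h * t * (2 / s * k) < h * t * (h * t)" by (simp add: power2_eq_square ac_simps)
  then have sk: "2 / s * k < h * t" by (rule mult_less_cancel_left_pos[THEN iffD1, rotated]) (use p in simp)
  have e1: "K * (H / K) powr \<alpha> / \<eta> = k * t * h / s"
    unfolding P_def[symmetric] unfolding \<eta> sq(2) using p P by (simp add: field_simps power2_eq_square)
  have e2: "\<iota> / (2 * \<gamma>) = q * j * k * t / (2 * h)"
    unfolding \<gamma> sq(4) using p by (simp add: field_simps power2_eq_square)
  have "\<eta> / (2 * (\<alpha> * (1 - \<alpha>))) * ((H / K) powr (- \<alpha>) * H * (T + \<alpha> * (\<iota> / (2 * \<gamma>))))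
     = s * k / (t * h) * P / s\<^sup>2 * (1 / P * h\<^sup>2 * (t\<^sup>2 + \<alpha> * (q * j * k * t / (2 * h))))"
    unfolding e2 Pm \<eta> by (simp add: sq)
  also have "\<dots> = k * h / (t * s) * (t\<^sup>2 + \<alpha> * (q * j * k * t / (2 * h)))"
    using p P by (simp add: field_simps power2_eq_square)
  also have "\<dots> = k * t * h / s + \<alpha> * (q * j * k / 4 * (2 / s * k))"
    using p by (simp add: field_simps power2_eq_square)
  \<comment> \<open>The excess contains the factor \<open>2 / s * k\<close>, which
    \<open>big\<close>, divided by \<open>h * t\<close>, bounds by \<open>h * t\<close>.\<close>
  also have "\<alpha> * (q * j * k / 4 * (2 / s * k)) \<le> 1 * (q * j * k / 4 * (h * t))"
    using p \<alpha> by (intro mult_mono[OF _ mult_left_mono[OF less_imp_le[OF sk]]]) auto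
  finally have "\<eta> / (2 * (\<alpha> * (1 - \<alpha>))) * ((H / K) powr (- \<alpha>) * H * (T + \<alpha> * (\<iota> / (2 * \<gamma>))))
     \<le> k * t * h / s + q * j * (h * k * t) / 4" by (simp add: ac_simps)
  moreover have qj: "sqrt (2 * \<iota>) = q * j" by (simp add: real_sqrt_mult q_def j_def)
  moreover have "k * t * h / s + k * t * h / s = 2 / s * (h * k * t)" by (simp add: ac_simps)
  ultimately show ?thesis unfolding e1 a2 hkt qj by linarith
qed

lemma tuning_shannon:
  fixes H K T \<iota> :: real
  assumes pos: "0 < H" "1 < K" "0 < T" "0 < \<iota>"
  defines "\<gamma> \<equiv> sqrt (H * \<iota> / (2 * K * T))"
    and "\<eta> \<equiv> sqrt (2 * H * ln K / (K * T))"
  assumes big: "sqrt (2 * ln K) * sqrt (H * K * T) < H * T"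
  shows "H * ln K / \<eta> + \<eta> / 2 * (K * (T + \<iota> / (2 * \<gamma>)))
    \<le> sqrt (2 * ln K) * sqrt (H * K * T) + sqrt (2 * \<iota>) * sqrt (H * K * T) / 4"
proof -
  define h where "h = sqrt H" define k where "k = sqrt K" define t where "t = sqrt T"
  define j where "j = sqrt \<iota>" define y where "y = sqrt (ln K)"
  define q where "q = (sqrt 2 :: real)"
  have p: "0 < h" "0 < k" "0 < t" "0 < j" "0 < y" "0 < q"
    using pos by (auto simp: h_def k_def t_def j_def y_def q_def)
  have sq: "H = h\<^sup>2" "K = k\<^sup>2" "T = t\<^sup>2" "\<iota> = j\<^sup>2" "ln K = y\<^sup>2" and q2: "q * q = 2"
    using pos by (auto simp: h_def k_def t_def j_def y_def q_def)
  have \<eta>: "\<eta> = q * h * y / (k * t)"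
    by (simp add: \<eta>_def real_sqrt_divide real_sqrt_mult h_def y_def q_def k_def t_def)
  have \<gamma>: "\<gamma> = h * j / (q * k * t)"
    by (simp add: \<gamma>_def real_sqrt_divide real_sqrt_mult h_def j_def q_def k_def t_def)
  have hkt: "sqrt (H * K * T) = h * k * t" by (simp add: real_sqrt_mult h_def k_def t_def)
  have y2: "sqrt (2 * ln K) = q * y" by (simp add: real_sqrt_mult q_def y_def)
  have "q * y * (h * k * t) < h\<^sup>2 * t\<^sup>2" using big unfolding hkt y2 by (simp add: sq)
  then have "h * t * (q * y * k) < h * t * (h * t)" by (simp add: power2_eq_square ac_simps)
  then have yk: "q * y * k < h * t" by (rule mult_less_cancel_left_pos[THEN iffD1, rotated]) (use p in simp)
  have e1: "H * ln K / \<eta> = h * y * k * t / q"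
    unfolding sq(5) \<eta> sq(1) using p by (simp add: field_simps power2_eq_square)
  also have "\<dots> = q * y * (h * k * t) / 2"
    using p q2 by (simp add: field_simps)
  finally have e1: "H * ln K / \<eta> = q * y * (h * k * t) / 2" .
  have e2: "\<iota> / (2 * \<gamma>) = q * j * k * t / (2 * h)"
    unfolding \<gamma> sq(4) using p by (simp add: field_simps power2_eq_square)
  have "\<eta> / 2 * (K * (T + \<iota> / (2 * \<gamma>))) = q * h * y / (k * t) / 2 * (k\<^sup>2 * (t\<^sup>2 + q * j * k * t / (2 * h)))"
    unfolding e2 \<eta> by (simp add: sq(2,3))
  also have "\<dots> = q * y * (h * k * t) / 2 + q * j * k / 4 * (q * y * k)"
    using p by (simp add: field_simps power2_eq_square)
  also have "q * j * k / 4 * (q * y * k) \<le> q * j * k / 4 * (h * t)"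
    using p yk by (intro mult_left_mono) auto
  finally have "\<eta> / 2 * (K * (T + \<iota> / (2 * \<gamma>))) \<le> q * y * (h * k * t) / 2 + q * j * (h * k * t) / 4"
    by (simp add: ac_simps)
  moreover have qj: "sqrt (2 * \<iota>) = q * j" by (simp add: real_sqrt_mult q_def j_def)
  ultimately show ?thesis unfolding e1 y2 hkt qj by linarith
qed

text \<open>\<gamma> equates the two biases it governs, that of the played policies and that of the
  comparator. Likewise \<open>sqrt (2 * \<iota> / T) / H\<close> minimizes over \<open>lam\<close>
  the threshold of \<open>lower_tail\<close> with \<open>B = H\<close>; the minimum is H times the
  square root of 2 \<iota> T, and \<open>H \<le> K\<close> brings it below the stated bound.\<close>

lemma tuning_bias:
  fixes H K T \<iota> :: real
  assumes pos: "0 < H" "0 < K" "0 < T" "0 < \<iota>"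
  defines "\<gamma> \<equiv> sqrt (H * \<iota> / (2 * K * T))"
  shows "\<gamma> * T * K = sqrt (2 * \<iota>) * sqrt (H * K * T) / 2"
    and "H * \<iota> / (2 * \<gamma>) = sqrt (2 * \<iota>) * sqrt (H * K * T) / 2"
    and "H \<le> K \<Longrightarrow> sqrt (2 * \<iota> / T) / H * H\<^sup>2 * T / 2 + \<iota> / (sqrt (2 * \<iota> / T) / H)
      \<le> sqrt (2 * \<iota>) * sqrt (H * K * T)"
proof -
  define h where "h = sqrt H" define k where "k = sqrt K" define t where "t = sqrt T"
  define j where "j = sqrt \<iota>"
  define q where "q = (sqrt 2 :: real)"
  have p: "0 < h" "0 < k" "0 < t" "0 < j" "0 < q"
    using pos by (auto simp: h_def k_def t_def j_def q_def)
  have sq: "H = h\<^sup>2" "K = k\<^sup>2" "T = t\<^sup>2" "\<iota> = j\<^sup>2" and q2: "q * q = 2"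
    using pos by (auto simp: h_def k_def t_def j_def q_def)
  have \<gamma>: "\<gamma> = h * j / (q * k * t)"
    by (simp add: \<gamma>_def real_sqrt_divide real_sqrt_mult h_def j_def q_def k_def t_def)
  have hkt: "sqrt (H * K * T) = h * k * t" by (simp add: real_sqrt_mult h_def k_def t_def)
  have qj: "sqrt (2 * \<iota>) = q * j" by (simp add: real_sqrt_mult q_def j_def)
  have qjt: "sqrt (2 * \<iota> / T) = q * j / t" by (simp add: real_sqrt_mult real_sqrt_divide q_def j_def t_def)
  have q': "x / q = q * x / 2" for x using p q2 by (simp add: field_simps)
  show "\<gamma> * T * K = sqrt (2 * \<iota>) * sqrt (H * K * T) / 2"
  proof -
    have "\<gamma> * T * K = h * j * k * t / q" unfolding \<gamma> sq(2,3) using p by (simp add: field_simps power2_eq_square)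
    then show ?thesis unfolding hkt qj q' by (simp add: ac_simps)
  qed
  show "H * \<iota> / (2 * \<gamma>) = sqrt (2 * \<iota>) * sqrt (H * K * T) / 2"
  proof -
    have "H * \<iota> / (2 * \<gamma>) = q * j * (h * k * t) / 2"
      unfolding \<gamma> sq(1,4) using p by (simp add: field_simps power2_eq_square)
    then show ?thesis unfolding hkt qj .
  qed
  assume "H \<le> K"
  then have hk: "h \<le> k" by (simp add: h_def k_def)
  have "sqrt (2 * \<iota> / T) / H * H\<^sup>2 * T / 2 + \<iota> / (sqrt (2 * \<iota> / T) / H) = q * j * h\<^sup>2 * t / 2 + j * t * h\<^sup>2 / q"
    unfolding qjt unfolding sq(1,3,4) using p by (simp add: field_simps power2_eq_square)
  also have "\<dots> = q * j * t * h * h" unfolding q' by (simp add: power2_eq_square ac_simps)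
  also have "\<dots> \<le> q * j * t * h * k" using p hk by (intro mult_left_mono) auto
  finally show "sqrt (2 * \<iota> / T) / H * H\<^sup>2 * T / 2 + \<iota> / (sqrt (2 * \<iota> / T) / H)
      \<le> sqrt (2 * \<iota>) * sqrt (H * K * T)" unfolding hkt qj by (simp add: ac_simps)
qed

section \<open>High-probability regret bounds\<close>

context game_tree
begin

definition plan_at :: "(nat \<Rightarrow> 'x \<Rightarrow> 'a \<Rightarrow> real) \<Rightarrow> nat \<times> 'x \<times> 'a \<Rightarrow> real" where
  "plan_at mu = (\<lambda>(h, x, a). plan par mu h x a)"

definition ps_at :: "nat \<times> 'x \<times> 'a \<Rightarrow> real" where
  "ps_at = (\<lambda>(h, x, a). ps h x)"

lemma idx_cases:
  assumes "i \<in> idx"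
  obtains h x a where "i = (h, x, a)" "h \<in> {1..H}" "x \<in> X h" "a \<in> A x"
  using assms unfolding idx_def by blast

lemma idx_nonempty: "idx \<noteq> {}"
  using K_eq_card K_ge_1 by auto

lemma ps_at_pos: "i \<in> idx \<Longrightarrow> 0 < ps_at i"
  by (erule idx_cases) (simp add: ps_at_def pstar_pos)

lemma plan_at_range: "mu \<in> Policies \<Longrightarrow> i \<in> idx \<Longrightarrow> 0 \<le> plan_at mu i \<and> plan_at mu i \<le> 1"
  by (erule idx_cases) (simp add: plan_at_def plan_nonneg plan_le_1)

lemma reach_plan_idx:
  assumes "valid_trans q0 q" "mu \<in> Policies"
  shows "(\<Sum>(h, x, a)\<in>idx. reachp q0 q par h x * plan par mu h x a) = H"
  unfolding sum_idx using reach_plan_sum[OF assms] by simp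

text \<open>p* is itself a valid transition law, so a scaled plan has mass one on each of the
  \<open>H\<close> levels. This is the constant \<open>B\<close> of \<open>ix_path\<close>.\<close>

lemma ps_plan_idx: "mu \<in> Policies \<Longrightarrow> (\<Sum>i\<in>idx. ps_at i * plan_at mu i) = H"
  using reach_plan_idx[OF valid_pstar, of mu]
  by (simp add: ps_at_def plan_at_def pstar_def split_beta)

lemma ps_plan_le_1:
  assumes mu: "mu \<in> Policies" and i: "i \<in> idx"
  shows "ps_at i * plan_at mu i \<le> 1"
proof -
  from i have "0 \<le> ps_at i" "ps_at i \<le> 1"
    by (auto elim!: idx_cases simp: ps_at_def pstar_def reachp_nonneg[OF valid_pstar] reachp_le_1[OF valid_pstar])
  then show ?thesis using plan_at_range[OF mu i] by (intro mult_le_one) auto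
qed

lemma balance_idx:
  assumes "valid_trans q0 q"
  shows "(\<Sum>(h, x, a)\<in>idx. reachp q0 q par h x / ps h x) = card idx"
proof -
  have "(\<Sum>(h, x, a)\<in>idx. reachp q0 q par h x / ps h x) = K"
    unfolding sum_idx using balance[OF assms] by simp
  then show ?thesis by (simp add: K_eq_card)
qed

lemma pairing_idx: "pairing H X A par mu f = (\<Sum>i\<in>idx. plan_at mu i * (case i of (h, x, a) \<Rightarrow> f h x a))"
  unfolding pairing_def sum_idx[symmetric] plan_at_def by (simp add: split_beta)

lemma ftrl_obj_idx:
  assumes "\<And>h S w. Psi h S w = (\<Sum>z\<in>S. \<psi> (w z))"
  shows "ftrl_obj H X A par Psi (\<lambda>h. \<eta>) f mu =
    (\<Sum>i\<in>idx. plan_at mu i * (case i of (h, x, a) \<Rightarrow> f h x a)) + (\<Sum>i\<in>idx. \<psi> (ps_at i * plan_at mu i)) / \<eta>"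
proof -
  have "(\<Sum>h\<in>{1..H}. \<Sum>z\<in>Sigma (X h) A. \<psi> (case z of (x, a) \<Rightarrow> ps h x * plan par mu h x a))
      = (\<Sum>h\<in>{1..H}. \<Sum>x\<in>X h. \<Sum>a\<in>A x. \<psi> (ps h x * plan par mu h x a))"
    using finite_X finite_A by (intro sum.cong refl) (subst sum.Sigma, auto simp: split_beta)
  also have "\<dots> = (\<Sum>i\<in>idx. \<psi> (ps_at i * plan_at mu i))"
    unfolding sum_idx[symmetric] by (simp add: plan_at_def ps_at_def split_beta)
  finally show ?thesis
    unfolding ftrl_obj_def pairing_idx by (simp add: assms sum_divide_distrib[symmetric])
qed

end

section \<open>The protocol and its concentration events\<close>

text \<open>Of the algorithm only membership in \<open>Policies\<close> is assumed, because
  concentration does not depend on how the policies are chosen. The update rule enters later,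
  through \<open>ftrl_opt\<close>.\<close>

locale play = game_tree H X A par for H and X :: "nat \<Rightarrow> 'x set" and A :: "'x \<Rightarrow> 'a set" and par +
  fixes p0 :: "'n \<Rightarrow> 'x \<Rightarrow> real" and ptr :: "'n \<Rightarrow> nat \<Rightarrow> 'x \<Rightarrow> 'a \<Rightarrow> 'x \<Rightarrow> real"
    and rew :: "'n \<Rightarrow> nat \<Rightarrow> 'x \<Rightarrow> 'a \<Rightarrow> real"
    and T :: nat and \<delta> :: real
    and M :: "'w measure" and F nu mu xs as rs
  assumes \<delta>: "0 < \<delta>" "\<delta> < 1" and T: "1 \<le> T"
    and prot: "protocol H X A par p0 ptr rew T M F nu mu xs as rs"
    and mu_Policies: "\<And>t w. t \<in> {1..T} \<Longrightarrow> w \<in> space M \<Longrightarrow> mu t w \<in> Policies"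
begin

definition \<iota> :: real where "\<iota> = ln (3 * K / \<delta>)"
definition \<gamma> :: real where "\<gamma> = sqrt (real H * \<iota> / (2 * K * real T))"

definition C :: "nat \<Rightarrow> 'w \<Rightarrow> nat \<times> 'x \<times> 'a \<Rightarrow> real" where
  "C t w = (\<lambda>(h, x, a). indicator {w \<in> space M. xs t h w = x \<and> as t h w = a} w * (1 - rs t h w))"

definition loss :: "nat \<Rightarrow> 'w \<Rightarrow> nat \<times> 'x \<times> 'a \<Rightarrow> real" where
  "loss t w = (\<lambda>(h, x, a). opp_loss par (p0 (nu t w)) (ptr (nu t w)) (rew (nu t w)) h x a)"

text \<open>One-sided deviations only: no coordinate is overestimated by too much, and the estimated
  loss of the played policies does not fall far below its conditional mean. The factor in front of
  \<open>C\<close> makes the last summand the plan times the estimate.\<close>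

definition good :: "'w \<Rightarrow> bool" where
  "good w \<longleftrightarrow> (\<forall>i\<in>idx. (\<Sum>t\<in>{1..T}. C t w i / (plan_at (mu t w) i + \<gamma> / ps_at i) - loss t w i) \<le> \<iota> / (2 * (\<gamma> / ps_at i))) \<and>
     (\<Sum>t\<in>{1..T}. (\<Sum>i\<in>idx. plan_at (mu t w) i / (plan_at (mu t w) i + \<gamma> / ps_at i) * (plan_at (mu t w) i * loss t w i))
         - (\<Sum>i\<in>idx. plan_at (mu t w) i / (plan_at (mu t w) i + \<gamma> / ps_at i) * C t w i))
       \<le> sqrt (2 * \<iota>) * sqrt (real H * K * real T)"

lemma \<iota>_pos: "0 < \<iota>" and exp_\<iota>: "exp (- \<iota>) = \<delta> / (3 * K)"
proof -
  have "\<delta> < 3 * K" using \<delta> K_ge_1 by simp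
  then have "1 < 3 * K / \<delta>" using \<delta> by simp
  then show "0 < \<iota>" "exp (- \<iota>) = \<delta> / (3 * K)" unfolding \<iota>_def by (auto simp: exp_minus)
qed

lemma \<gamma>_pos: "0 < \<gamma>"
  unfolding \<gamma>_def using \<iota>_pos H_ge_1 K_ge_1 T by simp

lemma prob: "prob_space M"
  using prot by (simp add: protocol_def)

lemma subalg: "subalgebra M (F t)"
  using prot[unfolded protocol_def, THEN conjunct2, THEN conjunct1] by simp

lemma filt: "s \<le> t \<Longrightarrow> sets (F s) \<subseteq> sets (F t)"
  using prot[unfolded protocol_def, THEN conjunct2, THEN conjunct2, THEN conjunct1] by simp

lemma opp:
  assumes "t \<in> {1..T}" "w \<in> space M"
  shows "opp_valid H X A par (p0 (nu t w)) (ptr (nu t w)) (rew (nu t w))"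
  using prot assms unfolding protocol_def by blast

lemma valid_opp: "t \<in> {1..T} \<Longrightarrow> w \<in> space M \<Longrightarrow> valid_trans (p0 (nu t w)) (ptr (nu t w))"
  using opp unfolding opp_valid_def valid_trans_def by blast

lemma observations:
  assumes "t \<in> {1..T}" "h \<in> {1..H}"
  shows "xs t h \<in> measurable (F t) (count_space UNIV)" "as t h \<in> measurable (F t) (count_space UNIV)"
    "rs t h \<in> borel_measurable (F t)" "w \<in> space M \<Longrightarrow> 0 \<le> rs t h w \<and> rs t h w \<le> 1"
  using prot[unfolded protocol_def, THEN conjunct2, THEN conjunct2, THEN conjunct2, THEN conjunct1,
      rule_format, OF assms] by simp_all

lemma space_F: "space (F t) = space M" using subalg by (simp add: subalgebra_def)

lemma C_range: "t \<in> {1..T} \<Longrightarrow> w \<in> space M \<Longrightarrow> i \<in> idx \<Longrightarrow> 0 \<le> C t w i \<and> C t w i \<le> 1"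
  by (erule idx_cases) (use observations(4) in \<open>force simp: C_def indicator_def\<close>)

lemma C_measurable: "t \<in> {1..T} \<Longrightarrow> i \<in> idx \<Longrightarrow> (\<lambda>w. C t w i) \<in> borel_measurable (F t)"
proof (erule idx_cases)
  fix h x a assume t: "t \<in> {1..T}" and i: "i = (h, x, a)" and h: "h \<in> {1..H}"
  note [measurable] = observations(1-3)[OF t h]
  have "{w \<in> space (F t). xs t h w = x \<and> as t h w = a} \<in> sets (F t)" by measurable
  then have [measurable]: "{w \<in> space M. xs t h w = x \<and> as t h w = a} \<in> sets (F t)" by (simp add: space_F)
  show ?thesis unfolding i C_def prod.case by measurable
qed

text \<open>At each step only the visited pair contributes, and its contribution is at most
  1.\<close>

lemma C_sum:
  assumes t: "t \<in> {1..T}" and w: "w \<in> space M"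
  shows "(\<Sum>i\<in>idx. C t w i) \<le> H"
proof -
  have "(\<Sum>i\<in>idx. C t w i) =
      (\<Sum>h\<in>{1..H}. \<Sum>x\<in>X h. \<Sum>a\<in>A x. if xs t h w = x \<and> as t h w = a then 1 - rs t h w else 0)"
    unfolding sum_idx[symmetric] using w by (intro sum.cong refl) (auto simp: C_def indicator_def)
  also have "\<dots> \<le> (\<Sum>h\<in>{1..H}. 1)"
  proof (rule sum_mono)
    fix h assume h: "h \<in> {1..H}"
    have "(\<Sum>x\<in>X h. \<Sum>a\<in>A x. if xs t h w = x \<and> as t h w = a then 1 - rs t h w else 0)
       = (\<Sum>z\<in>Sigma (X h) A. if (xs t h w, as t h w) = z then 1 - rs t h w else 0)"
      using finite_X[OF h] finite_A[OF h] by (subst sum.Sigma) (auto intro!: sum.cong simp del: sum.delta sum.delta')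
    also have "\<dots> \<le> 1"
      using finite_X[OF h] finite_A[OF h] observations(4)[OF t h w] by (subst sum.delta') (auto intro!: finite_SigmaI)
    finally show "(\<Sum>x\<in>X h. \<Sum>a\<in>A x. if xs t h w = x \<and> as t h w = a then 1 - rs t h w else 0) \<le> 1" .
  qed
  finally show ?thesis by simp
qed

lemma loss_le_reach:
  assumes t: "t \<in> {1..T}" and w: "w \<in> space M" and i: "(h, x, a) \<in> idx"
  shows "0 \<le> loss t w (h, x, a)" "loss t w (h, x, a) \<le> reachp (p0 (nu t w)) (ptr (nu t w)) par h x"
proof -
  have hx: "h \<in> {1..H}" "x \<in> X h" "a \<in> A x" using i by (auto simp: idx_def)
  have r: "0 \<le> rew (nu t w) h x a" "rew (nu t w) h x a \<le> 1"
    using opp[OF t w] hx unfolding opp_valid_def by blast+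
  have p: "0 \<le> reachp (p0 (nu t w)) (ptr (nu t w)) par h x"
    by (rule reachp_nonneg[OF valid_opp[OF t w] hx(1,2)])
  show "0 \<le> loss t w (h, x, a)" "loss t w (h, x, a) \<le> reachp (p0 (nu t w)) (ptr (nu t w)) par h x"
    using p r by (auto simp: loss_def opp_loss_def intro: mult_left_le)
qed

lemma loss_range:
  assumes t: "t \<in> {1..T}" and w: "w \<in> space M" and i: "i \<in> idx"
  shows "0 \<le> loss t w i \<and> loss t w i \<le> 1"
proof -
  from i obtain h x a where e: "i = (h, x, a)" and hx: "h \<in> {1..H}" "x \<in> X h" by (rule idx_cases)
  show ?thesis
    using loss_le_reach[OF t w, of h x a] reachp_le_1[OF valid_opp[OF t w] hx] i e by auto
qed

lemma loss_sum:
  assumes t: "t \<in> {1..T}" and w: "w \<in> space M"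
  shows "(\<Sum>i\<in>idx. loss t w i / ps_at i) \<le> card idx"
proof -
  have "(\<Sum>i\<in>idx. loss t w i / ps_at i) \<le> (\<Sum>(h, x, a)\<in>idx. reachp (p0 (nu t w)) (ptr (nu t w)) par h x / ps h x)"
  proof (rule sum_mono)
    fix i assume i: "i \<in> idx"
    obtain h x a where e: "i = (h, x, a)" by (cases i)
    have "0 < ps h x" using ps_at_pos[OF i] by (simp add: e ps_at_def)
    then show "loss t w i / ps_at i \<le> (case i of (h, x, a) \<Rightarrow> reachp (p0 (nu t w)) (ptr (nu t w)) par h x / ps h x)"
      using loss_le_reach(2)[OF t w] i unfolding e by (auto simp: ps_at_def intro!: divide_right_mono)
  qed
  then show ?thesis using balance_idx[OF valid_opp[OF t w]] by simp
qed

lemma pairing_loss: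
  assumes t: "t \<in> {1..T}" and w: "w \<in> space M" and m: "m \<in> Policies"
  shows "0 \<le> (\<Sum>i\<in>idx. plan_at m i * loss t w i)" "(\<Sum>i\<in>idx. plan_at m i * loss t w i) \<le> H"
proof -
  show "0 \<le> (\<Sum>i\<in>idx. plan_at m i * loss t w i)"
    using plan_at_range[OF m] loss_range[OF t w] by (intro sum_nonneg) auto
  have "(\<Sum>i\<in>idx. plan_at m i * loss t w i)
      \<le> (\<Sum>(h, x, a)\<in>idx. reachp (p0 (nu t w)) (ptr (nu t w)) par h x * plan par m h x a)"
  proof (rule sum_mono)
    fix i assume i: "i \<in> idx"
    obtain h x a where e: "i = (h, x, a)" by (cases i)
    have "plan_at m i * loss t w i \<le> plan_at m i * reachp (p0 (nu t w)) (ptr (nu t w)) par h x"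
      using plan_at_range[OF m i] loss_le_reach(2)[OF t w, of h x a] i e by (intro mult_left_mono) auto
    then show "plan_at m i * loss t w i
        \<le> (case i of (h, x, a) \<Rightarrow> reachp (p0 (nu t w)) (ptr (nu t w)) par h x * plan par m h x a)"
      by (simp add: e plan_at_def mult.commute)
  qed
  then show "(\<Sum>i\<in>idx. plan_at m i * loss t w i) \<le> H"
    using reach_plan_idx[OF valid_opp[OF t w] m] by simp
qed

lemma plan_measurable:
  assumes t: "t \<in> {1..T}" and "h \<in> {1..H}" "x \<in> X h" "a \<in> A x"
  shows "(\<lambda>w. plan par (mu t w) h x a) \<in> borel_measurable (F (t - 1))"
proof -
  have mu: "(\<lambda>w. mu t w h x a) \<in> borel_measurable (F (t - 1))" if "h \<in> {1..H}" "x \<in> X h" "a \<in> A x" for h x a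
    using prot t that unfolding protocol_def by blast
  from assms(2-4) show ?thesis
  proof (induction h arbitrary: x a rule: level_induct)
    case root
    then show ?case using mu[of 1 x a] H_ge_1 by simp
  next
    case (step h)
    have "Suc h \<in> {1..H}" using step.hyps by auto
    from step.IH[OF par_in[OF step.hyps(1) step.prems(1)]] mu[OF this step.prems] show ?case
      unfolding plan_Suc[OF step.hyps(1)] by (rule borel_measurable_times)
  qed
qed

lemma plan_at_measurable:
  assumes t: "t \<in> {1..T}" and i: "i \<in> idx"
  shows "(\<lambda>w. plan_at (mu t w) i) \<in> borel_measurable (F (t - 1))"
proof -
  from i obtain h x a where e: "i = (h, x, a)" and hx: "h \<in> {1..H}" "x \<in> X h" "a \<in> A x" by (rule idx_cases)
  show ?thesis unfolding e plan_at_def prod.case by (rule plan_measurable[OF t hx])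
qed

lemma loss_measurable:
  assumes t: "t \<in> {1..T}"
  shows "(\<lambda>w. loss t w i) \<in> borel_measurable (F (t - 1))"
proof -
  have opp_meas: "(\<lambda>w. p0 (nu t w) x) \<in> borel_measurable (F (t - 1))"
    "(\<lambda>w. ptr (nu t w) h x a x') \<in> borel_measurable (F (t - 1))"
    "(\<lambda>w. rew (nu t w) h x a) \<in> borel_measurable (F (t - 1))" for h x a x'
    using prot t unfolding protocol_def by blast+
  have reach_meas: "(\<lambda>w. reachp (p0 (nu t w)) (ptr (nu t w)) par h x) \<in> borel_measurable (F (t - 1))" for h x
  proof (induction h arbitrary: x rule: nat_induct)
    case (Suc h)
    then show ?case
      by (cases h) (auto simp del: One_nat_def intro!: borel_measurable_times opp_meas)
  qed simp
  obtain h x a where e: "i = (h, x, a)" by (cases i)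
  show ?thesis
    unfolding e loss_def opp_loss_def prod.case
    by (intro borel_measurable_times borel_measurable_diff borel_measurable_const reach_meas opp_meas)
qed

lemma C_cond_mean:
  assumes t: "t \<in> {1..T}" and i: "i \<in> idx"
  shows "has_cond_mean M (F (t - 1)) (\<lambda>w. C t w i) (\<lambda>w. plan_at (mu t w) i * loss t w i)"
proof -
  interpret prob_space M by (rule prob)
  from i obtain h x a where e: "i = (h, x, a)" and hx: "h \<in> {1..H}" "x \<in> X h" "a \<in> A x" by (rule idx_cases)
  show ?thesis
  proof (rule has_cond_meanI[where c = 1, OF subalg])
    show "(\<lambda>w. C t w i) \<in> borel_measurable M"
      by (rule measurable_from_subalg[OF subalg C_measurable[OF t i]])
    show "\<bar>C t w i\<bar> \<le> 1" if "w \<in> space M" for w using C_range[OF t that i] by auto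
    show "(\<lambda>w. plan_at (mu t w) i * loss t w i) \<in> borel_measurable M"
      by (rule measurable_from_subalg[OF subalg borel_measurable_times[OF plan_at_measurable[OF t i] loss_measurable[OF t]]])
    have "AE w in M. real_cond_exp M (F (t - 1))
            (\<lambda>w. indicator {w \<in> space M. xs t h w = x \<and> as t h w = a} w * (1 - rs t h w)) w
          = plan par (mu t w) h x a * opp_loss par (p0 (nu t w)) (ptr (nu t w)) (rew (nu t w)) h x a"
      using prot t hx unfolding protocol_def by blast
    then show "AE w in M. real_cond_exp M (F (t - 1)) (\<lambda>w. C t w i) w = plan_at (mu t w) i * loss t w i"
      by (simp add: e C_def plan_at_def loss_def)
  qed
qed

lemma ratio_range: "t \<in> {1..T} \<Longrightarrow> w \<in> space M \<Longrightarrow> i \<in> idx \<Longrightarrow>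
    0 \<le> plan_at (mu t w) i / (plan_at (mu t w) i + \<gamma> / ps_at i) \<and>
    plan_at (mu t w) i / (plan_at (mu t w) i + \<gamma> / ps_at i) \<le> 1"
proof -
  assume *: "t \<in> {1..T}" "w \<in> space M" "i \<in> idx"
  have "0 < \<gamma> / ps_at i" using \<gamma>_pos ps_at_pos[OF *(3)] by simp
  then show ?thesis using plan_at_range[OF mu_Policies[OF *(1,2)] *(3)] by simp
qed

lemma good_event: "\<exists>E\<in>sets M. measure M E \<ge> 1 - \<delta> \<and> (\<forall>w\<in>E. w \<in> space M \<and> good w)"
proof -
  interpret prob_space M by (rule prob)
  define S1 where "S1 i w = (\<Sum>t\<in>{1..T}. C t w i / (plan_at (mu t w) i + \<gamma> / ps_at i) - loss t w i)" for i w
  define k where "k t i w = plan_at (mu t w) i / (plan_at (mu t w) i + \<gamma> / ps_at i)" for t i w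
  define Y where "Y t w = (\<Sum>i\<in>idx. k t i w * C t w i)" for t w
  define e where "e t w = (\<Sum>i\<in>idx. k t i w * (plan_at (mu t w) i * loss t w i))" for t w
  define R where "R = sqrt (2 * \<iota>) * sqrt (real H * K * real T)"
  define lam where "lam = sqrt (2 * \<iota> / real T) / real H"
  define B1 where "B1 i = {w \<in> space M. \<iota> / (2 * (\<gamma> / ps_at i)) < S1 i w}" for i
  define B2 where "B2 = {w \<in> space M. R < (\<Sum>t\<in>{1..T}. e t w - Y t w)}"
  have subF: "subalgebra (F t) (F s)" if "s \<le> t" for s t
    using subalg[of s] subalg[of t] filt[OF that] by (auto simp: subalgebra_def)
  have up: "f \<in> borel_measurable (F t)" if "f \<in> borel_measurable (F (t - 1))" for f :: "'w \<Rightarrow> real" and t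
    by (rule measurable_from_subalg[OF subF that]) simp
  have up': "f \<in> borel_measurable M" if "f \<in> borel_measurable (F t)" for f :: "'w \<Rightarrow> real" and t
    by (rule measurable_from_subalg[OF subalg that])
  have k_meas: "k t i \<in> borel_measurable (F (t - 1))" if "t \<in> {1..T}" "i \<in> idx" for t i
    unfolding k_def using plan_at_measurable[OF that] by measurable
  have e_meas: "e t \<in> borel_measurable (F (t - 1))" if "t \<in> {1..T}" for t
    unfolding e_def using k_meas[OF that] plan_at_measurable[OF that] loss_measurable[OF that]
    by (intro borel_measurable_sum borel_measurable_times) auto
  have Y_meas: "Y t \<in> borel_measurable (F t)" if "t \<in> {1..T}" for t
    unfolding Y_def using up[OF k_meas[OF that]] C_measurable[OF that]
    by (intro borel_measurable_sum borel_measurable_times) auto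
  have S1_meas: "S1 i \<in> borel_measurable M" if i: "i \<in> idx" for i
    unfolding S1_def
    using up'[OF C_measurable[OF _ i]] up'[OF plan_at_measurable[OF _ i]] up'[OF loss_measurable]
    by (intro borel_measurable_sum borel_measurable_diff borel_measurable_divide borel_measurable_add) auto
  have S2_meas: "(\<lambda>w. \<Sum>t\<in>{1..T}. e t w - Y t w) \<in> borel_measurable M"
    using up'[OF e_meas] up'[OF Y_meas] by (intro borel_measurable_sum borel_measurable_diff) auto
  have B1_sets: "B1 i \<in> sets M" if "i \<in> idx" for i
    unfolding B1_def using S1_meas[OF that] by measurable
  have S2_sets: "{w \<in> space M. c < (\<Sum>t\<in>{1..T}. e t w - Y t w)} \<in> sets M" for c
    using S2_meas by measurable
  have B2_sets: "B2 \<in> sets M"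
    unfolding B2_def by (rule S2_sets)
  have B1_prob: "prob (B1 i) \<le> exp (- \<iota>)" if i: "i \<in> idx" for i
    unfolding B1_def S1_def
  proof (rule ix_tail[OF subalg filt])
    show "0 < \<gamma> / ps_at i" using \<gamma>_pos ps_at_pos[OF i] by simp
    fix t assume t: "t \<in> {1..T}"
    show "(\<lambda>w. C t w i) \<in> borel_measurable (F t)" by (rule C_measurable[OF t i])
    show "(\<lambda>w. plan_at (mu t w) i) \<in> borel_measurable (F (t - 1))" by (rule plan_at_measurable[OF t i])
    show "(\<lambda>w. loss t w i) \<in> borel_measurable (F (t - 1))" by (rule loss_measurable[OF t])
    show "has_cond_mean M (F (t - 1)) (\<lambda>w. C t w i) (\<lambda>w. plan_at (mu t w) i * loss t w i)"
      by (rule C_cond_mean[OF t i])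
    fix w assume w: "w \<in> space M"
    show "0 \<le> C t w i \<and> C t w i \<le> 1" by (rule C_range[OF t w i])
    show "0 \<le> plan_at (mu t w) i" using plan_at_range[OF mu_Policies[OF t w] i] by simp
    show "0 \<le> loss t w i \<and> loss t w i \<le> 1" by (rule loss_range[OF t w i])
  qed
  have lam: "0 < lam" using \<iota>_pos T H_ge_1 by (simp add: lam_def)
  have kr: "0 \<le> k t i w \<and> k t i w \<le> 1" if "t \<in> {1..T}" "w \<in> space M" "i \<in> idx" for t i w
    unfolding k_def using ratio_range[OF that] .
  \<comment> \<open>For this \<open>lam\<close> the threshold of \<open>lower_tail\<close> is at
    most \<open>R\<close>, so exceeding \<open>R\<close> is the rarer event.\<close>
  have "B2 \<subseteq> {w \<in> space M. lam * (real H)\<^sup>2 * T / 2 + \<iota> / lam < (\<Sum>t\<in>{1..T}. e t w - Y t w)}"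
  proof -
    have "lam * (real H)\<^sup>2 * T / 2 + \<iota> / lam \<le> R"
      unfolding lam_def R_def using H_ge_1 K_ge_1 T \<iota>_pos H_le_K by (intro tuning_bias(3)) auto
    then show ?thesis by (auto simp: B2_def)
  qed
  then have "prob B2 \<le> prob {w \<in> space M. lam * (real H)\<^sup>2 * T / 2 + \<iota> / lam < (\<Sum>t\<in>{1..T}. e t w - Y t w)}"
    by (rule finite_measure_mono[OF _ S2_sets])
  also have "\<dots> \<le> exp (- \<iota>)"
  proof (rule lower_tail[OF subalg filt _ _ _ _ lam])
    fix t assume t: "t \<in> {1..T}"
    show "Y t \<in> borel_measurable (F t)" by (rule Y_meas[OF t])
    show "e t \<in> borel_measurable (F (t - 1))" by (rule e_meas[OF t])
    \<comment> \<open>Single estimates can be of order p* / \<gamma>, but weighted by the plan they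
      are at most \<open>C\<close>. The martingale increments therefore have range \<open>H\<close>,
      independently of \<gamma>.\<close>
    show "0 \<le> Y t w \<and> Y t w \<le> H" if w: "w \<in> space M" for w
    proof
      show "0 \<le> Y t w" unfolding Y_def using kr[OF t w] C_range[OF t w] by (intro sum_nonneg) auto
      have "Y t w \<le> (\<Sum>i\<in>idx. C t w i)"
        unfolding Y_def using kr[OF t w] C_range[OF t w] by (intro sum_mono mult_left_le_one_le) auto
      then show "Y t w \<le> H" using C_sum[OF t w] by simp
    qed
    show "0 \<le> e t w \<and> e t w \<le> H" if w: "w \<in> space M" for w
    proof
      have *: "0 \<le> plan_at (mu t w) i * loss t w i" if "i \<in> idx" for i
        using plan_at_range[OF mu_Policies[OF t w] that] loss_range[OF t w that] by simp
      then show "0 \<le> e t w" unfolding e_def using kr[OF t w] by (intro sum_nonneg) auto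
      have "e t w \<le> (\<Sum>i\<in>idx. plan_at (mu t w) i * loss t w i)"
        unfolding e_def using kr[OF t w] * by (intro sum_mono mult_left_le_one_le) auto
      then show "e t w \<le> H" using pairing_loss(2)[OF t w mu_Policies[OF t w]] by simp
    qed
    show "has_cond_mean M (F (t - 1)) (Y t) (e t)"
      unfolding Y_def e_def
    proof (rule has_cond_mean_sum[OF finite_idx subalg])
      fix i assume i: "i \<in> idx"
      show "(\<lambda>w. C t w i) \<in> borel_measurable M" by (rule up'[OF C_measurable[OF t i]])
      show "(\<lambda>w. plan_at (mu t w) i * loss t w i) \<in> borel_measurable M"
        by (rule up'[OF borel_measurable_times[OF plan_at_measurable[OF t i] loss_measurable[OF t]]])
      show "k t i \<in> borel_measurable (F (t - 1))" by (rule k_meas[OF t i])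
      show "has_cond_mean M (F (t - 1)) (\<lambda>w. C t w i) (\<lambda>w. plan_at (mu t w) i * loss t w i)"
        by (rule C_cond_mean[OF t i])
      fix w assume w: "w \<in> space M"
      show "\<bar>C t w i\<bar> \<le> 1" using C_range[OF t w i] by auto
      show "\<bar>k t i w\<bar> \<le> 1" using kr[OF t w i] by auto
      show "\<bar>plan_at (mu t w) i * loss t w i\<bar> \<le> 1"
        using plan_at_range[OF mu_Policies[OF t w] i] loss_range[OF t w i]
        by (auto simp: abs_mult intro!: mult_le_one)
    qed
  qed
  finally have B2_prob: "prob B2 \<le> exp (- \<iota>)" .
  define E where "E = space M - ((\<Union>i\<in>idx. B1 i) \<union> B2)"
  have bad_sets: "(\<Union>i\<in>idx. B1 i) \<in> sets M" using B1_sets finite_idx by auto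
  \<comment> \<open>The \<open>K\<close> overestimation events share \<delta> / 3, and the deviation
    event costs at most another \<delta> / 3.\<close>
  have "prob ((\<Union>i\<in>idx. B1 i) \<union> B2) \<le> prob (\<Union>i\<in>idx. B1 i) + prob B2"
    using bad_sets B2_sets by (rule measure_Un_le)
  also have "prob (\<Union>i\<in>idx. B1 i) \<le> (\<Sum>i\<in>idx. prob (B1 i))"
    using B1_sets finite_idx by (intro measure_UNION_le) auto
  also have "\<dots> \<le> (\<Sum>i\<in>idx. exp (- \<iota>))" by (intro sum_mono B1_prob)
  also have "\<dots> = K * (\<delta> / (3 * K))" by (simp add: K_eq_card exp_\<iota>)
  also have "\<dots> = \<delta> / 3" using K_ge_1 by simp
  also note B2_prob
  also have "exp (- \<iota>) \<le> \<delta> / 3"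
    unfolding exp_\<iota> using K_ge_1 \<delta> by (intro divide_left_mono) auto
  finally have "prob ((\<Union>i\<in>idx. B1 i) \<union> B2) \<le> \<delta>" using \<delta> by simp
  then have "1 - \<delta> \<le> prob E"
    unfolding E_def using bad_sets B2_sets by (subst prob_compl) auto
  moreover have "E \<in> sets M" unfolding E_def using bad_sets B2_sets by auto
  moreover have "w \<in> space M \<and> good w" if "w \<in> E" for w
    using that unfolding E_def good_def B1_def B2_def S1_def e_def Y_def k_def R_def by (auto simp: not_less)
  ultimately show ?thesis by blast
qed

lemma regret_le:
  assumes w: "w \<in> space M"
    and le: "\<And>m. m \<in> Policies \<Longrightarrow>
      (\<Sum>t\<in>{1..T}. (\<Sum>i\<in>idx. plan_at (mu t w) i * loss t w i) - (\<Sum>i\<in>idx. plan_at m i * loss t w i)) \<le> b"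
  shows "regret H X A par p0 ptr rew T nu mu w \<le> b"
  unfolding regret_def
proof (rule cSUP_least)
  \<comment> \<open>A real supremum over the empty set would be unspecified; the policy played in
    episode 1 is a witness.\<close>
  show "Policies \<noteq> {}" using mu_Policies[OF _ w, of 1] T by auto
  show "(\<Sum>t\<in>{1..T}. pairing H X A par (mu t w) (opp_loss par (p0 (nu t w)) (ptr (nu t w)) (rew (nu t w)))
      - pairing H X A par m (opp_loss par (p0 (nu t w)) (ptr (nu t w)) (rew (nu t w)))) \<le> b"
    if "m \<in> Policies" for m
    using le[OF that] unfolding pairing_idx loss_def .
qed

text \<open>The loss of a policy in one episode lies between 0 and \<open>H\<close>. This bound
  takes over when \<open>T\<close> is so small that the leading term of the claim reaches
  \<open>H * T\<close>.\<close>

lemma regret_le_HT: "w \<in> space M \<Longrightarrow> regret H X A par p0 ptr rew T nu mu w \<le> H * T"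
proof (rule regret_le)
  fix m assume w: "w \<in> space M" and m: "m \<in> Policies"
  have "(\<Sum>t\<in>{1..T}. (\<Sum>i\<in>idx. plan_at (mu t w) i * loss t w i) - (\<Sum>i\<in>idx. plan_at m i * loss t w i))
    \<le> (\<Sum>t\<in>{1..T}. real H)"
  proof (rule sum_mono)
    fix t assume t: "t \<in> {1..T}"
    show "(\<Sum>i\<in>idx. plan_at (mu t w) i * loss t w i) - (\<Sum>i\<in>idx. plan_at m i * loss t w i) \<le> real H"
      using pairing_loss(2)[OF t w mu_Policies[OF t w]] pairing_loss(1)[OF t w m] by linarith
  qed
  then show "(\<Sum>t\<in>{1..T}. (\<Sum>i\<in>idx. plan_at (mu t w) i * loss t w i) - (\<Sum>i\<in>idx. plan_at m i * loss t w i))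
    \<le> real (H * T)" by (simp add: mult.commute)
qed auto

lemma ix_path:
  assumes w: "w \<in> space M" and good: "good w"
  shows "ix_path idx ps_at (plan_at ` Policies) \<gamma> \<iota> H T (\<lambda>t. plan_at (mu t w)) (\<lambda>t. C t w) (\<lambda>t. loss t w)"
proof
  show "\<exists>v''\<in>plan_at ` Policies. \<forall>i\<in>idx. v'' i = (1 - \<epsilon>) * v i + \<epsilon> * v' i"
    if v: "v \<in> plan_at ` Policies" "v' \<in> plan_at ` Policies" and \<epsilon>: "0 < \<epsilon>" "\<epsilon> < 1" for v v' and \<epsilon> :: real
  proof -
    from v obtain m m' where m: "m \<in> Policies" "m' \<in> Policies" and e: "v = plan_at m" "v' = plan_at m'" by blast
    from plan_convex[OF m \<epsilon>] obtain m'' where m'': "m'' \<in> Policies"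
      "\<And>h x a. h \<in> {1..H} \<Longrightarrow> x \<in> X h \<Longrightarrow> a \<in> A x \<Longrightarrow>
        plan par m'' h x a = (1 - \<epsilon>) * plan par m h x a + \<epsilon> * plan par m' h x a" by blast
    then have "plan_at m'' i = (1 - \<epsilon>) * v i + \<epsilon> * v' i" if "i \<in> idx" for i
      using that by (auto elim!: idx_cases simp: plan_at_def e)
    then show ?thesis using m''(1) by blast
  qed
qed (use finite_idx idx_nonempty ps_at_pos T \<gamma>_pos H_ge_1 plan_at_range ps_plan_idx mu_Policies w C_range C_sum
    loss_range loss_sum good in \<open>auto simp: good_def\<close>)

lemma est_eq: "w \<in> space M \<Longrightarrow>
    C t w i / (plan_at (mu t w) i + \<gamma> / ps_at i) =
    (case i of (h, x, a) \<Rightarrow> ix_est H X A par (\<lambda>h. \<gamma>) mu xs as rs t w h x a)"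
  by (cases i) (simp add: C_def plan_at_def ps_at_def ix_est_def)

lemma regret_good:
  assumes w: "w \<in> space M" and good: "good w"
    and reg: "\<And>m. m \<in> Policies \<Longrightarrow> (\<Sum>t\<in>{1..T}. \<Sum>i\<in>idx. (plan_at (mu t w) i - plan_at m i) *
        ix_path.est ps_at \<gamma> (\<lambda>t. plan_at (mu t w)) (\<lambda>t. C t w) t i)
      \<le> r + sqrt (2 * \<iota>) * sqrt (real H * K * real T) / 4"
  shows "regret H X A par p0 ptr rew T nu mu w \<le> r + 3 * sqrt (2 * \<iota>) * sqrt (real H * K * real T)"
proof (rule regret_le[OF w])
  fix m assume m: "m \<in> Policies"
  interpret ix_path idx ps_at "plan_at ` Policies" \<gamma> \<iota> H T "\<lambda>t. plan_at (mu t w)" "\<lambda>t. C t w" "\<lambda>t. loss t w"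
    by (rule ix_path[OF w good])
  let ?R = "sqrt (2 * \<iota>) * sqrt (real H * K * real T)"
  have dev: "(\<Sum>t\<in>{1..T}. (\<Sum>i\<in>idx. plan_at (mu t w) i / (plan_at (mu t w) i + \<gamma> / ps_at i) * (plan_at (mu t w) i * loss t w i))
      - (\<Sum>i\<in>idx. plan_at (mu t w) i * est t i)) \<le> ?R"
    using good by (simp add: good_def est_def)
  have "(\<Sum>t\<in>{1..T}. (\<Sum>i\<in>idx. plan_at (mu t w) i * loss t w i) - (\<Sum>i\<in>idx. plan_at m i * loss t w i))
    \<le> \<gamma> * T * card idx + ?R + (r + ?R / 4) + H * \<iota> / (2 * \<gamma>)"
    by (rule regret_decomposition[OF _ reg[OF m] dev]) (use m in auto)
  also have "\<gamma> * T * card idx = ?R / 2"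
    unfolding K_eq_card[symmetric] \<gamma>_def using H_ge_1 K_ge_1 T \<iota>_pos by (intro tuning_bias(1)) auto
  also have "H * \<iota> / (2 * \<gamma>) = ?R / 2"
    unfolding \<gamma>_def using H_ge_1 K_ge_1 T \<iota>_pos by (intro tuning_bias(2)) auto
  \<comment> \<open>The contributions add up to 9/4 of \<open>?R\<close>; the constant 3 leaves
    room.\<close>
  also have "?R / 2 + ?R + (r + ?R / 4) + ?R / 2 \<le> r + 3 * ?R"
    using \<iota>_pos K_ge_1 by simp
  finally show "(\<Sum>t\<in>{1..T}. (\<Sum>i\<in>idx. plan_at (mu t w) i * loss t w i) - (\<Sum>i\<in>idx. plan_at m i * loss t w i))
    \<le> r + 3 * sqrt (2 * \<iota>) * sqrt (real H * K * real T)" by (simp add: mult.assoc)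
qed

text \<open>The objective depends on a policy only through its plan, so optimality among policies is
  optimality among the plan vectors.\<close>

lemma ftrl_opt:
  assumes bf: "balanced_ftrl H X A par Psi (\<lambda>h. \<eta>) (\<lambda>h. \<gamma>) T (space M) mu xs as rs"
    and Psi: "\<And>h S w. Psi h S w = (\<Sum>z\<in>S. \<psi> (w z))"
    and w: "w \<in> space M" and t: "t \<in> {1..T}" and v: "v \<in> plan_at ` Policies"
  defines "est \<equiv> ix_path.est ps_at \<gamma> (\<lambda>t. plan_at (mu t w)) (\<lambda>t. C t w)"
  assumes good: "good w"
  shows "(\<Sum>i\<in>idx. plan_at (mu t w) i * (\<Sum>k\<in>{1..t-1}. est k i)) + (\<Sum>i\<in>idx. \<psi> (ps_at i * plan_at (mu t w) i)) / \<eta>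
    \<le> (\<Sum>i\<in>idx. v i * (\<Sum>k\<in>{1..t-1}. est k i)) + (\<Sum>i\<in>idx. \<psi> (ps_at i * v i)) / \<eta>"
proof -
  interpret P: ix_path idx ps_at "plan_at ` Policies" \<gamma> \<iota> H T "\<lambda>t. plan_at (mu t w)" "\<lambda>t. C t w" "\<lambda>t. loss t w"
    by (rule ix_path[OF w good])
  from v obtain m where m: "m \<in> Policies" "v = plan_at m" by blast
  have cum: "(case i of (h, x, a) \<Rightarrow> ix_cum H X A par (\<lambda>h. \<gamma>) mu xs as rs (t - 1) w h x a) = (\<Sum>k\<in>{1..t-1}. est k i)" for i
    by (cases i) (simp add: ix_cum_def est_def P.est_def est_eq[OF w])
  let ?L = "ix_cum H X A par (\<lambda>h. \<gamma>) mu xs as rs (t - 1) w"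
  have obj: "ftrl_obj H X A par Psi (\<lambda>h. \<eta>) ?L m' =
      (\<Sum>i\<in>idx. plan_at m' i * (\<Sum>k\<in>{1..t-1}. est k i)) + (\<Sum>i\<in>idx. \<psi> (ps_at i * plan_at m' i)) / \<eta>" for m'
    unfolding cum[symmetric] by (rule ftrl_obj_idx) (rule Psi)
  have "ftrl_obj H X A par Psi (\<lambda>h. \<eta>) ?L (mu t w) \<le> ftrl_obj H X A par Psi (\<lambda>h. \<eta>) ?L m"
    using bf t w m(1) unfolding balanced_ftrl_def by blast
  then show ?thesis unfolding obj m(2) .
qed

end

context play
begin

section \<open>The two regularizers\<close>

lemma tsallis_bound:
  assumes \<alpha>: "0 < \<alpha>" "\<alpha> < 1"
    and bf: "balanced_ftrl H X A par (\<lambda>h. tsallis \<alpha>)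
      (\<lambda>h. sqrt (2 * \<alpha> * (1 - \<alpha>) / real T) * (real H / K) powr (\<alpha> - 1/2)) (\<lambda>h. \<gamma>) T (space M) mu xs as rs"
    and w: "w \<in> space M" and good: "good w"
  shows "regret H X A par p0 ptr rew T nu mu w
    \<le> (sqrt (2 / (\<alpha> * (1 - \<alpha>))) + 3 * sqrt (2 * \<iota>)) * sqrt (real H * K * real T)"
\<comment> \<open>The strict inequality is the hypothesis \<open>big\<close> of the tuning lemma; in
  the other case the claim is weaker than the trivial bound.\<close>
proof (cases "sqrt (2 / (\<alpha> * (1 - \<alpha>))) * sqrt (real H * K * real T) < real H * real T")
  case True
  define \<eta> where "\<eta> = sqrt (2 * \<alpha> * (1 - \<alpha>) / real T) * (real H / K) powr (\<alpha> - 1/2)"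
  have \<eta>: "0 < \<eta>" unfolding \<eta>_def using \<alpha> T H_ge_1 K_ge_1 by simp
  interpret ix_path idx ps_at "plan_at ` Policies" \<gamma> \<iota> H T "\<lambda>t. plan_at (mu t w)" "\<lambda>t. C t w" "\<lambda>t. loss t w"
    by (rule ix_path[OF w good])
  have "regret H X A par p0 ptr rew T nu mu w
    \<le> sqrt (2 / (\<alpha> * (1 - \<alpha>))) * sqrt (real H * K * real T) + 3 * sqrt (2 * \<iota>) * sqrt (real H * K * real T)"
  proof (rule regret_good[OF w good])
    fix m assume m: "m \<in> Policies"
    have "(\<Sum>t\<in>{1..T}. \<Sum>i\<in>idx. (plan_at (mu t w) i - plan_at m i) * est t i) \<le>
      card idx * (H / card idx) powr \<alpha> / \<eta>
      + \<eta> / (2 * (\<alpha> * (1 - \<alpha>))) * ((H / card idx) powr (- \<alpha>) * H * (T + \<alpha> * (\<iota> / (2 * \<gamma>))))"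
    proof (rule reg_tsallis[OF \<alpha> \<eta>])
      show "plan_at m \<in> plan_at ` Policies" using m by blast
      show "(\<Sum>i\<in>idx. plan_at (mu t w) i * (\<Sum>k\<in>{1..t-1}. est k i))
          + (\<Sum>i\<in>idx. - ((ps_at i * plan_at (mu t w) i) powr \<alpha>)) / \<eta>
        \<le> (\<Sum>i\<in>idx. v i * (\<Sum>k\<in>{1..t-1}. est k i)) + (\<Sum>i\<in>idx. - ((ps_at i * v i) powr \<alpha>)) / \<eta>"
        if "t \<in> {1..T}" "v \<in> plan_at ` Policies" for t v
        by (rule ftrl_opt[OF bf[folded \<eta>_def] _ w that good, where \<psi> = "\<lambda>s. - (s powr \<alpha>)"])
          (simp add: tsallis_def sum_negf)
    qed
    also have "\<dots> \<le> sqrt (2 / (\<alpha> * (1 - \<alpha>))) * sqrt (real H * K * real T) + sqrt (2 * \<iota>) * sqrt (real H * K * real T) / 4"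
      unfolding K_eq_card[symmetric] \<gamma>_def \<eta>_def
      using \<alpha> T H_ge_1 K_ge_1 \<iota>_pos True by (intro tuning_tsallis) auto
    finally show "(\<Sum>t\<in>{1..T}. \<Sum>i\<in>idx. (plan_at (mu t w) i - plan_at m i) * est t i) \<le>
      sqrt (2 / (\<alpha> * (1 - \<alpha>))) * sqrt (real H * K * real T) + sqrt (2 * \<iota>) * sqrt (real H * K * real T) / 4" .
  qed
  then show ?thesis by (simp add: distrib_right)
next
  case False
  have "0 \<le> 3 * sqrt (2 * \<iota>) * sqrt (real H * K * real T)" using \<iota>_pos K_ge_1 by simp
  then show ?thesis using regret_le_HT[OF w] False by (simp add: distrib_right)
qed

lemma shannon_bound:
  assumes bf: "balanced_ftrl H X A par (\<lambda>h. shannon)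
      (\<lambda>h. sqrt (2 * real H * ln K / (K * real T))) (\<lambda>h. \<gamma>) T (space M) mu xs as rs"
    and w: "w \<in> space M" and good: "good w"
  shows "regret H X A par p0 ptr rew T nu mu w
    \<le> (sqrt (2 * ln K) + 3 * sqrt (2 * \<iota>)) * sqrt (real H * K * real T)"
proof -
  let ?S = "sqrt (real H * K * real T)"
  have rhs: "0 \<le> 3 * sqrt (2 * \<iota>) * ?S" "0 \<le> sqrt (2 * ln K) * ?S" using \<iota>_pos K_ge_1 by simp_all
  consider "K = 1" | "real H * real T \<le> sqrt (2 * ln K) * ?S" | "1 < K" "sqrt (2 * ln K) * ?S < real H * real T"
    using K_ge_1 by linarith
  then show ?thesis
  proof cases
    case 1
    \<comment> \<open>Here \<open>\<eta> = 0\<close>, so the objective carries no regularizer, but there is only one plan.\<close>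
    then have "card idx = 1" using K_eq_card by simp
    then obtain i where i: "idx = {i}" by (rule card_1_singletonE)
    \<comment> \<open>With a single coordinate, the mass constraint of \<open>ps_plan_idx\<close>
      determines the plan.\<close>
    have "plan_at m i = H / ps_at i" if "m \<in> Policies" for m
      using ps_plan_idx[OF that] ps_at_pos[of i] by (simp add: i field_simps)
    then have "regret H X A par p0 ptr rew T nu mu w \<le> 0"
      using mu_Policies[OF _ w] by (intro regret_le[OF w]) (simp add: i)
    then show ?thesis using rhs by (simp add: distrib_right)
  next
    case 2
    then show ?thesis using regret_le_HT[OF w] rhs by (simp add: distrib_right)
  next
    case 3
    define \<eta> where "\<eta> = sqrt (2 * real H * ln K / (K * real T))"
    have \<eta>: "0 < \<eta>" unfolding \<eta>_def using T H_ge_1 3 by simp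
    interpret ix_path idx ps_at "plan_at ` Policies" \<gamma> \<iota> H T "\<lambda>t. plan_at (mu t w)" "\<lambda>t. C t w" "\<lambda>t. loss t w"
      by (rule ix_path[OF w good])
    have "regret H X A par p0 ptr rew T nu mu w \<le> sqrt (2 * ln K) * ?S + 3 * sqrt (2 * \<iota>) * ?S"
    proof (rule regret_good[OF w good])
      fix m assume m: "m \<in> Policies"
      have "(\<Sum>t\<in>{1..T}. \<Sum>i\<in>idx. (plan_at (mu t w) i - plan_at m i) * est t i) \<le>
        H * ln (card idx) / \<eta> + \<eta> / 2 * (card idx * (T + \<iota> / (2 * \<gamma>)))"
      proof (rule reg_shannon[OF \<eta>])
        show "plan_at m \<in> plan_at ` Policies" using m by blast
        show "ps_at i * plan_at m i \<le> 1" if "i \<in> idx" for i by (rule ps_plan_le_1[OF m that])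
        show "1 \<le> real H" using H_ge_1 by simp
        show "(\<Sum>i\<in>idx. plan_at (mu t w) i * (\<Sum>k\<in>{1..t-1}. est k i))
            + (\<Sum>i\<in>idx. ps_at i * plan_at (mu t w) i * ln (ps_at i * plan_at (mu t w) i)) / \<eta>
          \<le> (\<Sum>i\<in>idx. v i * (\<Sum>k\<in>{1..t-1}. est k i)) + (\<Sum>i\<in>idx. ps_at i * v i * ln (ps_at i * v i)) / \<eta>"
          if "t \<in> {1..T}" "v \<in> plan_at ` Policies" for t v
          by (rule ftrl_opt[OF bf[folded \<eta>_def] _ w that good, where \<psi> = "\<lambda>s. s * ln s"])
            (simp add: shannon_def)
      qed
      also have "\<dots> \<le> sqrt (2 * ln K) * ?S + sqrt (2 * \<iota>) * ?S / 4"
        unfolding K_eq_card[symmetric] \<gamma>_def \<eta>_def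
        using T H_ge_1 3 \<iota>_pos by (intro tuning_shannon) auto
      finally show "(\<Sum>t\<in>{1..T}. \<Sum>i\<in>idx. (plan_at (mu t w) i - plan_at m i) * est t i) \<le>
        sqrt (2 * ln K) * ?S + sqrt (2 * \<iota>) * ?S / 4" .
    qed
    then show ?thesis by (simp add: distrib_right)
  qed
qed

end

theorem theorem3:
  fixes H :: nat and X :: "nat \<Rightarrow> 'x set" and A :: "'x \<Rightarrow> 'a set" and par :: "'x \<Rightarrow> 'x \<times> 'a"
    and p0 :: "'n \<Rightarrow> 'x \<Rightarrow> real" and ptr :: "'n \<Rightarrow> nat \<Rightarrow> 'x \<Rightarrow> 'a \<Rightarrow> 'x \<Rightarrow> real"
    and rew :: "'n \<Rightarrow> nat \<Rightarrow> 'x \<Rightarrow> 'a \<Rightarrow> real"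
    and T :: nat and \<delta> :: real
  assumes tree: "infoset_tree H X A par"
    and \<delta>: "0 < \<delta>" "\<delta> < 1"
    and T: "1 \<le> T"
  defines "\<iota> \<equiv> ln (3 * A_X H X A / \<delta>)"
  defines "\<gamma> \<equiv> (\<lambda>h::nat. sqrt (real H * \<iota> / (2 * A_X H X A * real T)))"
  shows
    "(\<forall>(\<alpha>::real) (M :: 'w measure) F nu mu xs as rs.
        0 < \<alpha> \<and> \<alpha> < 1 \<and>
        protocol H X A par p0 ptr rew T M F nu mu xs as rs \<and>
        balanced_ftrl H X A par (\<lambda>h. tsallis \<alpha>)
          (\<lambda>h. sqrt (2 * \<alpha> * (1 - \<alpha>) / real T) * (real H / A_X H X A) powr (\<alpha> - 1/2))
          \<gamma> T (space M) mu xs as rs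
      \<longrightarrow> (\<exists>E\<in>sets M. measure M E \<ge> 1 - \<delta> \<and>
            (\<forall>w\<in>E. regret H X A par p0 ptr rew T nu mu w
               \<le> (sqrt (2 / (\<alpha> * (1 - \<alpha>))) + 3 * sqrt (2 * \<iota>)) * sqrt (real H * A_X H X A * real T))))
   \<and>
    (\<forall>(M :: 'w measure) F nu mu xs as rs.
        protocol H X A par p0 ptr rew T M F nu mu xs as rs \<and>
        balanced_ftrl H X A par (\<lambda>h. shannon)
          (\<lambda>h. sqrt (2 * real H * ln (A_X H X A) / (A_X H X A * real T)))
          \<gamma> T (space M) mu xs as rs
      \<longrightarrow> (\<exists>E\<in>sets M. measure M E \<ge> 1 - \<delta> \<and>
            (\<forall>w\<in>E. regret H X A par p0 ptr rew T nu mu w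
               \<le> (sqrt (2 * ln (A_X H X A)) + 3 * sqrt (2 * \<iota>)) * sqrt (real H * A_X H X A * real T))))"
proof (intro conjI allI impI; elim conjE)
  fix \<alpha> :: real and M :: "'w measure" and F nu mu xs as rs
  assume \<alpha>: "0 < \<alpha>" "\<alpha> < 1" and prot: "protocol H X A par p0 ptr rew T M F nu mu xs as rs"
    and bf: "balanced_ftrl H X A par (\<lambda>h. tsallis \<alpha>)
          (\<lambda>h. sqrt (2 * \<alpha> * (1 - \<alpha>) / real T) * (real H / A_X H X A) powr (\<alpha> - 1/2))
          \<gamma> T (space M) mu xs as rs"
  interpret play H X A par p0 ptr rew T \<delta> M F nu mu xs as rs
    using tree \<delta> T prot bf by unfold_locales (auto simp: balanced_ftrl_def)
  have eq: "\<iota> = play.\<iota> H X A \<delta>" "\<gamma> = (\<lambda>h. play.\<gamma> H X A T \<delta>)"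
    by (simp_all add: \<iota>_def \<gamma>_def assms(5,6))
  show "\<exists>E\<in>sets M. measure M E \<ge> 1 - \<delta> \<and> (\<forall>w\<in>E. regret H X A par p0 ptr rew T nu mu w
      \<le> (sqrt (2 / (\<alpha> * (1 - \<alpha>))) + 3 * sqrt (2 * \<iota>)) * sqrt (real H * A_X H X A * real T))"
    using good_event tsallis_bound[OF \<alpha> bf[unfolded eq]] unfolding eq by blast
next
  fix M :: "'w measure" and F nu mu xs as rs
  assume prot: "protocol H X A par p0 ptr rew T M F nu mu xs as rs"
    and bf: "balanced_ftrl H X A par (\<lambda>h. shannon)
          (\<lambda>h. sqrt (2 * real H * ln (A_X H X A) / (A_X H X A * real T)))
          \<gamma> T (space M) mu xs as rs"
  interpret play H X A par p0 ptr rew T \<delta> M F nu mu xs as rs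
    using tree \<delta> T prot bf by unfold_locales (auto simp: balanced_ftrl_def)
  have eq: "\<iota> = play.\<iota> H X A \<delta>" "\<gamma> = (\<lambda>h. play.\<gamma> H X A T \<delta>)"
    by (simp_all add: \<iota>_def \<gamma>_def assms(5,6))
  show "\<exists>E\<in>sets M. measure M E \<ge> 1 - \<delta> \<and> (\<forall>w\<in>E. regret H X A par p0 ptr rew T nu mu w
      \<le> (sqrt (2 * ln (A_X H X A)) + 3 * sqrt (2 * \<iota>)) * sqrt (real H * A_X H X A * real T))"
    using good_event shannon_bound[OF bf[unfolded eq]] unfolding eq by blast
qed

end
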